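(* Consider the full prior-driven system $\dot{\mathbf x}=\mathbf A\mathbf x+\mathbf L_{\mathrm{pr}}\mathbf u$, $\mathbf x(0)=\mathbf 0$, $\mathbf y_\epsilon=\mathbf\Gamma_\epsilon^{-1/2}\mathbf C\mathbf x$ and its reduced version $\dot{\mathbf x}_r=\mathbf A_r\mathbf x_r+\mathbf L_{\mathrm{pr},r}\mathbf u$, $\mathbf x_r(0)=\mathbf 0$, $\mathbf y_{\epsilon,r}=\mathbf\Gamma_\epsilon^{-1/2}\mathbf C_r\mathbf x_r$ obtained by prior-driven balanced truncation (as defined in the context) with $r\le s$. Let $\mathbf S\in\mathbb R^{d\times r}$ be a solution of the Sylvester equation $$\mathbf A^\top\mathbf S+\mathbf S\mathbf A_r+\mathbf C^\top\mathbf\Gamma_\epsilon^{-1}\mathbf C_r=\mathbf 0,$$ and let $\bar{\mathbf S}\in\mathbb R^{(d-r)\times r}$ collect the last $d-r$ rows of $\mathbf S$. Similarly, let $\bar{\mathbf V},\bar{\mathbf W}\in\mathbb R^{d\times(d-r)}$ collect the last $d-r$ columns of $\mathbf V,\mathbf W$, and let $\bar{\mathbf\Sigma}=\mathrm{diag}(\sigma_{r+1},\dots,\sigma_d)\in\mathbb R^{(d-r)\times(d-r)}$ be the diagonal matrix of truncated Hankel singular values of $\mathbf P_{\mathrm{PD}}\mathbf Q_\epsilon$. Let $\bar{\mathbf L}_{\mathrm{pr}}=\bar{\mathbf V}^\top\mathbf L_{\mathrm{pr}}\in\mathbb R^{(d-r)\times s}$ and $\bar{\mathbf A}=\mathbf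 V_r^\top\mathbf A\bar{\mathbf W}\in\mathbb R^{r\times(d-r)}$. Then, for the output functions $\mathbf y_\epsilon$ of the full system and $\mathbf y_{\epsilon,r}$ of the balanced, rank-$r$ reduced system, i.e. $\mathbf y_\epsilon(t)=\mathbf\Gamma_\epsilon^{-1/2}\mathbf C e^{\mathbf A t}\mathbf L_{\mathrm{pr}}\mathbf z$ and $\mathbf y_{\epsilon,r}(t)=\mathbf\Gamma_\epsilon^{-1/2}\mathbf C_r e^{\mathbf A_r t}\mathbf L_{\mathrm{pr},r}\mathbf z$ (responses to the impulse input $\mathbf u(t)=\delta(t)\mathbf z$ with $\mathbf z\sim\mathcal N(\mathbf 0,\mathbf I_s)$), $$\mathbb E_{\mathbf z}\Big[\|\mathbf y_\epsilon-\mathbf y_{\epsilon,r}\|_{L_2}^2\Big]\le s\cdot\mathrm{trace}\big[(\bar{\mathbf L}_{\mathrm{pr}}\bar{\mathbf L}_{\mathrm{pr}}^\top+2\bar{\mathbf S}\bar{\mathbf A})\bar{\mathbf\Sigma}\big].$$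
   Context: **Data.** Let $\mathbf A\in\mathbb R^{d\times d}$ be stable (all eigenvalues in the open left half-plane), $\mathbf C\in\mathbb R^{d_{\mathrm{out}}\times d}$, and $\mathbf\Gamma_\epsilon\in\mathbb R^{d_{\mathrm{out}}\times d_{\mathrm{out}}}$ symmetric positive definite. Let $\mathbf\Gamma_{\mathrm{pr}}\in\mathbb R^{d\times d}$ be symmetric positive semidefinite of rank $s$, with $\mathbf\Gamma_{\mathrm{pr}}=\mathbf L_{\mathrm{pr}}\mathbf L_{\mathrm{pr}}^\top$, $\mathbf L_{\mathrm{pr}}\in\mathbb R^{d\times s}$. $\delta$ denotes the Dirac delta. **Gramians.** $\mathbf P_{\mathrm{PD}}$ is the solution of $\mathbf A\mathbf P_{\mathrm{PD}}+\mathbf P_{\mathrm{PD}}\mathbf A^\top=-\mathbf\Gamma_{\mathrm{pr}}$, and $\mathbf Q_\epsilon=\int_0^\infty e^{\mathbf A^\top t}\mathbf C^\top\mathbf\Gamma_\epsilon^{-1}\mathbf C e^{\mathbf A t}\,dt$. Both may be rank-deficient. The numbers $\sigma_1\ge\dots\ge\sigma_d\ge0$ (Hankel singular values) are the square roots of the eigenvalues of $\mathbf P_{\mathrm{PD}}\mathbf Q_\epsilon$. **Balancing bases.** $\mathbf W\in\mathbb R^{d\times d}$ is an invertible matrix of right eigenvectors, $\mathbf P_{\mathrm{PD}}\mathbf Q_\epsilon\mathbf W=\mathbf W\,\mathrm{diag}(\sigma_1^2,\dots,\sigma_d^2)$, and $\mathbf V\in\mathbb R^{d\times d}$ is the matrix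 of associated left eigenvectors, $\mathbf V^\top\mathbf P_{\mathrm{PD}}\mathbf Q_\epsilon=\mathrm{diag}(\sigma_1^2,\dots,\sigma_d^2)\mathbf V^\top$, with $\mathbf V^\top\mathbf W=\mathbf I_d$. If $q$ is the number of nonzero $\sigma_i$, the first $q$ columns $\mathbf W_q,\mathbf V_q$ are normalized by $\mathbf V_q^\top\mathbf P_{\mathrm{PD}}\mathbf V_q=\mathrm{diag}(\sigma_1,\dots,\sigma_q)=\mathbf W_q^\top\mathbf Q_\epsilon\mathbf W_q$ (these are obtained from a singular value decomposition $\mathbf R^\top\mathbf L=\mathbf U\mathbf\Sigma\mathbf Z^\top$, where $\mathbf P_{\mathrm{PD}}=\mathbf L\mathbf L^\top$ and $\mathbf Q_\epsilon=\mathbf R\mathbf R^\top$, via $\mathbf W_q=\mathbf L\mathbf Z_q\mathbf\Sigma_q^{-1/2}$, $\mathbf V_q=\mathbf R\mathbf U_q\mathbf\Sigma_q^{-1/2}$, where $\mathbf U_q,\mathbf Z_q$ are the first $q$ columns of $\mathbf U,\mathbf Z$ and $\mathbf\Sigma_q=\mathrm{diag}(\sigma_1,\dots,\sigma_q)$). **Reduced system.** $\mathbf W_r,\mathbf V_r\in\mathbb R^{d\times r}$ are the first $r$ columns of $\mathbf W,\mathbf V$, and $\mathbf A_r=\mathbf V_r^\top\mathbf A\mathbf W_r$, $\mathbf L_{\mathrm{pr},r}=\mathbf V_r^\top\mathbf L_{\mathrm{pr}}$, $\mathbf C_r=\mathbf C\mathbf W_r$. **Norm.** $\|\mathbf f\|_{L_2}^2=\int_0^\infty\|\mathbf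 f(t)\|_2^2\,dt$ for vector-valued $\mathbf f$.
   Formalization: S̄ collects the last d−r rows of WᵀS (S in balanced coordinates), since with S itself the bound can be negative; and if r exceeds the number q of nonzero σ_i, VᵀP_PD V and WᵀQ_ε W are also assumed diagonal, since arbitrary null eigenvectors can give infinite error against bound 0. *)

theory Defs
  imports
    "HOL-Probability.Probability"
    "Jordan_Normal_Form.Char_Poly"
    "Jordan_Normal_Form.DL_Rank"
begin

definition sym_psd :: "nat \<Rightarrow> real mat \<Rightarrow> bool" where
  "sym_psd n M \<longleftrightarrow> M \<in> carrier_mat n n \<and> transpose_mat M = M \<and>
     (\<forall>v \<in> carrier_vec n. 0 \<le> scalar_prod v (M *\<^sub>v v))"

definition sym_pd :: "nat \<Rightarrow> real mat \<Rightarrow> bool" where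
  "sym_pd n M \<longleftrightarrow> M \<in> carrier_mat n n \<and> transpose_mat M = M \<and>
     (\<forall>v \<in> carrier_vec n. v \<noteq> 0\<^sub>v n \<longrightarrow> 0 < scalar_prod v (M *\<^sub>v v))"

definition stable_mat :: "real mat \<Rightarrow> bool" where
  "stable_mat A \<longleftrightarrow> (\<forall>k. eigenvalue (map_mat complex_of_real A) k \<longrightarrow> Re k < 0)"

definition mat_trace :: "real mat \<Rightarrow> real" where
  "mat_trace M = (\<Sum>i<dim_row M. M $$ (i, i))"

text \<open>The power series of the exponential, summed entrywise; \<open>A\<close> is meant to be square.\<close>
definition mat_exp :: "real mat \<Rightarrow> real mat" where
  "mat_exp A = mat (dim_row A) (dim_row A) (\<lambda>ij. \<Sum>k. (A ^\<^sub>m k) $$ ij / fact k)"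

definition take_cols :: "nat \<Rightarrow> 'a mat \<Rightarrow> 'a mat" where
  "take_cols r M = mat (dim_row M) r (\<lambda>(i, j). M $$ (i, j))"

definition drop_cols :: "nat \<Rightarrow> 'a mat \<Rightarrow> 'a mat" where
  "drop_cols r M = mat (dim_row M) (dim_col M - r) (\<lambda>(i, j). M $$ (i, r + j))"

definition drop_rows :: "nat \<Rightarrow> 'a mat \<Rightarrow> 'a mat" where
  "drop_rows r M = mat (dim_row M - r) (dim_col M) (\<lambda>(i, j). M $$ (r + i, j))"

text \<open>The entrywise integral over \<open>t \<ge> 0\<close> of
  \<open>exp (t A)\<^sup>T C\<^sup>T N C exp (t A)\<close>; the weight \<open>N\<close> will be the inverse noise covariance.\<close>
definition obs_gramian :: "real mat \<Rightarrow> real mat \<Rightarrow> real mat \<Rightarrow> real mat" where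
  "obs_gramian A C N = mat (dim_row A) (dim_row A) (\<lambda>ij.
     set_lebesgue_integral lborel {0..} (\<lambda>t.
       (transpose_mat (mat_exp (t \<cdot>\<^sub>m A)) * transpose_mat C * N * C * mat_exp (t \<cdot>\<^sub>m A)) $$ ij))"

text \<open>Indices start at 0 throughout: \<open>\<sigma> 0 \<ge> \<dots> \<ge> \<sigma> (d - 1) \<ge> 0\<close> are the square roots of
  the eigenvalues of \<open>P Q\<close>, counted with algebraic multiplicity.\<close>
definition hankel_singular_values :: "nat \<Rightarrow> real mat \<Rightarrow> real mat \<Rightarrow> (nat \<Rightarrow> real) \<Rightarrow> bool" where
  "hankel_singular_values d P Q \<sigma> \<longleftrightarrow>
     (\<forall>i<d. 0 \<le> \<sigma> i) \<and> (\<forall>i j. i \<le> j \<longrightarrow> j < d \<longrightarrow> \<sigma> j \<le> \<sigma> i) \<and>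
     char_poly (P * Q) = (\<Prod>i<d. [:- (\<sigma> i)\<^sup>2, 1:])"

definition num_nonzero :: "nat \<Rightarrow> (nat \<Rightarrow> real) \<Rightarrow> nat" where
  "num_nonzero d \<sigma> = card {i. i < d \<and> \<sigma> i \<noteq> 0}"

definition balancing_bases ::
  "nat \<Rightarrow> real mat \<Rightarrow> real mat \<Rightarrow> (nat \<Rightarrow> real) \<Rightarrow> real mat \<Rightarrow> real mat \<Rightarrow> bool" where
  "balancing_bases d P Q \<sigma> W V \<longleftrightarrow>
     W \<in> carrier_mat d d \<and> V \<in> carrier_mat d d \<and>
     P * Q * W = W * mat_diag d (\<lambda>i. (\<sigma> i)\<^sup>2) \<and>
     transpose_mat V * (P * Q) = mat_diag d (\<lambda>i. (\<sigma> i)\<^sup>2) * transpose_mat V \<and>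
     transpose_mat V * W = 1\<^sub>m d \<and>
     (let q = num_nonzero d \<sigma>; W\<^sub>q = take_cols q W; V\<^sub>q = take_cols q V in
        transpose_mat V\<^sub>q * P * V\<^sub>q = mat_diag q \<sigma> \<and>
        transpose_mat W\<^sub>q * Q * W\<^sub>q = mat_diag q \<sigma>)"

text \<open>Zero-state response of \<open>x' = A x + B u\<close>, \<open>y = G C x\<close> to the input \<open>u(t) = \<delta>(t) z\<close>.\<close>
definition impulse_response ::
  "real mat \<Rightarrow> real mat \<Rightarrow> real mat \<Rightarrow> real mat \<Rightarrow> real vec \<Rightarrow> real \<Rightarrow> real vec" where
  "impulse_response G C A B z t = (G * C * mat_exp (t \<cdot>\<^sub>m A) * B) *\<^sub>v z"

text \<open>The squared norm in \<open>L\<^sub>2([0, \<infinity>))\<close> of a vector-valued function, with value \<open>\<infinity>\<close> when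
  the function is not square integrable.\<close>
definition L2_norm_sq :: "(real \<Rightarrow> real vec) \<Rightarrow> ennreal" where
  "L2_norm_sq f = (\<integral>\<^sup>+t\<in>{0..}. ennreal (scalar_prod (f t) (f t)) \<partial>lborel)"

text \<open>\<open>Z \<sim> N(0, I\<^sub>s)\<close>, given by its \<open>s\<close> independent standard normal components.\<close>
definition std_normal_vector :: "nat \<Rightarrow> 'w measure \<Rightarrow> ('w \<Rightarrow> real vec) \<Rightarrow> bool" where
  "std_normal_vector s M Z \<longleftrightarrow> prob_space M \<and>
     (\<forall>\<omega> \<in> space M. Z \<omega> \<in> carrier_vec s) \<and>
     prob_space.indep_vars M (\<lambda>_. borel) (\<lambda>i \<omega>. Z \<omega> $ i) {..<s} \<and>
     (\<forall>i<s. distributed M lborel (\<lambda>\<omega>. Z \<omega> $ i) std_normal_density)"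

end

theory Submission
  imports Defs "Jordan_Normal_Form.Spectral_Radius" "HOL-Real_Asymp.Real_Asymp"
begin

text \<open>For a fixed \<open>z\<close> let \<open>x\<close> and \<open>x\<^sub>r\<close> be the two state trajectories. If \<open>r\<close> is at most the number
  \<open>q\<close> of nonzero singular values, the function
  \<open>x\<^sup>T Q x + x\<^sub>r\<^sup>T \<Sigma>\<^sub>r x\<^sub>r - 2 x\<^sup>T S x\<^sub>r\<close> decreases exactly at the rate of the squared output error, because
  \<open>Q\<close>, \<open>\<Sigma>\<^sub>r\<close> and \<open>S\<close> solve the two observability Lyapunov equations and the Sylvester equation. Hence the
  squared error is at most its initial value, a quadratic form in \<open>z\<close> whose mean is a trace; the
  controllability Lyapunov equation turns this trace into the claimed one without the factor \<open>s\<close>. The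
  rank-deficient parts of \<open>P\<close> and \<open>Q\<close> drop out since they are uncontrollable or unobservable.
  If \<open>r > q\<close>, only uncontrollable or unobservable states are discarded, so the two systems have the same
  Markov parameters and both sides vanish.\<close>

text \<open>The normalization fixes only the leading q x q blocks of the balanced Gramians. On the
  remaining indices the blocks of P and Q have product 0 but need not be diagonal, so P and Q cannot
  simply be replaced by diagonal matrices. For r \<le> q these blocks survive as a remainder, and
  the two Lyapunov equations are needed once more to remove it from the trace. For r > q the columns
  beyond q are just some basis of the kernel of P Q, and the choice matters: if e1 is controllable
  but unobservable and e2 observable but uncontrollable, retaining e1 + e2 can give the reduced
  system a response that the full one lacks. The hypothesis \<open>r_beyond_q\<close> selects a
  basis in which every discarded state is itself uncontrollable or unobservable. A further obstacle
  is that no decay of the reduced state is available. Its diagonal storage term is therefore used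
  only through its sign and its monotonicity, which is why positivity of the retained singular
  values, hence r \<le> q, is essential for the energy argument.\<close>

unbundle no vec_syntax and no inner_syntax

subsection \<open>The matrix exponential\<close>

lemma index_mult_sum:
  fixes A B :: "'a :: semiring_0 mat"
  assumes "A \<in> carrier_mat m n" "B \<in> carrier_mat n k" "i < m" "j < k"
  shows "(A * B) $$ (i, j) = (\<Sum>l<n. A $$ (i, l) * B $$ (l, j))"
  using assms by (simp add: scalar_prod_def lessThan_atLeast0)

lemma index_mult_vec_sum:
  fixes A :: "'a :: semiring_0 mat"
  assumes "A \<in> carrier_mat m n" "v \<in> carrier_vec n" "i < m"
  shows "(A *\<^sub>v v) $ i = (\<Sum>l<n. A $$ (i, l) * v $ l)"
  using assms by (simp add: scalar_prod_def lessThan_atLeast0)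

lemma scalar_prod_sum:
  assumes "w \<in> carrier_vec n"
  shows "v \<bullet> w = (\<Sum>i<n. v $ i * w $ i)"
  using assms by (simp add: scalar_prod_def lessThan_atLeast0)

lemma pow_mat_Suc_left:
  fixes A :: "'a :: semiring_1 mat"
  assumes A: "A \<in> carrier_mat n n"
  shows "A ^\<^sub>m Suc k = A * A ^\<^sub>m k"
proof (induction k)
  case (Suc k)
  have "A ^\<^sub>m Suc (Suc k) = (A * A ^\<^sub>m k) * A"
    using Suc by simp
  also have "\<dots> = A * A ^\<^sub>m Suc k"
    using A by (simp add: assoc_mult_mat[of _ n n _ n _ n])
  finally show ?case .
qed (use A in simp)

lemma smult_pow_mat:
  fixes A :: "'a :: comm_semiring_1 mat"
  assumes A: "A \<in> carrier_mat n n"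
  shows "(t \<cdot>\<^sub>m A) ^\<^sub>m k = t ^ k \<cdot>\<^sub>m A ^\<^sub>m k"
proof (induction k)
  case (Suc k)
  show ?case
    by (rule eq_matI) (use A Suc in \<open>auto simp: index_mult_sum[of _ n n _ n] sum_distrib_left mult_ac
       simp del: index_mult_mat(1)\<close>)
qed (use A in \<open>auto intro!: eq_matI\<close>)

lemma transpose_pow_mat:
  fixes A :: "'a :: comm_semiring_1 mat"
  assumes A: "A \<in> carrier_mat n n"
  shows "transpose_mat A ^\<^sub>m k = transpose_mat (A ^\<^sub>m k)"
proof (induction k)
  case (Suc k)
  show ?case
    unfolding pow_mat_Suc_left[OF A] transpose_mult[OF A pow_carrier_mat[OF A]]
    by (simp add: Suc)
qed (use A in simp)

text \<open>The sum of the absolute values of all entries dominates every column sum, so each right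
  multiplication by \<open>A\<close> costs at most one factor \<open>K\<close>. Geometric growth is
  all that the exponential series needs.\<close>

lemma pow_mat_entry_bound:
  fixes A :: "real mat"
  assumes A: "A \<in> carrier_mat n n"
  shows "\<exists>K\<ge>0. \<forall>k. \<forall>i<n. \<forall>j<n. \<bar>(A ^\<^sub>m k) $$ (i, j)\<bar> \<le> K ^ k"
proof -
  define K where "K = (\<Sum>j<n. \<Sum>l<n. \<bar>A $$ (l, j)\<bar>)"
  have K: "K \<ge> 0"
    unfolding K_def by (intro sum_nonneg) auto
  have "\<bar>(A ^\<^sub>m k) $$ (i, j)\<bar> \<le> K ^ k" if "i < n" "j < n" for k i j
    using that
  proof (induction k arbitrary: j)
    case (Suc k)
    have "\<bar>(A ^\<^sub>m Suc k) $$ (i, j)\<bar> = \<bar>\<Sum>l<n. (A ^\<^sub>m k) $$ (i, l) * A $$ (l, j)\<bar>"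
      using Suc.prems A by (simp add: index_mult_sum[of _ n n _ n] del: index_mult_mat(1))
    also have "\<dots> \<le> (\<Sum>l<n. K ^ k * \<bar>A $$ (l, j)\<bar>)"
      by (rule order_trans[OF sum_abs sum_mono])
        (auto simp: abs_mult intro!: mult_right_mono Suc)
    also have "\<dots> = K ^ k * (\<Sum>l<n. \<bar>A $$ (l, j)\<bar>)"
      by (simp add: sum_distrib_left)
    also have "K ^ k * (\<Sum>l<n. \<bar>A $$ (l, j)\<bar>) \<le> K ^ k * K"
      unfolding K_def using Suc.prems K[unfolded K_def]
      by (intro mult_left_mono member_le_sum[where f = "\<lambda>j. \<Sum>l<n. \<bar>A $$ (l, j)\<bar>"])
        (auto intro: sum_nonneg)
    finally show ?case
      by (simp add: mult.commute)
  qed (use A in auto)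
  with K show ?thesis
    by blast
qed

text \<open>Comparison with the series of exp(K |t|). The absolute values serve the Cauchy product
  below, and the factor \<open>t ^ k\<close> is split off so that the entries are power series in
  \<open>t\<close>.\<close>

lemma summable_mat_exp:
  fixes A :: "real mat"
  assumes A: "A \<in> carrier_mat n n" and "i < n" "j < n"
  shows "summable (\<lambda>k. \<bar>(A ^\<^sub>m k) $$ (i, j) / fact k * t ^ k\<bar>)"
proof -
  obtain K where K: "K \<ge> 0" "\<And>k. \<bar>(A ^\<^sub>m k) $$ (i, j)\<bar> \<le> K ^ k"
    using pow_mat_entry_bound[OF A] assms by blast
  have "summable (\<lambda>k. (K * \<bar>t\<bar>) ^ k /\<^sub>R fact k)"
    by (rule summable_exp_generic)
  then show ?thesis
  proof (rule summable_comparison_test'[where N = 0])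
    fix k
    have "\<bar>(A ^\<^sub>m k) $$ (i, j)\<bar> * \<bar>t\<bar> ^ k / fact k \<le> K ^ k * \<bar>t\<bar> ^ k / fact k"
      by (intro divide_right_mono mult_right_mono K) auto
    then show "norm \<bar>(A ^\<^sub>m k) $$ (i, j) / fact k * t ^ k\<bar> \<le> (K * \<bar>t\<bar>) ^ k /\<^sub>R fact k"
      by (simp add: abs_mult power_abs power_mult_distrib divide_simps)
  qed
qed

lemma mat_exp_carrier [simp]:
  assumes "A \<in> carrier_mat n n"
  shows "mat_exp (t \<cdot>\<^sub>m A) \<in> carrier_mat n n"
  using assms by (simp add: mat_exp_def)

lemma mat_exp_smult_index:
  fixes A :: "real mat"
  assumes A: "A \<in> carrier_mat n n" and ij: "i < n" "j < n"
  shows "mat_exp (t \<cdot>\<^sub>m A) $$ (i, j) = (\<Sum>k. (A ^\<^sub>m k) $$ (i, j) / fact k * t ^ k)"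
  using assms by (simp add: mat_exp_def smult_pow_mat[OF A] mult.commute)

lemma mat_exp_sums:
  fixes A :: "real mat"
  assumes A: "A \<in> carrier_mat n n" and ij: "i < n" "j < n"
  shows "(\<lambda>k. (A ^\<^sub>m k) $$ (i, j) / fact k * t ^ k) sums mat_exp (t \<cdot>\<^sub>m A) $$ (i, j)"
  unfolding mat_exp_smult_index[OF assms]
  by (rule summable_sums, rule summable_rabs_cancel, rule summable_mat_exp[OF assms])

lemma mat_exp_zero:
  assumes A: "A \<in> carrier_mat n n"
  shows "mat_exp (0 \<cdot>\<^sub>m A) = 1\<^sub>m n"
proof (rule eq_matI)
  fix i j assume ij: "i < dim_row (1\<^sub>m n)" "j < dim_col (1\<^sub>m n)"
  have "(\<lambda>k. (A ^\<^sub>m k) $$ (i, j) / fact k * 0 ^ k) sums ((A ^\<^sub>m 0) $$ (i, j) / fact 0)"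
    by (rule powser_sums_zero)
  then show "mat_exp (0 \<cdot>\<^sub>m A) $$ (i, j) = 1\<^sub>m n $$ (i, j)"
    using mat_exp_sums[OF A, of i j 0] ij A sums_unique2 by fastforce
qed (use A in \<open>auto simp: mat_exp_def\<close>)

lemma transpose_mat_exp:
  fixes A :: "real mat"
  assumes A: "A \<in> carrier_mat n n"
  shows "transpose_mat (mat_exp (t \<cdot>\<^sub>m A)) = mat_exp (t \<cdot>\<^sub>m transpose_mat A)"
proof (rule eq_matI)
  fix i j assume "i < dim_row (mat_exp (t \<cdot>\<^sub>m transpose_mat A))"
    and "j < dim_col (mat_exp (t \<cdot>\<^sub>m transpose_mat A))"
  then have "i < n" "j < n"
    using A by (auto simp: mat_exp_def)
  then show "transpose_mat (mat_exp (t \<cdot>\<^sub>m A)) $$ (i, j) = mat_exp (t \<cdot>\<^sub>m transpose_mat A) $$ (i, j)"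
    using A mat_exp_carrier[OF A, of t]
    by (subst index_transpose_mat) (auto simp: mat_exp_smult_index[of _ n] transpose_pow_mat[OF A]
        carrier_matD[OF mat_exp_carrier[OF A]])
qed (use A in \<open>auto simp: mat_exp_def\<close>)

text \<open>Both products have the same coefficients \<open>A ^\<^sub>m Suc k\<close>, which yields
  commutation; the same series is the termwise derivative of the exponential, which yields the
  differential equation.\<close>

lemma
  fixes A :: "real mat"
  assumes A: "A \<in> carrier_mat n n" and ij: "i < n" "j < n"
  shows mat_exp_mult_right_sums:
      "(\<lambda>k. (A ^\<^sub>m Suc k) $$ (i, j) / fact k * t ^ k) sums (mat_exp (t \<cdot>\<^sub>m A) * A) $$ (i, j)"
    and mat_exp_mult_left_sums:
      "(\<lambda>k. (A ^\<^sub>m Suc k) $$ (i, j) / fact k * t ^ k) sums (A * mat_exp (t \<cdot>\<^sub>m A)) $$ (i, j)"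
proof -
  have "(\<lambda>k. \<Sum>l<n. (A ^\<^sub>m k) $$ (i, l) / fact k * t ^ k * A $$ (l, j))
      sums (\<Sum>l<n. mat_exp (t \<cdot>\<^sub>m A) $$ (i, l) * A $$ (l, j))"
    by (intro sums_sum sums_mult2 mat_exp_sums[OF A]) (use ij in auto)
  then show "(\<lambda>k. (A ^\<^sub>m Suc k) $$ (i, j) / fact k * t ^ k) sums (mat_exp (t \<cdot>\<^sub>m A) * A) $$ (i, j)"
    using ij A
    by (simp add: index_mult_sum[of _ n n _ n] sum_distrib_left sum_distrib_right mult_ac
        sum_divide_distrib del: index_mult_mat(1))
  have "(\<lambda>k. \<Sum>l<n. A $$ (i, l) * ((A ^\<^sub>m k) $$ (l, j) / fact k * t ^ k))
      sums (\<Sum>l<n. A $$ (i, l) * mat_exp (t \<cdot>\<^sub>m A) $$ (l, j))"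
    by (intro sums_sum sums_mult mat_exp_sums[OF A]) (use ij in auto)
  then show "(\<lambda>k. (A ^\<^sub>m Suc k) $$ (i, j) / fact k * t ^ k) sums (A * mat_exp (t \<cdot>\<^sub>m A)) $$ (i, j)"
    using ij A
    by (simp add: index_mult_sum[of _ n n _ n] sum_distrib_left sum_distrib_right mult_ac
        sum_divide_distrib pow_mat_Suc_left[OF A] del: index_mult_mat(1) pow_mat.simps(2))
qed

lemma mat_exp_commute:
  fixes A :: "real mat"
  assumes A: "A \<in> carrier_mat n n"
  shows "mat_exp (t \<cdot>\<^sub>m A) * A = A * mat_exp (t \<cdot>\<^sub>m A)"
proof (rule eq_matI)
  fix i j assume "i < dim_row (A * mat_exp (t \<cdot>\<^sub>m A))" "j < dim_col (A * mat_exp (t \<cdot>\<^sub>m A))"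
  then have "i < n" "j < n"
    using A by (auto simp: mat_exp_def)
  then show "(mat_exp (t \<cdot>\<^sub>m A) * A) $$ (i, j) = (A * mat_exp (t \<cdot>\<^sub>m A)) $$ (i, j)"
    using mat_exp_mult_left_sums[OF A] mat_exp_mult_right_sums[OF A] sums_unique2 by blast
qed (use A in \<open>auto simp: mat_exp_def\<close>)

lemma mat_exp_has_derivative:
  fixes A :: "real mat"
  assumes A: "A \<in> carrier_mat n n" and ij: "i < n" "j < n"
  shows "((\<lambda>t. mat_exp (t \<cdot>\<^sub>m A) $$ (i, j)) has_real_derivative (A * mat_exp (t \<cdot>\<^sub>m A)) $$ (i, j)) (at t)"
proof -
  let ?c = "\<lambda>k. (A ^\<^sub>m k) $$ (i, j) / fact k"
  have "((\<lambda>t. \<Sum>k. ?c k * t ^ k) has_real_derivative (\<Sum>k. diffs ?c k * t ^ k)) (at t)"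
    by (rule termdiffs_strong_converges_everywhere, rule summable_rabs_cancel,
        rule summable_mat_exp[OF assms])
  moreover have "diffs ?c k = (A ^\<^sub>m Suc k) $$ (i, j) / fact k" for k
    by (simp add: diffs_def divide_simps del: pow_mat.simps)
  ultimately show ?thesis
    using sums_unique[OF mat_exp_mult_left_sums[OF assms, of t]] assms
    by (simp add: mat_exp_smult_index del: index_mult_mat(1) pow_mat.simps)
qed

lemma mat_exp_vec_has_derivative:
  fixes A :: "real mat"
  assumes A: "A \<in> carrier_mat n n" and v: "v \<in> carrier_vec n" and i: "i < n"
  shows "((\<lambda>t. (mat_exp (t \<cdot>\<^sub>m A) *\<^sub>v v) $ i) has_real_derivative
    (A *\<^sub>v (mat_exp (t \<cdot>\<^sub>m A) *\<^sub>v v)) $ i) (at t)"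
proof -
  have "((\<lambda>t. \<Sum>l<n. mat_exp (t \<cdot>\<^sub>m A) $$ (i, l) * v $ l) has_real_derivative
      (\<Sum>l<n. (A * mat_exp (t \<cdot>\<^sub>m A)) $$ (i, l) * v $ l)) (at t)"
    by (intro DERIV_sum DERIV_cmult_right mat_exp_has_derivative[OF A i]) auto
  also have "(\<Sum>l<n. (A * mat_exp (t \<cdot>\<^sub>m A)) $$ (i, l) * v $ l) = ((A * mat_exp (t \<cdot>\<^sub>m A)) *\<^sub>v v) $ i"
    by (rule index_mult_vec_sum[symmetric, OF mult_carrier_mat[OF A mat_exp_carrier[OF A]] v i])
  finally show ?thesis
    by (simp only: index_mult_vec_sum[OF mat_exp_carrier[OF A] v i]
        assoc_mult_mat_vec[OF A mat_exp_carrier[OF A] v])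
qed

subsection \<open>Exponential decay for stable matrices\<close>

text \<open>Binomial theorem for the commuting matrices \<open>M\<close> and a I, by Pascal's rule
  on entries. Row \<open>i\<close> stays fixed because multiplication on the right only mixes
  columns.\<close>

lemma scalar_shift_pow_mat:
  fixes M :: "real mat"
  assumes M: "M \<in> carrier_mat n n" and i: "i < n"
  shows "j < n \<Longrightarrow> ((M + a \<cdot>\<^sub>m 1\<^sub>m n) ^\<^sub>m k) $$ (i, j) =
    (\<Sum>m\<le>k. of_nat (k choose m) * a ^ (k - m) * (M ^\<^sub>m m) $$ (i, j))"
proof (induction k arbitrary: j)
  case (Suc k)
  let ?N = "M + a \<cdot>\<^sub>m 1\<^sub>m n"
  let ?q = "\<lambda>m. (M ^\<^sub>m m) $$ (i, j)"
  have N: "?N \<in> carrier_mat n n" "?N ^\<^sub>m k \<in> carrier_mat n n"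
    using M by auto
  have step: "(\<Sum>l<n. (M ^\<^sub>m m) $$ (i, l) * M $$ (l, j)) = ?q (Suc m)" for m
    using M i Suc.prems by (simp add: index_mult_sum[of _ n n _ n] del: index_mult_mat(1))
  have "(?N ^\<^sub>m Suc k) $$ (i, j) = (\<Sum>l<n. (?N ^\<^sub>m k) $$ (i, l) * ?N $$ (l, j))"
    using N i Suc.prems by (simp add: index_mult_sum[of _ n n _ n] del: index_mult_mat(1))
  also have "\<dots> = (\<Sum>l<n. (?N ^\<^sub>m k) $$ (i, l) * M $$ (l, j) + (if l = j then a * (?N ^\<^sub>m k) $$ (i, j) else 0))"
    using M Suc.prems by (intro sum.cong) (auto simp: algebra_simps)
  also have "\<dots> = (\<Sum>l<n. (?N ^\<^sub>m k) $$ (i, l) * M $$ (l, j)) + a * (?N ^\<^sub>m k) $$ (i, j)"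
    using Suc.prems by (simp add: sum.distrib)
  also have "(\<Sum>l<n. (?N ^\<^sub>m k) $$ (i, l) * M $$ (l, j)) =
      (\<Sum>l<n. \<Sum>m\<le>k. of_nat (k choose m) * a ^ (k - m) * ((M ^\<^sub>m m) $$ (i, l) * M $$ (l, j)))"
    by (intro sum.cong) (auto simp: Suc.IH sum_distrib_right sum_distrib_left mult_ac)
  also have "\<dots> = (\<Sum>m\<le>k. of_nat (k choose m) * a ^ (k - m) * ?q (Suc m))"
    unfolding step[symmetric] sum_distrib_left by (rule sum.swap)
  \<comment> \<open>The range is extended by m = Suc k, whose binomial coefficient is 0; after
    splitting off m = 0 the other half of Pascal's rule stands over the same range.\<close>
  also have "a * (?N ^\<^sub>m k) $$ (i, j) = (\<Sum>m\<le>Suc k. of_nat (k choose m) * a ^ (Suc k - m) * ?q m)"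
    by (simp add: Suc.IH[OF Suc.prems] sum_distrib_left Suc_diff_le mult_ac del: pow_mat.simps)
  also have "\<dots> = a ^ Suc k * ?q 0 + (\<Sum>m\<le>k. of_nat (k choose Suc m) * a ^ (k - m) * ?q (Suc m))"
    by (subst sum.atMost_Suc_shift) simp
  also have "(\<Sum>m\<le>k. of_nat (k choose m) * a ^ (k - m) * ?q (Suc m)) + \<dots> =
      (\<Sum>m\<le>Suc k. of_nat (Suc k choose m) * a ^ (Suc k - m) * ?q m)"
    by (subst sum.atMost_Suc_shift) (simp add: algebra_simps sum.distrib del: pow_mat.simps)
  finally show ?case .
qed (use M in simp)

text \<open>The Cauchy product of the series of exp(t M) and exp(a t) has exactly the binomial sums
  as coefficients.\<close>

lemma mat_exp_scalar_shift:
  fixes M :: "real mat"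
  assumes M: "M \<in> carrier_mat n n" and ij: "i < n" "j < n"
  shows "mat_exp (t \<cdot>\<^sub>m (M + a \<cdot>\<^sub>m 1\<^sub>m n)) $$ (i, j) = exp (a * t) * mat_exp (t \<cdot>\<^sub>m M) $$ (i, j)"
proof -
  let ?f = "\<lambda>m. (M ^\<^sub>m m) $$ (i, j) / fact m * t ^ m"
  let ?g = "\<lambda>m. (a * t) ^ m /\<^sub>R fact m"
  have "(\<lambda>k. \<Sum>m\<le>k. ?f m * ?g (k - m)) sums ((\<Sum>k. ?f k) * (\<Sum>k. ?g k))"
    by (rule Cauchy_product_sums)
      (use summable_mat_exp[OF assms, of t] summable_norm_exp[of "a * t"] in simp_all)
  also have "(\<Sum>k. ?f k) * (\<Sum>k. ?g k) = exp (a * t) * mat_exp (t \<cdot>\<^sub>m M) $$ (i, j)"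
    by (simp add: mat_exp_smult_index[OF assms] exp_def)
  also have "(\<lambda>k. \<Sum>m\<le>k. ?f m * ?g (k - m)) =
      (\<lambda>k. ((M + a \<cdot>\<^sub>m 1\<^sub>m n) ^\<^sub>m k) $$ (i, j) / fact k * t ^ k)"
  proof
    fix k
    have "?f m * ?g (k - m) =
        of_nat (k choose m) * a ^ (k - m) * (M ^\<^sub>m m) $$ (i, j) / fact k * t ^ k" if "m \<le> k" for m
    proof -
      have "t ^ k = t ^ m * t ^ (k - m)"
        using that by (simp flip: power_add)
      then show ?thesis
        unfolding binomial_fact[OF that, where 'a = real]
        by (simp add: divide_simps power_mult_distrib)
    qed
    then show "(\<Sum>m\<le>k. ?f m * ?g (k - m)) = ((M + a \<cdot>\<^sub>m 1\<^sub>m n) ^\<^sub>m k) $$ (i, j) / fact k * t ^ k"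
      by (simp add: scalar_shift_pow_mat[OF assms] sum_distrib_right sum_divide_distrib)
  qed
  finally show ?thesis
    by (rule sums_unique2[rotated]) (rule mat_exp_sums[OF _ ij], use M in simp)
qed

lemma mat_exp_entry_le:
  fixes M :: "real mat"
  assumes M: "M \<in> carrier_mat n n" and ij: "i < n" "j < n" and t: "t \<ge> 0"
    and bound: "\<And>k. \<bar>(M ^\<^sub>m k) $$ (i, j)\<bar> \<le> c * a ^ k"
  shows "\<bar>mat_exp (t \<cdot>\<^sub>m M) $$ (i, j)\<bar> \<le> c * exp (a * t)"
proof -
  have "(\<lambda>k. (a * t) ^ k /\<^sub>R fact k) sums exp (a * t)"
    unfolding exp_def by (rule summable_sums, rule summable_exp_generic)
  then have E: "(\<lambda>k. c * ((a * t) ^ k /\<^sub>R fact k)) sums (c * exp (a * t))"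
    by (rule sums_mult)
  have S: "summable (\<lambda>k. \<bar>(M ^\<^sub>m k) $$ (i, j) / fact k * t ^ k\<bar>)"
    by (rule summable_mat_exp[OF M ij])
  have "\<bar>mat_exp (t \<cdot>\<^sub>m M) $$ (i, j)\<bar> \<le> (\<Sum>k. \<bar>(M ^\<^sub>m k) $$ (i, j) / fact k * t ^ k\<bar>)"
    unfolding mat_exp_smult_index[OF M ij] by (rule summable_rabs[OF S])
  also have "\<dots> \<le> (\<Sum>k. c * ((a * t) ^ k /\<^sub>R fact k))"
  proof (rule suminf_le[OF _ S sums_summable[OF E]])
    fix k
    have "\<bar>(M ^\<^sub>m k) $$ (i, j)\<bar> * t ^ k / fact k \<le> c * a ^ k * t ^ k / fact k"
      using bound t by (intro divide_right_mono mult_right_mono) auto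
    then show "\<bar>(M ^\<^sub>m k) $$ (i, j) / fact k * t ^ k\<bar> \<le> c * ((a * t) ^ k /\<^sub>R fact k)"
      using t by (simp add: abs_mult power_abs power_mult_distrib divide_simps)
  qed
  also have "\<dots> = c * exp (a * t)"
    using E by (rule sums_unique[symmetric])
  finally show ?thesis .
qed

text \<open>Since |1 + h k|^2 = 1 + h (h |k|^2 + 2 Re k), every h with 0 < h < -2 Re k / |k|^2 will
  do: an explicit Euler step of that size contracts the mode k.\<close>

lemma eventually_norm_one_plus_less_1:
  fixes k :: complex
  assumes "Re k < 0"
  shows "\<forall>\<^sub>F h in at_right 0. norm (1 + of_real h * k) < 1"
proof -
  have k: "(norm k)\<^sup>2 > 0"
    using assms by auto
  have "\<forall>\<^sub>F h in at_right 0. h \<in> {0<..<- 2 * Re k / (norm k)\<^sup>2}"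
    using assms k by (intro eventually_at_right_real) (auto simp: divide_simps)
  then show ?thesis
  proof eventually_elim
    case (elim h)
    then have h: "h > 0" "h * (norm k)\<^sup>2 < - 2 * Re k"
      using k by (auto simp: field_simps)
    have "(norm (1 + of_real h * k))\<^sup>2 = 1 + h * (h * (norm k)\<^sup>2 + 2 * Re k)"
      by (simp only: cmod_power2) (simp add: power2_eq_square algebra_simps)
    also have "\<dots> < 1"
      using h by (simp add: mult_pos_neg)
    finally show ?case
      by (simp add: abs_square_less_1)
  qed
qed

text \<open>For small \<open>b, h > 0\<close> the matrix \<open>I + h (A + b I)\<close> has spectral radius below 1, hence bounded
  powers, which bounds the power series of its exponential.\<close>

lemma stable_mat_exp_decay:
  assumes A: "A \<in> carrier_mat n n" and stable: "stable_mat A"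
  shows "\<exists>c. \<exists>b>0. \<forall>t\<ge>0. \<forall>i<n. \<forall>j<n. \<bar>mat_exp (t \<cdot>\<^sub>m A) $$ (i, j)\<bar> \<le> c * exp (- b * t)"
proof (cases "n = 0")
  case False
  let ?AC = "map_mat complex_of_real A"
  have AC: "?AC \<in> carrier_mat n n"
    using A by simp
  have fin: "finite (spectrum ?AC)"
    using card_finite_spectrum[OF AC] by simp
  have neg: "Re k < 0" if "k \<in> spectrum ?AC" for k
    using that stable by (auto simp: spectrum_def stable_mat_def)
  have "\<forall>\<^sub>F b in at_right 0. b \<in> {0<..<- Re k}" if "k \<in> spectrum ?AC" for k
    using neg[OF that] by (intro eventually_at_right_real) auto
  then have "\<forall>\<^sub>F b in at_right 0. b > 0 \<and> (\<forall>k\<in>spectrum ?AC. b \<in> {0<..<- Re k})"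
    unfolding eventually_conj_iff eventually_ball_finite_distrib[OF fin]
    by (simp add: eventually_at_right_less)
  \<comment> \<open>Any b below the gap between the finite spectrum and the imaginary axis keeps A +
    b I stable; b becomes the decay rate.\<close>
  then obtain b where b0: "b > 0 \<and> (\<forall>k\<in>spectrum ?AC. b \<in> {0<..<- Re k})"
    using eventually_happens'[OF trivial_limit_at_right_real] by blast
  then have b: "b > 0" "\<And>k. k \<in> spectrum ?AC \<Longrightarrow> Re (k + of_real b) < 0"
    by auto
  have "\<forall>\<^sub>F h in at_right 0. h > 0 \<and> (\<forall>k\<in>spectrum ?AC. norm (1 + of_real h * (k + of_real b)) < 1)"
    using b(2) unfolding eventually_conj_iff eventually_ball_finite_distrib[OF fin]
    by (simp add: eventually_at_right_less eventually_norm_one_plus_less_1)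
  then obtain h where h: "h > 0"
      "\<And>k. k \<in> spectrum ?AC \<Longrightarrow> norm (1 + of_real h * (k + of_real b)) < 1"
    using eventually_happens'[OF trivial_limit_at_right_real] by blast
  define B where "B = h \<cdot>\<^sub>m A + (1 + h * b) \<cdot>\<^sub>m 1\<^sub>m n"
  let ?BC = "map_mat complex_of_real B"
  have B: "B \<in> carrier_mat n n" and BC: "?BC \<in> carrier_mat n n"
    using A by (auto simp: B_def)
  have BC_eq: "?BC = of_real h \<cdot>\<^sub>m ?AC + (1 + of_real h * of_real b) \<cdot>\<^sub>m 1\<^sub>m n"
    using A by (intro eq_matI) (auto simp: B_def)
  have "norm \<mu> < 1" if \<mu>_spec: "\<mu> \<in> spectrum ?BC" for \<mu>
  proof -
    define k where "k = (\<mu> - 1 - of_real h * of_real b) / of_real h"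
    have \<mu>: "\<mu> = 1 + of_real h * (k + of_real b)"
      using h by (simp add: k_def field_simps)
    obtain v where v: "v \<in> carrier_vec n" "v \<noteq> 0\<^sub>v n" "?BC *\<^sub>v v = \<mu> \<cdot>\<^sub>v v"
      using \<mu>_spec unfolding spectrum_def mem_Collect_eq eigenvalue_def eigenvector_def carrier_matD(1)[OF BC]
      by blast
    have "?AC *\<^sub>v v = k \<cdot>\<^sub>v v"
    proof (rule eq_vecI)
      fix i assume "i < dim_vec (k \<cdot>\<^sub>v v)"
      then have i: "i < n"
        using v by simp
      have "(?BC *\<^sub>v v) $ i = of_real h * (?AC *\<^sub>v v) $ i + (1 + of_real h * of_real b) * v $ i"
        unfolding BC_eq using i v AC
        by (subst add_mult_distrib_mat_vec[of _ n n]) auto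
      then have "of_real h * (?AC *\<^sub>v v) $ i = of_real h * (k * v $ i)"
        using i v(1) unfolding v(3) \<mu> by (auto simp: algebra_simps)
      then have "(?AC *\<^sub>v v) $ i = k * v $ i"
        using h(1) by (metis mult_left_cancel of_real_eq_0_iff less_irrefl)
      then show "(?AC *\<^sub>v v) $ i = (k \<cdot>\<^sub>v v) $ i"
        using i v(1) by simp
    qed (use A v in simp)
    then have "k \<in> spectrum ?AC"
      using v A by (auto simp: spectrum_def eigenvalue_def eigenvector_def)
    then show ?thesis
      unfolding \<mu> by (rule h)
  qed
  then have "spectral_radius ?BC < 1"
    using spectral_radius_mem_max(1)[OF BC] False by auto
  then obtain c where c: "\<And>k. norm_bound (?BC ^\<^sub>m k) c"
    using spectral_radius_jnf_norm_bound_less_1_upper_triangular[OF BC] by blast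
  have c: "\<bar>(B ^\<^sub>m k) $$ (i, j)\<bar> \<le> c" if "i < n" "j < n" for i j k
    using c[of k] that B unfolding norm_bound_def of_real_hom.mat_hom_pow[OF B, symmetric]
    by auto
  let ?M = "(1 / h) \<cdot>\<^sub>m B"
  have M: "?M \<in> carrier_mat n n"
    using B by simp
  \<comment> \<open>The definition of \<open>B\<close> solved for \<open>A\<close>. The scalar part
    contributes exp(-(1/h + b) t), while bounded powers of \<open>B\<close> let exp(t B / h) grow at
    most like exp(t / h); what is left is exp(-b t).\<close>
  have A_eq: "A = ?M + (- (1 / h + b)) \<cdot>\<^sub>m 1\<^sub>m n"
    using A h by (intro eq_matI) (auto simp: B_def field_simps)
  have "\<bar>mat_exp (t \<cdot>\<^sub>m A) $$ (i, j)\<bar> \<le> c * exp (- b * t)" if "t \<ge> 0" "i < n" "j < n" for t i j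
  proof -
    have "\<bar>(?M ^\<^sub>m k) $$ (i, j)\<bar> \<le> c * (1 / h) ^ k" for k
      using h c[OF that(2,3), of k] that B by (simp add: smult_pow_mat[OF B] abs_mult power_abs divide_simps)
    then have "\<bar>mat_exp (t \<cdot>\<^sub>m ?M) $$ (i, j)\<bar> \<le> c * exp (1 / h * t)"
      by (rule mat_exp_entry_le[OF M that(2,3,1)])
    then have "\<bar>mat_exp (t \<cdot>\<^sub>m A) $$ (i, j)\<bar> \<le> exp (- (1 / h + b) * t) * (c * exp (1 / h * t))"
      unfolding arg_cong[OF A_eq, of "\<lambda>X. mat_exp (t \<cdot>\<^sub>m X) $$ (i, j)"]
      by (subst mat_exp_scalar_shift[OF M that(2,3)]) (simp add: abs_mult)
    also have "\<dots> = c * (exp (- (1 / h + b) * t) * exp (1 / h * t))"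
      by simp
    also have "exp (- (1 / h + b) * t) * exp (1 / h * t) = exp (- b * t)"
      unfolding exp_add[symmetric] by (simp add: algebra_simps)
    finally show ?thesis .
  qed
  with b(1) show ?thesis
    by blast
qed (auto intro: exI[of _ 1])

lemma stable_mat_exp_tendsto_0:
  assumes A: "A \<in> carrier_mat n n" "stable_mat A" and ij: "i < n" "j < n"
  shows "((\<lambda>t. mat_exp (t \<cdot>\<^sub>m A) $$ (i, j)) \<longlongrightarrow> 0) at_top"
proof -
  obtain c b where b: "b > 0"
      "\<forall>t\<ge>0. \<forall>i<n. \<forall>j<n. \<bar>mat_exp (t \<cdot>\<^sub>m A) $$ (i, j)\<bar> \<le> c * exp (- b * t)"
    using stable_mat_exp_decay[OF A] by blast
  have "((\<lambda>t. c * exp (- b * t)) \<longlongrightarrow> 0) at_top"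
    using b(1) by real_asymp
  then show ?thesis
    by (rule Lim_null_comparison[rotated])
      (use b(2) ij in \<open>auto intro!: eventually_at_top_linorderI[of 0]\<close>)
qed

lemma stable_mat_exp_vec_tendsto_0:
  assumes A: "A \<in> carrier_mat n n" "stable_mat A" and v: "v \<in> carrier_vec n" and i: "i < n"
  shows "((\<lambda>t. (mat_exp (t \<cdot>\<^sub>m A) *\<^sub>v v) $ i) \<longlongrightarrow> 0) at_top"
  unfolding index_mult_vec_sum[OF mat_exp_carrier[OF A(1)] v i]
  by (intro tendsto_null_sum tendsto_mult_left_zero stable_mat_exp_tendsto_0[OF A i]) auto

subsection \<open>Bilinear forms along trajectories\<close>

lemma scalar_prod_adjoint:
  fixes A :: "real mat"
  assumes "A \<in> carrier_mat n m" "x \<in> carrier_vec m" "y \<in> carrier_vec n"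
  shows "(A *\<^sub>v x) \<bullet> y = x \<bullet> (transpose_mat A *\<^sub>v y)"
  using transpose_vec_mult_scalar[of "transpose_mat A" m n y x] assms by simp

lemma zero_mat_mult_vec: "0\<^sub>m n m *\<^sub>v v = (0\<^sub>v n :: real vec)" if "v \<in> carrier_vec m"
  by (rule eq_vecI) (use that in \<open>auto simp: scalar_prod_def\<close>)

text \<open>Product rule with separate dynamics on the two sides: full with full, reduced with
  reduced and full with reduced give the three terms of the storage function, and unit vectors as
  initial values give matrix entries.\<close>

lemma bilinear_has_derivative:
  fixes A B M :: "real mat"
  assumes A: "A \<in> carrier_mat n n" and B: "B \<in> carrier_mat m m" and M: "M \<in> carrier_mat n m"
    and u: "u \<in> carrier_vec n" and v: "v \<in> carrier_vec m"
  shows "((\<lambda>t. (mat_exp (t \<cdot>\<^sub>m A) *\<^sub>v u) \<bullet> (M *\<^sub>v (mat_exp (t \<cdot>\<^sub>m B) *\<^sub>v v))) has_real_derivative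
    (mat_exp (t \<cdot>\<^sub>m A) *\<^sub>v u) \<bullet> ((transpose_mat A * M + M * B) *\<^sub>v (mat_exp (t \<cdot>\<^sub>m B) *\<^sub>v v))) (at t)"
proof -
  define x where "x t = mat_exp (t \<cdot>\<^sub>m A) *\<^sub>v u" for t
  define y where "y t = mat_exp (t \<cdot>\<^sub>m B) *\<^sub>v v" for t
  have x: "x t \<in> carrier_vec n" and y: "y t \<in> carrier_vec m" for t
    using A B u v by (auto simp: x_def y_def intro!: mult_mat_vec_carrier)
  have expand: "p \<bullet> (M *\<^sub>v w) = (\<Sum>i<n. \<Sum>j<m. M $$ (i, j) * (p $ i * w $ j))"
    if "w \<in> carrier_vec m" for p w
    using M that
    by (simp add: scalar_prod_sum[of _ n] index_mult_vec_sum[OF M that] sum_distrib_left mult_ac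
        del: index_mult_mat_vec)
  have D: "((\<lambda>t. \<Sum>i<n. \<Sum>j<m. M $$ (i, j) * (x t $ i * y t $ j)) has_real_derivative
      (\<Sum>i<n. \<Sum>j<m. M $$ (i, j) * ((A *\<^sub>v x t) $ i * y t $ j + x t $ i * (B *\<^sub>v y t) $ j))) (at t)" for t
    unfolding x_def y_def
    by (intro DERIV_sum DERIV_cmult)
      (auto intro!: derivative_eq_intros mat_exp_vec_has_derivative[OF A u] mat_exp_vec_has_derivative[OF B v]
        simp del: index_mult_mat_vec)
  have "(\<Sum>i<n. \<Sum>j<m. M $$ (i, j) * ((A *\<^sub>v x t) $ i * y t $ j + x t $ i * (B *\<^sub>v y t) $ j))
      = (A *\<^sub>v x t) \<bullet> (M *\<^sub>v y t) + x t \<bullet> (M *\<^sub>v (B *\<^sub>v y t))"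
    unfolding expand[OF y] expand[OF mult_mat_vec_carrier[OF B y]] sum.distrib[symmetric]
    by (simp add: algebra_simps del: index_mult_mat_vec)
  also have "(A *\<^sub>v x t) \<bullet> (M *\<^sub>v y t) = x t \<bullet> (transpose_mat A *\<^sub>v (M *\<^sub>v y t))"
    by (rule scalar_prod_adjoint[OF A x mult_mat_vec_carrier[OF M y]])
  also have "\<dots> + x t \<bullet> (M *\<^sub>v (B *\<^sub>v y t)) = x t \<bullet> ((transpose_mat A * M + M * B) *\<^sub>v y t)"
    using A B M x y
    by (simp add: add_mult_distrib_mat_vec[of _ n m] assoc_mult_mat_vec[of _ n n _ m]
        assoc_mult_mat_vec[of _ n m _ m] scalar_prod_add_distrib[of _ n] mult_mat_vec_carrier[of _ n m]
        mult_mat_vec_carrier[of _ m m] mult_mat_vec_carrier[of _ n n])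
  finally show ?thesis
    using D[of t] unfolding expand[OF y, symmetric] by (simp add: x_def y_def)
qed

text \<open>The hypothesis concerns products of coordinates instead of single factors, because in
  the mixed term with \<open>S\<close> one state decays while the other is only known to be
  bounded.\<close>

lemma bilinear_tendsto_0:
  fixes A B M :: "real mat"
  assumes M: "M \<in> carrier_mat n m"
    and v: "\<And>t. y t \<in> carrier_vec m"
    and lim: "\<And>i j. i < n \<Longrightarrow> j < m \<Longrightarrow> ((\<lambda>t. x t $ i * y t $ j) \<longlongrightarrow> 0) F"
  shows "((\<lambda>t. x t \<bullet> (M *\<^sub>v y t)) \<longlongrightarrow> 0) F"
proof -
  have "x t \<bullet> (M *\<^sub>v y t) = (\<Sum>i<n. \<Sum>j<m. M $$ (i, j) * (x t $ i * y t $ j))" for t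
    using M v
    by (simp add: scalar_prod_sum[of _ n] index_mult_vec_sum[OF M v] sum_distrib_left mult_ac
        del: index_mult_mat_vec)
  then show ?thesis
    by (simp only:) (intro tendsto_null_sum tendsto_mult_right_zero lim; simp)
qed

lemma unit_bilinear:
  fixes M :: "real mat"
  assumes M: "M \<in> carrier_mat n m" and ij: "i < n" "j < m"
  shows "unit_vec n i \<bullet> (M *\<^sub>v unit_vec m j) = M $$ (i, j)"
  using assms by simp

text \<open>The curve \<open>exp(t A) K exp(t A\<^sup>T)\<close> is constant and tends to 0.\<close>

lemma lyapunov_unique:
  assumes A: "A \<in> carrier_mat n n" "stable_mat A" and K: "K \<in> carrier_mat n n"
    and eq: "A * K + K * transpose_mat A = 0\<^sub>m n n"
  shows "K = 0\<^sub>m n n"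
proof (rule eq_matI)
  fix i j assume "i < dim_row (0\<^sub>m n n :: real mat)" "j < dim_col (0\<^sub>m n n :: real mat)"
  then have ij: "i < n" "j < n"
    by auto
  let ?A = "transpose_mat A"
  let ?x = "\<lambda>i t. mat_exp (t \<cdot>\<^sub>m ?A) *\<^sub>v unit_vec n i"
  let ?g = "\<lambda>t. ?x i t \<bullet> (K *\<^sub>v ?x j t)"
  have A': "?A \<in> carrier_mat n n"
    using A by simp
  have x: "?x i t \<in> carrier_vec n" for i t
    using mat_exp_carrier[OF A'] by (auto intro!: mult_mat_vec_carrier)
  have x_index: "?x i t $ k = mat_exp (t \<cdot>\<^sub>m A) $$ (i, k)" if "i < n" "k < n" for i k t
    using that mat_exp_carrier[OF A(1), of t] by (simp flip: transpose_mat_exp[OF A(1)])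
  have "(?g has_real_derivative 0) (at t)" for t
    using bilinear_has_derivative[OF A' A' K, of "unit_vec n i" "unit_vec n j" t] eq x
    by (simp add: zero_mat_mult_vec)
  then obtain c where c: "\<And>t. ?g t = c"
    using DERIV_isconst_all by blast
  have "(?g \<longlongrightarrow> 0) at_top"
    by (rule bilinear_tendsto_0[OF K x])
      (use x_index ij in \<open>simp add: tendsto_mult_zero stable_mat_exp_tendsto_0[OF A] del: index_mult_mat_vec\<close>)
  then have "?g t = 0" for t
    unfolding c by (simp add: tendsto_const_iff)
  from this[of 0] show "K $$ (i, j) = 0\<^sub>m n n $$ (i, j)"
    using unit_bilinear[OF K ij] ij mat_exp_zero[OF A'] by simp
qed (use K in auto)

subsection \<open>The observability Gramian\<close>

lemma
  fixes f :: "'i \<Rightarrow> 'a \<Rightarrow> real"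
  assumes "\<And>k. k \<in> I \<Longrightarrow> set_integrable M S (f k)"
  shows set_integrable_sum: "set_integrable M S (\<lambda>x. \<Sum>k\<in>I. f k x)"
    and set_integral_sum: "(LINT x:S|M. (\<Sum>k\<in>I. f k x)) = (\<Sum>k\<in>I. LINT x:S|M. f k x)"
  using assms unfolding set_integrable_def set_lebesgue_integral_def scaleR_sum_right
  by (auto intro: Bochner_Integration.integrable_sum Bochner_Integration.integral_sum)

text \<open>The integrand F(t) = exp(t A)^T C^T N C exp(t A) satisfies F' = A^T F + F A, tends to 0
  and starts at C^T N C; integrating F' over the half-line gives the equation.\<close>

lemma obs_gramian_lyapunov:
  assumes A: "A \<in> carrier_mat n n" "stable_mat A" and C: "C \<in> carrier_mat p n"
    and N: "N \<in> carrier_mat p p"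
  shows "transpose_mat A * obs_gramian A C N + obs_gramian A C N * A + transpose_mat C * N * C = 0\<^sub>m n n"
    and "obs_gramian A C N \<in> carrier_mat n n"
    and "transpose_mat N = N \<Longrightarrow> transpose_mat (obs_gramian A C N) = obs_gramian A C N"
proof -
  let ?E = "\<lambda>t. mat_exp (t \<cdot>\<^sub>m A)"
  let ?M = "transpose_mat C * N * C"
  let ?Q = "obs_gramian A C N"
  define F where "F t = transpose_mat (?E t) * ?M * ?E t" for t
  have E: "?E t \<in> carrier_mat n n" "transpose_mat (?E t) \<in> carrier_mat n n" for t
    using mat_exp_carrier[OF A(1)] by auto
  have M: "?M \<in> carrier_mat n n"
    using C N by simp
  have F: "F t \<in> carrier_mat n n" for t
    unfolding F_def using E M by (metis mult_carrier_mat)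
  have F_eq: "F t = transpose_mat (?E t) * transpose_mat C * N * C * ?E t" for t
    unfolding F_def using E[of t] C N
    by (simp add: assoc_mult_mat[of _ n p _ p _ n] assoc_mult_mat[of _ n n _ p _ n] assoc_mult_mat[of _ n n _ p _ p]
        assoc_mult_mat[of _ n p _ n _ n] assoc_mult_mat[of _ n p _ p _ p] assoc_mult_mat[of _ p p _ n _ n])
  have F_index: "F t $$ (i, j) = (?E t *\<^sub>v unit_vec n i) \<bullet> (?M *\<^sub>v (?E t *\<^sub>v unit_vec n j))"
    if "i < n" "j < n" for i j t
  proof -
    have "F t $$ (i, j) = unit_vec n i \<bullet> (F t *\<^sub>v unit_vec n j)"
      by (rule unit_bilinear[OF F that, symmetric])
    also have "\<dots> = unit_vec n i \<bullet> (transpose_mat (?E t) *\<^sub>v (?M *\<^sub>v (?E t *\<^sub>v unit_vec n j)))"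
      unfolding F_def using E[of t] M
      by (simp add: assoc_mult_mat_vec[of _ n n _ n] mult_mat_vec_carrier[of _ n n] mult_carrier_mat[of _ n n _ n])
    also have "\<dots> = (?E t *\<^sub>v unit_vec n i) \<bullet> (?M *\<^sub>v (?E t *\<^sub>v unit_vec n j))"
      using E[of t] M
      by (intro scalar_prod_adjoint[of _ n n, symmetric]) (auto intro!: mult_mat_vec_carrier)
    finally show ?thesis .
  qed
  have deriv: "((\<lambda>t. F t $$ (i, j)) has_real_derivative (transpose_mat A * F t + F t * A) $$ (i, j)) (at t)"
    if ij: "i < n" "j < n" for i j t
  proof -
    have "((\<lambda>t. F t $$ (i, j)) has_real_derivative
      (?E t *\<^sub>v unit_vec n i) \<bullet> ((transpose_mat A * ?M + ?M * A) *\<^sub>v (?E t *\<^sub>v unit_vec n j))) (at t)"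
      unfolding F_index[OF ij] by (rule bilinear_has_derivative[OF A(1) A(1) M]) auto
    also have "(?E t *\<^sub>v unit_vec n i) \<bullet> ((transpose_mat A * ?M + ?M * A) *\<^sub>v (?E t *\<^sub>v unit_vec n j))
      = unit_vec n i \<bullet> (transpose_mat (?E t) *\<^sub>v ((transpose_mat A * ?M + ?M * A) *\<^sub>v (?E t *\<^sub>v unit_vec n j)))"
      using E[of t] M A
      by (intro scalar_prod_adjoint[of _ n n]) (auto intro!: mult_mat_vec_carrier[of _ n n])
    also have "\<dots> = unit_vec n i \<bullet> ((transpose_mat (?E t) * (transpose_mat A * ?M + ?M * A) * ?E t) *\<^sub>v unit_vec n j)"
      using E[of t] M A
      by (simp add: assoc_mult_mat_vec[of _ n n _ n] mult_mat_vec_carrier[of _ n n] mult_carrier_mat[of _ n n _ n])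
    also have "\<dots> = (transpose_mat (?E t) * (transpose_mat A * ?M + ?M * A) * ?E t) $$ (i, j)"
      using E[of t] M A by (intro unit_bilinear[OF _ ij]) (auto intro!: mult_carrier_mat[of _ n n])
    also have "transpose_mat (?E t) * (transpose_mat A * ?M + ?M * A) * ?E t
        = (transpose_mat (?E t) * transpose_mat A) * ?M * ?E t + transpose_mat (?E t) * ?M * (A * ?E t)"
      using E[of t] M A
      by (simp add: assoc_mult_mat[of _ n n _ n _ n] mult_add_distrib_mat[of _ n n _ n]
          add_mult_distrib_mat[of _ n n _ _ n] mult_carrier_mat[of _ n n _ n])
    \<comment> \<open>The derivative of the bilinear form has \<open>A\<close> next to the weight.
      Commuting \<open>A\<close> past its exponential moves it to the outside, where it can leave
      the integral.\<close>
    also have "transpose_mat (?E t) * transpose_mat A = transpose_mat A * transpose_mat (?E t)"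
      using transpose_mult[OF A(1) E(1)[of t]] transpose_mult[OF E(1)[of t] A(1)] mat_exp_commute[OF A(1), of t]
      by simp
    also have "A * ?E t = ?E t * A"
      by (rule mat_exp_commute[OF A(1), symmetric])
    also have "transpose_mat A * transpose_mat (?E t) * ?M * ?E t + transpose_mat (?E t) * ?M * (?E t * A)
        = transpose_mat A * F t + F t * A"
      unfolding F_def using E[of t] M A
      by (simp add: assoc_mult_mat[of _ n n _ n _ n] mult_carrier_mat[of _ n n _ n])
    finally show ?thesis .
  qed
  have cont: "continuous_on UNIV (\<lambda>t. F t $$ (i, j))" if "i < n" "j < n" for i j
    using deriv[OF that] by (meson DERIV_isCont continuous_at_imp_continuous_on)
  obtain c b where b: "b > 0"
      "\<And>t i j. t \<ge> 0 \<Longrightarrow> i < n \<Longrightarrow> j < n \<Longrightarrow> \<bar>?E t $$ (i, j)\<bar> \<le> c * exp (- b * t)"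
    using stable_mat_exp_decay[OF A] by blast
  have F_sum: "F t $$ (i, j) = (\<Sum>k<n. \<Sum>l<n. ?M $$ (k, l) * (?E t $$ (k, i) * ?E t $$ (l, j)))"
    if "i < n" "j < n" for i j t
  proof -
    have "F t $$ (i, j) = (\<Sum>k<n. (?E t *\<^sub>v unit_vec n i) $ k * (\<Sum>l<n. ?M $$ (k, l) * (?E t *\<^sub>v unit_vec n j) $ l))"
      unfolding F_index[OF that] using M E[of t]
      by (subst scalar_prod_sum[of _ n]) (auto simp: index_mult_vec_sum[of ?M n n] intro!: sum.cong
          simp del: index_mult_mat_vec)
    then show ?thesis
      using that E(1)[of t] by (simp add: sum_distrib_left mult_ac)
  qed
  have int: "set_integrable lborel {0..} (\<lambda>t. F t $$ (i, j))" if ij: "i < n" "j < n" for i j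
  proof -
    \<comment> \<open>The two exponentials together decay like exp(-2 b t); the constant collects
      c^2 and all entries of the weight.\<close>
    let ?K = "(\<Sum>k<n. \<Sum>l<n. \<bar>?M $$ (k, l)\<bar>) * c\<^sup>2"
    have "((\<lambda>t. exp (- t * (2 * b))) has_integral exp (- 0 * (2 * b)) / (2 * b)) {0..}"
      using has_integral_exp_minus_to_infinity[of "2 * b" 0] b(1) by (simp add: mult.commute)
    then have "(\<lambda>t. exp (- t * (2 * b))) absolutely_integrable_on {0..}"
      by (intro nonnegative_absolutely_integrable_1) auto
    then have "set_integrable lborel {0..} (\<lambda>t. exp (- t * (2 * b)))"
      by (simp add: absolutely_integrable_on_def set_integrable_def integrable_completion)
    then have "set_integrable lborel {0..} (\<lambda>t. ?K * exp (- t * (2 * b)))"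
      by (rule set_integrable_mult_right)
    then show ?thesis
    proof (rule set_integrable_bound)
      show "AE t in lborel. t \<in> {0..} \<longrightarrow> norm (F t $$ (i, j)) \<le> norm (?K * exp (- t * (2 * b)))"
      proof (intro AE_I2 impI)
        fix t :: real assume "t \<in> {0..}"
        then have "\<bar>?E t $$ (k, i)\<bar> * \<bar>?E t $$ (l, j)\<bar> \<le> (c * exp (- b * t)) * (c * exp (- b * t))"
          if "k < n" "l < n" for k l
          using b(2) that ij by (intro mult_mono) (auto intro: order_trans[OF abs_ge_zero])
        moreover have "(c * exp (- b * t)) * (c * exp (- b * t)) = c\<^sup>2 * exp (- t * (2 * b))"
          by (simp add: power2_eq_square exp_add[symmetric] algebra_simps)
        ultimately have "\<bar>F t $$ (i, j)\<bar> \<le> (\<Sum>k<n. \<Sum>l<n. \<bar>?M $$ (k, l)\<bar> * (c\<^sup>2 * exp (- t * (2 * b))))"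
          unfolding F_sum[OF ij]
          by (intro order_trans[OF sum_abs sum_mono] order_trans[OF sum_abs sum_mono])
            (auto simp: abs_mult intro!: mult_left_mono)
        also have "\<dots> = ?K * exp (- t * (2 * b))"
          by (simp add: sum_distrib_right sum_distrib_left mult_ac)
        finally show "norm (F t $$ (i, j)) \<le> norm (?K * exp (- t * (2 * b)))"
          by simp
      qed
      show "set_borel_measurable lborel {0..} (\<lambda>t. F t $$ (i, j))"
        unfolding set_borel_measurable_def
        using borel_measurable_continuous_onI[OF cont[OF ij]] by simp
    qed
  qed
  have Q_index: "?Q $$ (i, j) = (LINT t:{0..}|lborel. F t $$ (i, j))" if "i < n" "j < n" for i j
    using A that by (simp add: obs_gramian_def F_eq)
  show Q: "?Q \<in> carrier_mat n n"
    using A by (simp add: obs_gramian_def)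
  show "transpose_mat A * ?Q + ?Q * A + ?M = 0\<^sub>m n n"
  proof (rule eq_matI)
    fix i j assume "i < dim_row (0\<^sub>m n n :: real mat)" "j < dim_col (0\<^sub>m n n :: real mat)"
    then have ij: "i < n" "j < n"
      by auto
    let ?f = "\<lambda>t. (transpose_mat A * F t + F t * A) $$ (i, j)"
    have f_sum: "?f t = (\<Sum>k<n. A $$ (k, i) * F t $$ (k, j)) + (\<Sum>k<n. A $$ (k, j) * F t $$ (i, k))" for t
      using F[of t] A ij
      by (simp add: index_mult_sum[of _ n n _ n] mult.commute del: index_mult_mat(1))
    have f_int: "set_integrable lborel {0..} ?f"
      unfolding f_sum using ij by (intro set_integral_add set_integrable_sum set_integrable_mult_right int) auto
    have lim: "((\<lambda>t. F t $$ (i, j)) \<longlongrightarrow> 0) at_top"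
      unfolding F_sum[OF ij]
      by (intro tendsto_null_sum tendsto_mult_right_zero tendsto_mult_zero stable_mat_exp_tendsto_0[OF A])
        (use ij in auto)
    have lim0: "((\<lambda>t. F t $$ (i, j)) \<longlongrightarrow> F 0 $$ (i, j)) (at_right 0)"
      using deriv[OF ij, of 0, THEN DERIV_isCont] by (simp add: isCont_def filterlim_at_split)
    have F0: "F 0 = ?M"
      unfolding F_def mat_exp_zero[OF A(1)]
      by (simp only: transpose_one left_mult_one_mat[OF M] right_mult_one_mat[OF M])
    have "(LBINT t=0..\<infinity>. ?f t) = 0 - F 0 $$ (i, j)"
    proof (rule interval_integral_FTC_integrable)
      show "((\<lambda>t. F t $$ (i, j)) has_vector_derivative ?f t) (at t)" for t
        using deriv[OF ij] by (simp add: has_real_derivative_iff_has_vector_derivative)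
      show "isCont ?f t" for t
        unfolding f_sum using ij cont
        by (intro continuous_intros) (auto simp: continuous_on_eq_continuous_at)
      show "set_integrable lborel (einterval 0 \<infinity>) ?f"
        by (rule set_integrable_subset[OF f_int]) (auto simp: einterval_def)
      show "(((\<lambda>t. F t $$ (i, j)) \<circ> real_of_ereal) \<longlongrightarrow> F 0 $$ (i, j)) (at_right 0)"
        using lim0 by (simp add: zero_ereal_def ereal_tendsto_simps1)
      show "(((\<lambda>t. F t $$ (i, j)) \<circ> real_of_ereal) \<longlongrightarrow> 0) (at_left \<infinity>)"
        using lim by (simp add: ereal_tendsto_simps1)
    qed simp
    \<comment> \<open>The interval integral omits the endpoint 0 and the Gramian includes it; a
      single point has measure zero.\<close>
    also have "(LBINT t=0..\<infinity>. ?f t) = (LINT t:{0..}|lborel. ?f t)"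
      unfolding zero_ereal_def interval_integral_to_infinity_eq
      by (rule set_integral_discrete_difference[where X = "{0}"]) auto
    also have "\<dots> = (transpose_mat A * ?Q + ?Q * A) $$ (i, j)"
    proof -
      have "(LINT t:{0..}|lborel. ?f t) =
        (LINT t:{0..}|lborel. (\<Sum>k<n. A $$ (k, i) * F t $$ (k, j))) +
        (LINT t:{0..}|lborel. (\<Sum>k<n. A $$ (k, j) * F t $$ (i, k)))"
        unfolding f_sum
        by (intro set_integral_add(2) set_integrable_sum set_integrable_mult_right int) (use ij in auto)
      also have "(LINT t:{0..}|lborel. (\<Sum>k<n. A $$ (k, i) * F t $$ (k, j))) =
          (\<Sum>k<n. A $$ (k, i) * (LINT t:{0..}|lborel. F t $$ (k, j)))"
        using ij by (subst set_integral_sum) (auto intro!: set_integrable_mult_right int)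
      also have "(LINT t:{0..}|lborel. (\<Sum>k<n. A $$ (k, j) * F t $$ (i, k))) =
          (\<Sum>k<n. A $$ (k, j) * (LINT t:{0..}|lborel. F t $$ (i, k)))"
        using ij by (subst set_integral_sum) (auto intro!: set_integrable_mult_right int)
      finally have "(LINT t:{0..}|lborel. ?f t) =
          (\<Sum>k<n. A $$ (k, i) * (LINT t:{0..}|lborel. F t $$ (k, j))) +
          (\<Sum>k<n. A $$ (k, j) * (LINT t:{0..}|lborel. F t $$ (i, k)))" .
      then show ?thesis
        using Q A ij
        by (simp add: index_mult_sum[of _ n n _ n] mult.commute Q_index del: index_mult_mat(1))
    qed
    finally have "(transpose_mat A * ?Q + ?Q * A) $$ (i, j) + ?M $$ (i, j) = 0"
      unfolding F0 by linarith
    moreover have "(transpose_mat A * ?Q + ?Q * A + ?M) $$ (i, j)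
        = (transpose_mat A * ?Q + ?Q * A) $$ (i, j) + ?M $$ (i, j)"
      by (rule index_add_mat(1)) (simp_all only: carrier_matD[OF M] ij)
    ultimately show "(transpose_mat A * ?Q + ?Q * A + ?M) $$ (i, j) = 0\<^sub>m n n $$ (i, j)"
      using ij by (simp only: index_zero_mat(1))
  qed (use Q A C in auto)
  show "transpose_mat ?Q = ?Q" if "transpose_mat N = N"
  proof (rule eq_matI)
    fix i j assume "i < dim_row ?Q" "j < dim_col ?Q"
    then have ij: "i < n" "j < n"
      using Q by auto
    have "transpose_mat ?M = ?M"
      using C N that
      by (simp add: transpose_mult[of _ n p _ n] transpose_mult[of _ n p _ p]
          transpose_mult[of _ p p _ n] assoc_mult_mat[of _ n p _ p _ n])
    then have "?M $$ (k, l) = ?M $$ (l, k)" if "k < n" "l < n" for k l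
      using that M by (metis carrier_matD index_transpose_mat(1))
    then have "F t $$ (i, j) = F t $$ (j, i)" for t
      unfolding F_sum[OF ij] F_sum[OF ij(2,1)]
      by (subst sum.swap) (auto intro!: sum.cong)
    then show "transpose_mat ?Q $$ (i, j) = ?Q $$ (i, j)"
      using Q ij by (simp add: Q_index)
  qed (use Q in auto)
qed

subsection \<open>Energy balance for the output error\<close>

lemma mat_exp_mult_vec_carrier:
  assumes "A \<in> carrier_mat n n" "u \<in> carrier_vec n"
  shows "mat_exp (t \<cdot>\<^sub>m A) *\<^sub>v u \<in> carrier_vec n"
  using assms by (intro mult_mat_vec_carrier[of _ n n]) auto

lemma neg_eq_if_add_eq_zero_mat:
  fixes X Y :: "real mat"
  assumes "X \<in> carrier_mat n m" "Y \<in> carrier_mat n m" "X + Y = 0\<^sub>m n m"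
  shows "X = - Y"
proof (rule eq_matI)
  fix i j assume "i < dim_row (- Y)" "j < dim_col (- Y)"
  then have ij: "i < n" "j < m"
    using assms by auto
  then have "X $$ (i, j) + Y $$ (i, j) = (X + Y) $$ (i, j)"
    using assms(2) by simp
  also have "\<dots> = 0"
    unfolding assms(3) using ij by simp
  finally show "X $$ (i, j) = (- Y) $$ (i, j)"
    using assms(2) ij by simp
qed (use assms in auto)

lemma bilinear_transpose_mult:
  fixes K J :: "real mat"
  assumes "K \<in> carrier_mat p n" "J \<in> carrier_mat p m" "x \<in> carrier_vec n" "y \<in> carrier_vec m"
  shows "x \<bullet> ((transpose_mat K * J) *\<^sub>v y) = (K *\<^sub>v x) \<bullet> (J *\<^sub>v y)"
  using assms by (subst scalar_prod_adjoint[of K p n])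
    (auto simp: assoc_mult_mat_vec[of _ n p _ m] intro!: mult_mat_vec_carrier[of _ p m])

text \<open>One rule for all three storage terms: with outputs (K, K), (J, J) or (K, J) the equation
  is the Lyapunov equation of \<open>Q\<close>, that of the diagonal matrix, or the Sylvester
  equation of \<open>S\<close>, and the rate of change is minus an inner product of outputs.\<close>

lemma bilinear_sylvester_has_derivative:
  fixes A B M K J :: "real mat"
  assumes A: "A \<in> carrier_mat n n" and B: "B \<in> carrier_mat m m" and M: "M \<in> carrier_mat n m"
    and K: "K \<in> carrier_mat p n" and J: "J \<in> carrier_mat p m"
    and u: "u \<in> carrier_vec n" and v: "v \<in> carrier_vec m"
    and eq: "transpose_mat A * M + M * B + transpose_mat K * J = 0\<^sub>m n m"
  shows "((\<lambda>t. (mat_exp (t \<cdot>\<^sub>m A) *\<^sub>v u) \<bullet> (M *\<^sub>v (mat_exp (t \<cdot>\<^sub>m B) *\<^sub>v v))) has_real_derivative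
    - ((K *\<^sub>v (mat_exp (t \<cdot>\<^sub>m A) *\<^sub>v u)) \<bullet> (J *\<^sub>v (mat_exp (t \<cdot>\<^sub>m B) *\<^sub>v v)))) (at t)"
proof -
  let ?x = "mat_exp (t \<cdot>\<^sub>m A) *\<^sub>v u" and ?y = "mat_exp (t \<cdot>\<^sub>m B) *\<^sub>v v"
  have xy: "?x \<in> carrier_vec n" "?y \<in> carrier_vec m"
    by (rule mat_exp_mult_vec_carrier[OF A u], rule mat_exp_mult_vec_carrier[OF B v])
  have KJ: "transpose_mat K * J \<in> carrier_mat n m"
    using K J by simp
  have neg: "transpose_mat A * M + M * B = - (transpose_mat K * J)"
    by (rule neg_eq_if_add_eq_zero_mat[OF _ KJ eq]) (use A B M in simp)
  have "?x \<bullet> ((transpose_mat A * M + M * B) *\<^sub>v ?y) = - (?x \<bullet> ((transpose_mat K * J) *\<^sub>v ?y))"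
  proof -
    have "dim_vec ?y = dim_col (transpose_mat K * J)"
      unfolding carrier_vecD[OF xy(2)] carrier_matD(2)[OF KJ] ..
    then have h: "- (transpose_mat K * J) *\<^sub>v ?y = - ((transpose_mat K * J) *\<^sub>v ?y)"
      by (rule uminus_mult_mat_vec)
    have "dim_vec ?x = dim_vec ((transpose_mat K * J) *\<^sub>v ?y)"
      unfolding carrier_vecD[OF xy(1)] carrier_vecD[OF mult_mat_vec_carrier[OF KJ xy(2)]] ..
    then show ?thesis
      unfolding neg h by (rule scalar_prod_uminus_right)
  qed
  also have "\<dots> = - ((K *\<^sub>v ?x) \<bullet> (J *\<^sub>v ?y))"
    by (simp only: bilinear_transpose_mult[OF K J xy])
  finally show ?thesis
    using bilinear_has_derivative[OF A B M u v, of t] by simp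
qed

lemma continuous_bilinear_output:
  fixes A B K J :: "real mat"
  assumes A: "A \<in> carrier_mat n n" and B: "B \<in> carrier_mat m m"
    and K: "K \<in> carrier_mat p n" and J: "J \<in> carrier_mat p m"
    and u: "u \<in> carrier_vec n" and v: "v \<in> carrier_vec m"
  shows "continuous_on UNIV
    (\<lambda>t. (K *\<^sub>v (mat_exp (t \<cdot>\<^sub>m A) *\<^sub>v u)) \<bullet> (J *\<^sub>v (mat_exp (t \<cdot>\<^sub>m B) *\<^sub>v v)))"
proof -
  have KJ: "transpose_mat K * J \<in> carrier_mat n m"
    using K J by simp
  have "mat_exp (t \<cdot>\<^sub>m A) *\<^sub>v u \<in> carrier_vec n" "mat_exp (t \<cdot>\<^sub>m B) *\<^sub>v v \<in> carrier_vec m" for t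
    by (rule mat_exp_mult_vec_carrier[OF A u], rule mat_exp_mult_vec_carrier[OF B v])
  then show ?thesis
    using bilinear_has_derivative[OF A B KJ u v, THEN DERIV_isCont]
    by (simp add: bilinear_transpose_mult[OF K J] continuous_at_imp_continuous_on)
qed

lemma scalar_prod_self_minus:
  fixes a b :: "real vec"
  assumes "a \<in> carrier_vec p" "b \<in> carrier_vec p"
  shows "(a - b) \<bullet> (a - b) = a \<bullet> a + b \<bullet> b - 2 * (a \<bullet> b)"
  using assms by (simp add: scalar_prod_sum[of _ p] sum.distrib sum_subtractf sum_distrib_left algebra_simps)

lemma scalar_prod_self_nonneg: "0 \<le> a \<bullet> (a :: real vec)"
  by (auto simp: scalar_prod_def intro!: sum_nonneg)

text \<open>The storage function \<open>x\<^sup>T Q x + y\<^sup>T D y - 2 x\<^sup>T S y\<close> decreases at the rate given by the squared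
  output error. Positivity of \<open>D\<close> only bounds \<open>y\<close>, as \<open>B\<close> may have imaginary eigenvalues;
  this suffices because \<open>x\<close> decays.\<close>

lemma output_error_energy:
  fixes A B K J Q S :: "real mat" and \<delta> :: "nat \<Rightarrow> real"
  assumes A: "A \<in> carrier_mat n n" "stable_mat A" and B: "B \<in> carrier_mat m m"
    and K: "K \<in> carrier_mat p n" and J: "J \<in> carrier_mat p m"
    and Q: "Q \<in> carrier_mat n n" and S: "S \<in> carrier_mat n m"
    and pos: "\<And>i. i < m \<Longrightarrow> \<delta> i > 0"
    and Q_eq: "transpose_mat A * Q + Q * A + transpose_mat K * K = 0\<^sub>m n n"
    and D_eq: "transpose_mat B * mat_diag m \<delta> + mat_diag m \<delta> * B + transpose_mat J * J = 0\<^sub>m m m"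
    and S_eq: "transpose_mat A * S + S * B + transpose_mat K * J = 0\<^sub>m n m"
    and u: "u \<in> carrier_vec n" and v: "v \<in> carrier_vec m"
  defines "e \<equiv> u \<bullet> (Q *\<^sub>v u) + v \<bullet> (mat_diag m \<delta> *\<^sub>v v) - 2 * (u \<bullet> (S *\<^sub>v v))"
  shows "0 \<le> e"
    and "L2_norm_sq (\<lambda>t. K *\<^sub>v (mat_exp (t \<cdot>\<^sub>m A) *\<^sub>v u) - J *\<^sub>v (mat_exp (t \<cdot>\<^sub>m B) *\<^sub>v v)) \<le> ennreal e"
proof -
  let ?D = "mat_diag m \<delta>"
  define x where "x t = mat_exp (t \<cdot>\<^sub>m A) *\<^sub>v u" for t
  define y where "y t = mat_exp (t \<cdot>\<^sub>m B) *\<^sub>v v" for t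
  define f where "f t = (K *\<^sub>v x t - J *\<^sub>v y t) \<bullet> (K *\<^sub>v x t - J *\<^sub>v y t)" for t
  define E where "E t = x t \<bullet> (Q *\<^sub>v x t) + y t \<bullet> (?D *\<^sub>v y t) - 2 * (x t \<bullet> (S *\<^sub>v y t))" for t
  have D: "?D \<in> carrier_mat m m"
    by simp
  have x: "x t \<in> carrier_vec n" and y: "y t \<in> carrier_vec m" for t
    unfolding x_def y_def by (rule mat_exp_mult_vec_carrier[OF A(1) u], rule mat_exp_mult_vec_carrier[OF B v])
  have f_eq: "f t = (K *\<^sub>v x t) \<bullet> (K *\<^sub>v x t) + (J *\<^sub>v y t) \<bullet> (J *\<^sub>v y t) - 2 * ((K *\<^sub>v x t) \<bullet> (J *\<^sub>v y t))" for t
    unfolding f_def using K J x y by (intro scalar_prod_self_minus[of _ p] mult_mat_vec_carrier)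
  have f_nonneg: "0 \<le> f t" for t
    unfolding f_def by (rule scalar_prod_self_nonneg)
  have f_cont: "continuous_on UNIV f"
    unfolding f_eq x_def y_def
    by (intro continuous_intros continuous_bilinear_output[OF A(1) A(1) K K u u]
        continuous_bilinear_output[OF B B J J v v] continuous_bilinear_output[OF A(1) B K J u v])
  have E_deriv: "(E has_real_derivative - f t) (at t)" for t
  proof -
    have "(E has_real_derivative - ((K *\<^sub>v x t) \<bullet> (K *\<^sub>v x t)) + - ((J *\<^sub>v y t) \<bullet> (J *\<^sub>v y t))
        - 2 * - ((K *\<^sub>v x t) \<bullet> (J *\<^sub>v y t))) (at t)"
      unfolding E_def x_def y_def
      by (intro DERIV_add DERIV_diff DERIV_cmult
          bilinear_sylvester_has_derivative[OF A(1) A(1) Q K K u u Q_eq]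
          bilinear_sylvester_has_derivative[OF B B D J J v v D_eq]
          bilinear_sylvester_has_derivative[OF A(1) B S K J u v S_eq])
    moreover have "- a + - b - 2 * - c = - (a + b - 2 * c)" for a b c :: real
      by simp
    ultimately show ?thesis
      by (simp only: f_eq)
  qed
  have E_antimono: "E t \<le> E s" if "s \<le> t" for s t
  proof (rule DERIV_nonpos_imp_nonincreasing[OF that])
    show "\<exists>d. (E has_real_derivative d) (at r) \<and> d \<le> 0" for r
      using E_deriv[of r] f_nonneg[of r] by (intro exI[of _ "- f r"]) simp
  qed
  have y_energy: "y t \<bullet> (?D *\<^sub>v y t) = (\<Sum>i<m. \<delta> i * (y t $ i)\<^sup>2)" for t
  proof -
    have "(?D *\<^sub>v y t) $ i = \<delta> i * y t $ i" if "i < m" for i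
    proof -
      have "(?D *\<^sub>v y t) $ i = (\<Sum>l<m. ?D $$ (i, l) * y t $ l)"
        by (rule index_mult_vec_sum[OF D y that])
      also have "\<dots> = (\<Sum>l<m. if l = i then \<delta> i * y t $ i else 0)"
        using that by (intro sum.cong) (auto simp: mat_diag_def)
      finally show ?thesis
        using that by simp
    qed
    then show ?thesis
      unfolding scalar_prod_sum[OF mult_mat_vec_carrier[OF D y]]
      by (intro sum.cong) (auto simp: power2_eq_square)
  qed
  \<comment> \<open>The Lyapunov equation of the diagonal matrix makes y^T D y nonincreasing, so its
    initial value bounds every coordinate of \<open>y\<close>, all \<delta> being positive.\<close>
  define c where "c = y 0 \<bullet> (?D *\<^sub>v y 0)"
  have "y t \<bullet> (?D *\<^sub>v y t) \<le> c" if "t \<ge> 0" for t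
    unfolding c_def
  proof (rule DERIV_nonpos_imp_nonincreasing[OF that])
    show "\<exists>d. ((\<lambda>t. y t \<bullet> (?D *\<^sub>v y t)) has_real_derivative d) (at r) \<and> d \<le> 0" for r
      using bilinear_sylvester_has_derivative[OF B B D J J v v D_eq, of r]
        scalar_prod_self_nonneg[of "J *\<^sub>v y r"]
      unfolding y_def by (intro exI conjI) auto
  qed
  then have y_sq: "\<delta> j * (y t $ j)\<^sup>2 \<le> c" if "t \<ge> 0" "j < m" for t j
    unfolding y_energy using pos that
    by (intro order_trans[OF member_le_sum[of j "{..<m}" "\<lambda>i. \<delta> i * (y t $ i)\<^sup>2"]])
      (auto intro!: mult_nonneg_nonneg intro: less_imp_le)
  have y_bound: "\<bar>y t $ j\<bar> \<le> 1 + c / \<delta> j" if "t \<ge> 0" "j < m" for t j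
  proof -
    have "(y t $ j)\<^sup>2 \<le> c / \<delta> j"
      using y_sq[OF that] pos[OF that(2)] by (simp add: field_simps)
    \<comment> \<open>A crude bound by the square avoids square roots; only boundedness
      counts.\<close>
    moreover have "\<bar>a\<bar> \<le> 1 + a\<^sup>2" for a :: real
      using zero_le_power2[of "\<bar>a\<bar> - 1"] by (simp add: power2_diff)
    ultimately show ?thesis
      by (meson add_left_mono order_trans)
  qed
  have x_lim: "((\<lambda>t. x t $ i) \<longlongrightarrow> 0) at_top" if "i < n" for i
    unfolding x_def by (rule stable_mat_exp_vec_tendsto_0[OF A u that])
  have xx_lim: "((\<lambda>t. x t \<bullet> (Q *\<^sub>v x t)) \<longlongrightarrow> 0) at_top"
    by (rule bilinear_tendsto_0[OF Q x]) (intro tendsto_mult_zero x_lim)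
  have xy_lim: "((\<lambda>t. x t \<bullet> (S *\<^sub>v y t)) \<longlongrightarrow> 0) at_top"
  proof (rule bilinear_tendsto_0[OF S y])
    fix i j assume ij: "i < n" "j < m"
    have "((\<lambda>t. \<bar>x t $ i\<bar> * (1 + c / \<delta> j)) \<longlongrightarrow> 0) at_top"
      by (intro tendsto_mult_left_zero tendsto_rabs_zero x_lim ij)
    then show "((\<lambda>t. x t $ i * y t $ j) \<longlongrightarrow> 0) at_top"
      by (rule Lim_null_comparison[rotated])
        (use y_bound ij in \<open>auto simp: abs_mult intro!: eventually_at_top_linorderI[of 0] mult_left_mono\<close>)
  qed
  \<comment> \<open>\<open>E\<close> is nonincreasing and at late times at least x^T Q x - 2 x^T S
    y, which tends to 0; the term y^T D y is merely dropped as nonnegative.\<close>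
  have E_nonneg: "0 \<le> E t" for t
  proof -
    have "((\<lambda>t. x t \<bullet> (Q *\<^sub>v x t) - 2 * (x t \<bullet> (S *\<^sub>v y t))) \<longlongrightarrow> 0 - 2 * 0) at_top"
      by (intro tendsto_intros xx_lim xy_lim)
    moreover have "\<forall>\<^sub>F t' in at_top. x t' \<bullet> (Q *\<^sub>v x t') - 2 * (x t' \<bullet> (S *\<^sub>v y t')) \<le> E t"
    proof (rule eventually_at_top_linorderI[of t])
      fix t' assume "t \<le> t'"
      have "0 \<le> y t' \<bullet> (?D *\<^sub>v y t')"
        unfolding y_energy using pos by (intro sum_nonneg) (simp add: less_imp_le)
      with E_antimono[OF \<open>t \<le> t'\<close>] show "x t' \<bullet> (Q *\<^sub>v x t') - 2 * (x t' \<bullet> (S *\<^sub>v y t')) \<le> E t"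
        unfolding E_def[of t'] by linarith
    qed
    ultimately have "0 - 2 * 0 \<le> E t"
      by (rule tendsto_upperbound) simp
    then show ?thesis
      by simp
  qed
  have e_eq: "e = E 0"
    unfolding e_def E_def x_def y_def using u v by (simp add: mat_exp_zero[OF A(1)] mat_exp_zero[OF B])
  show "0 \<le> e"
    unfolding e_eq by (rule E_nonneg)
  have f_meas: "f \<in> borel_measurable borel"
    by (rule borel_measurable_continuous_onI[OF f_cont])
  \<comment> \<open>Cutting the integral at k reduces the claim to E 0 - E k \<le> E 0; monotone
    convergence removes the cut.\<close>
  let ?f = "\<lambda>(k :: nat) t. ennreal (f t) * indicator {0..real k} t"
  have "(\<integral>\<^sup>+t. ?f k t \<partial>lborel) \<le> ennreal e" for k
  proof -
    have "(\<integral>\<^sup>+t. ?f k t \<partial>lborel) = ennreal (- E (real k) - - E 0)"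
    proof (rule nn_integral_FTC_Icc[OF f_meas])
      show "((\<lambda>t. - E t) has_real_derivative f t) (at t)" for t
        using DERIV_minus[OF E_deriv, of t] by simp
    qed (simp_all add: f_nonneg)
    also have "\<dots> \<le> ennreal e"
      unfolding e_eq using E_nonneg by (intro ennreal_leI) simp
    finally show ?thesis .
  qed
  moreover have "(\<lambda>k. \<integral>\<^sup>+t. ?f k t \<partial>lborel) \<longlonglongrightarrow> (\<integral>\<^sup>+t. ennreal (f t) * indicator {0..} t \<partial>lborel)"
  proof (rule nn_integral_LIMSEQ)
    show "incseq ?f"
      by (auto simp: incseq_def le_fun_def split: split_indicator)
    show "?f k \<in> borel_measurable lborel" for k
      using f_meas by simp
    show "(\<lambda>k. ?f k t) \<longlonglongrightarrow> ennreal (f t) * indicator {0..} t" for t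
      by (intro tendsto_eventually eventually_sequentiallyI[of "nat \<lceil>t\<rceil>"])
        (auto split: split_indicator simp: nat_le_iff ceiling_le_iff)
  qed
  ultimately have "(\<integral>\<^sup>+t. ennreal (f t) * indicator {0..} t \<partial>lborel) \<le> ennreal e"
    by (intro LIMSEQ_le_const2) auto
  then show "L2_norm_sq (\<lambda>t. K *\<^sub>v (mat_exp (t \<cdot>\<^sub>m A) *\<^sub>v u) - J *\<^sub>v (mat_exp (t \<cdot>\<^sub>m B) *\<^sub>v v)) \<le> ennreal e"
    unfolding L2_norm_sq_def f_def x_def y_def .
qed

subsection \<open>Quadratic forms of a standard normal vector\<close>

lemma std_normal_vector_second_moment:
  assumes Z: "std_normal_vector s M Z" and ij: "i < s" "j < s"
  shows "integrable M (\<lambda>\<omega>. Z \<omega> $ i * Z \<omega> $ j)"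
    and "(\<integral>\<omega>. Z \<omega> $ i * Z \<omega> $ j \<partial>M) = (if i = j then 1 else 0)"
proof -
  interpret prob_space M
    using Z by (simp add: std_normal_vector_def)
  have D: "distributed M lborel (\<lambda>\<omega>. Z \<omega> $ k) std_normal_density" if "k < s" for k
    using Z that by (simp add: std_normal_vector_def)
  have int1: "integrable M (\<lambda>\<omega>. Z \<omega> $ k)" if "k < s" for k
    using distributed_integrable[OF D[OF that], of "\<lambda>x. x"] integrable_std_normal_moment[of 1] by simp
  have mean: "expectation (\<lambda>\<omega>. Z \<omega> $ k) = 0" if "k < s" for k
    by (rule standard_normal_distributed_expectation[OF D[OF that]])
  have "integrable M (\<lambda>\<omega>. Z \<omega> $ i * Z \<omega> $ j) \<and>
      (\<integral>\<omega>. Z \<omega> $ i * Z \<omega> $ j \<partial>M) = (if i = j then 1 else 0)"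
  proof (cases "i = j")
    case True
    have "integrable M (\<lambda>\<omega>. (Z \<omega> $ j)\<^sup>2)"
      using distributed_integrable[OF D[OF ij(2)], of "\<lambda>x. x\<^sup>2"] integrable_std_normal_moment[of 2] by simp
    moreover have "(\<integral>\<omega>. (Z \<omega> $ j)\<^sup>2 \<partial>M) = 1"
      using distributed_integral[OF D[OF ij(2)], of "\<lambda>x. x\<^sup>2"] integral_std_normal_moment_even[of 1] by simp
    ultimately show ?thesis
      using True by (simp add: power2_eq_square)
  next
    case False
    have indep: "indep_vars (\<lambda>_. borel) (\<lambda>i \<omega>. Z \<omega> $ i) {i, j}"
      using Z ij by (auto simp: std_normal_vector_def intro: indep_vars_subset)
    have "integrable M (\<lambda>\<omega>. \<Prod>k\<in>{i, j}. Z \<omega> $ k)"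
      by (rule indep_vars_integrable[OF _ indep]) (use int1 ij in auto)
    moreover have "(\<integral>\<omega>. (\<Prod>k\<in>{i, j}. Z \<omega> $ k) \<partial>M) = (\<Prod>k\<in>{i, j}. expectation (\<lambda>\<omega>. Z \<omega> $ k))"
      by (rule indep_vars_lebesgue_integral[OF _ indep]) (use int1 ij in auto)
    ultimately show ?thesis
      using False mean[OF ij(1)] by simp
  qed
  then show "integrable M (\<lambda>\<omega>. Z \<omega> $ i * Z \<omega> $ j)"
    "(\<integral>\<omega>. Z \<omega> $ i * Z \<omega> $ j \<partial>M) = (if i = j then 1 else 0)"
    by auto
qed

text \<open>Only the diagonal of \<open>X\<close> survives, as the coordinates are uncorrelated with
  second moment 1. Nonnegativity of the form makes the integral of the \<open>ennreal\<close> values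
  agree with the real mean.\<close>

lemma nn_integral_std_normal_quadratic_form:
  assumes Z: "std_normal_vector s M Z" and X: "X \<in> carrier_mat s s"
    and nonneg: "\<And>v. v \<in> carrier_vec s \<Longrightarrow> 0 \<le> v \<bullet> (X *\<^sub>v v)"
  shows "(\<integral>\<^sup>+\<omega>. ennreal (Z \<omega> \<bullet> (X *\<^sub>v Z \<omega>)) \<partial>M) = ennreal (mat_trace X)"
proof -
  have Z_carrier: "Z \<omega> \<in> carrier_vec s" if "\<omega> \<in> space M" for \<omega>
    using Z that by (simp add: std_normal_vector_def)
  let ?q = "\<lambda>\<omega>. \<Sum>i<s. \<Sum>j<s. X $$ (i, j) * (Z \<omega> $ i * Z \<omega> $ j)"
  have q: "Z \<omega> \<bullet> (X *\<^sub>v Z \<omega>) = ?q \<omega>" if "\<omega> \<in> space M" for \<omega>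
    using X Z_carrier[OF that]
    by (simp add: scalar_prod_sum[of _ s] index_mult_vec_sum[of X s s] sum_distrib_left mult_ac
        del: index_mult_mat_vec)
  have int: "integrable M ?q"
    by (intro Bochner_Integration.integrable_sum integrable_mult_right std_normal_vector_second_moment[OF Z]) auto
  have "(\<integral>\<^sup>+\<omega>. ennreal (Z \<omega> \<bullet> (X *\<^sub>v Z \<omega>)) \<partial>M) = (\<integral>\<^sup>+\<omega>. ennreal (?q \<omega>) \<partial>M)"
    by (intro nn_integral_cong) (simp add: q)
  also have "\<dots> = ennreal (\<integral>\<omega>. ?q \<omega> \<partial>M)"
    by (rule nn_integral_eq_integral[OF int]) (use nonneg[OF Z_carrier] q in \<open>auto intro!: AE_I2\<close>)
  also have "(\<integral>\<omega>. ?q \<omega> \<partial>M) = (\<Sum>i<s. \<Sum>j<s. X $$ (i, j) * (\<integral>\<omega>. Z \<omega> $ i * Z \<omega> $ j \<partial>M))"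
  proof -
    have "(\<integral>\<omega>. ?q \<omega> \<partial>M) = (\<Sum>i<s. \<integral>\<omega>. (\<Sum>j<s. X $$ (i, j) * (Z \<omega> $ i * Z \<omega> $ j)) \<partial>M)"
      by (intro Bochner_Integration.integral_sum Bochner_Integration.integrable_sum integrable_mult_right
          std_normal_vector_second_moment[OF Z]) auto
    also have "\<dots> = (\<Sum>i<s. \<Sum>j<s. \<integral>\<omega>. X $$ (i, j) * (Z \<omega> $ i * Z \<omega> $ j) \<partial>M)"
      by (intro sum.cong refl Bochner_Integration.integral_sum integrable_mult_right
          std_normal_vector_second_moment[OF Z]) auto
    finally show ?thesis
      by simp
  qed
  also have "\<dots> = mat_trace X"
    using X by (simp add: std_normal_vector_second_moment[OF Z] mat_trace_def if_distrib cong: if_cong)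
  finally show ?thesis .
qed

text \<open>Diagonal entries are values of the form at unit vectors. The sign is what later permits
  multiplication by s.\<close>

lemma mat_trace_nonneg:
  assumes X: "X \<in> carrier_mat s s" and nonneg: "\<And>v. v \<in> carrier_vec s \<Longrightarrow> 0 \<le> v \<bullet> (X *\<^sub>v v)"
  shows "0 \<le> mat_trace X"
proof -
  have "0 \<le> X $$ (i, i)" if "i < s" for i
    using nonneg[of "unit_vec s i"] unit_bilinear[OF X that that] by simp
  then show ?thesis
    using X by (auto simp: mat_trace_def intro!: sum_nonneg)
qed

subsection \<open>Traces\<close>

lemma mat_trace_add:
  assumes "X \<in> carrier_mat n n" "Y \<in> carrier_mat n n"
  shows "mat_trace (X + Y) = mat_trace X + mat_trace Y"
  using assms by (simp add: mat_trace_def sum.distrib)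

lemma mat_trace_minus:
  assumes "X \<in> carrier_mat n n" "Y \<in> carrier_mat n n"
  shows "mat_trace (X - Y) = mat_trace X - mat_trace Y"
  using assms by (simp add: mat_trace_def sum_subtractf)

lemma mat_trace_uminus: "X \<in> carrier_mat n n \<Longrightarrow> mat_trace (- X) = - mat_trace X"
  by (simp add: mat_trace_def sum_negf)

lemma mat_trace_smult: "X \<in> carrier_mat n n \<Longrightarrow> mat_trace (c \<cdot>\<^sub>m X) = c * mat_trace X"
  by (simp add: mat_trace_def sum_distrib_left)

lemma mat_trace_zero [simp]: "mat_trace (0\<^sub>m n n) = 0"
  by (simp add: mat_trace_def)

lemma mat_trace_transpose: "X \<in> carrier_mat n n \<Longrightarrow> mat_trace (transpose_mat X) = mat_trace X"
  by (simp add: mat_trace_def)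

lemma mat_trace_mult_comm:
  assumes X: "X \<in> carrier_mat n m" and Y: "Y \<in> carrier_mat m n"
  shows "mat_trace (X * Y) = mat_trace (Y * X)"
proof -
  have "mat_trace (X * Y) = (\<Sum>i<n. \<Sum>l<m. X $$ (i, l) * Y $$ (l, i))"
    using assms by (simp add: mat_trace_def index_mult_sum[OF X Y] del: index_mult_mat(1))
  also have "\<dots> = (\<Sum>l<m. \<Sum>i<n. Y $$ (l, i) * X $$ (i, l))"
    by (subst sum.swap) (simp add: mult.commute)
  also have "\<dots> = mat_trace (Y * X)"
    using assms by (simp add: mat_trace_def index_mult_sum[OF Y X] del: index_mult_mat(1))
  finally show ?thesis .
qed

text \<open>Each diagonal entry of the product is the squared length of a row of
  \<open>X\<close>.\<close>

lemma mult_transpose_self_eq_0: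
  fixes X :: "real mat"
  assumes X: "X \<in> carrier_mat n m" and eq: "X * transpose_mat X = 0\<^sub>m n n"
  shows "X = 0\<^sub>m n m"
proof (rule eq_matI)
  fix i j assume "i < dim_row (0\<^sub>m n m :: real mat)" "j < dim_col (0\<^sub>m n m :: real mat)"
  then have ij: "i < n" "j < m"
    by auto
  have "(\<Sum>l<m. (X $$ (i, l))\<^sup>2) = (X * transpose_mat X) $$ (i, i)"
    using X ij
    by (simp add: index_mult_sum[of _ n m _ n] power2_eq_square del: index_mult_mat(1))
  also have "\<dots> = 0"
    unfolding eq using ij by simp
  finally have "(X $$ (i, j))\<^sup>2 = 0"
    using ij by (subst (asm) sum_nonneg_eq_0_iff) auto
  then show "X $$ (i, j) = 0\<^sub>m n m $$ (i, j)"
    using ij by simp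
qed (use X in auto)

text \<open>Here \<open>\<Phi>\<close> is the oblique projector onto the retained states and \<open>T\<close> the lifted solution
  of the Sylvester equation.\<close>

lemma truncation_trace_identity:
  fixes A P Q \<Gamma> N T \<Phi> :: "real mat"
  assumes carr: "A \<in> carrier_mat n n" "P \<in> carrier_mat n n" "Q \<in> carrier_mat n n"
      "\<Gamma> \<in> carrier_mat n n" "N \<in> carrier_mat n n" "T \<in> carrier_mat n n" "\<Phi> \<in> carrier_mat n n"
    and sym: "transpose_mat P = P" "transpose_mat Q = Q"
    and P_eq: "A * P + P * transpose_mat A + \<Gamma> = 0\<^sub>m n n"
    and Q_eq: "transpose_mat A * Q + Q * A + N = 0\<^sub>m n n"
    and T_eq: "transpose_mat A * T + T * A * \<Phi> + N * \<Phi> = 0\<^sub>m n n"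
    and T\<Phi>: "T * \<Phi> = T"
    and P\<Phi>: "\<Phi> * P = P * transpose_mat \<Phi>"
    and Q\<Phi>: "Q * \<Phi> = transpose_mat \<Phi> * Q"
  shows "mat_trace (Q * \<Gamma>) + mat_trace (Q * \<Phi> * \<Gamma>) - 2 * mat_trace (T * \<Gamma>) =
    mat_trace ((Q - Q * \<Phi>) * \<Gamma>) + 2 * mat_trace (T * A * (P - \<Phi> * P))"
proof -
  let ?A = "transpose_mat A"
  note cl = mult_carrier_mat[of _ n n _ n] add_carrier_mat minus_carrier_mat uminus_carrier_mat
    transpose_carrier_mat[THEN iffD2] carr
  note assoc = assoc_mult_mat[of _ n n _ n _ n]
  note cyc = mat_trace_mult_comm[of _ n n]
  note neg = neg_eq_if_add_eq_zero_mat[of _ n n]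
  have \<Gamma>: "\<Gamma> = - (A * P + P * ?A)"
  proof (rule neg)
    show "\<Gamma> + (A * P + P * ?A) = 0\<^sub>m n n"
      unfolding P_eq[symmetric] by (rule comm_add_mat[of _ n n]; intro cl)
  qed (intro cl)+
  have N: "N = - (?A * Q + Q * A)"
  proof (rule neg)
    show "N + (?A * Q + Q * A) = 0\<^sub>m n n"
      unfolding Q_eq[symmetric] by (rule comm_add_mat[of _ n n]; intro cl)
  qed (intro cl)+
  have AT: "?A * T = - (T * A * \<Phi> + N * \<Phi>)"
  proof (rule neg)
    show "?A * T + (T * A * \<Phi> + N * \<Phi>) = 0\<^sub>m n n"
      unfolding T_eq[symmetric] by (rule assoc_add_mat[of _ n n, symmetric]; intro cl)
  qed (intro cl)+
  have trsum: "mat_trace (- (X + Y)) = - mat_trace X - mat_trace Y"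
    if "X \<in> carrier_mat n n" "Y \<in> carrier_mat n n" for X Y
    using that by (simp add: mat_trace_add[of _ n] mat_trace_uminus[of _ n])
  have tr\<Gamma>: "mat_trace (X * \<Gamma>) = - mat_trace (X * (A * P)) - mat_trace (X * (P * ?A))"
    if X: "X \<in> carrier_mat n n" for X
  proof -
    have "X * \<Gamma> = - (X * (A * P + P * ?A))"
      unfolding \<Gamma> by (rule uminus_mult_right_mat) (use X carr in simp)
    also have "X * (A * P + P * ?A) = X * (A * P) + X * (P * ?A)"
      by (rule mult_add_distrib_mat[of _ n n _ n]; intro cl X)
    finally show ?thesis
      by (simp only:) (rule trsum; intro cl X)
  qed
  have trN: "mat_trace (N * X) = - mat_trace (?A * Q * X) - mat_trace (Q * A * X)"
    if X: "X \<in> carrier_mat n n" for X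
  proof -
    have "N * X = - ((?A * Q + Q * A) * X)"
      unfolding N by (rule uminus_mult_left_mat) (use X carr in simp)
    also have "(?A * Q + Q * A) * X = ?A * Q * X + Q * A * X"
      by (rule add_mult_distrib_mat[of _ n n _ _ n]; intro cl X)
    finally show ?thesis
      by (simp only:) (rule trsum; intro cl X)
  qed
  \<comment> \<open>The commutation rules make \<open>\<Phi> * P\<close> symmetric and reduce the
    mixed traces of Q, \<Phi>, P and A in the expansion to this one number. It cancels at the end: 2
    tr(Q \<Phi> \<Gamma>) contributes -4 \<mu> and -2 tr(T \<Gamma>) contributes 4 \<mu>.\<close>
  define \<mu> where "\<mu> = mat_trace (Q * A * (\<Phi> * P))"
  have \<Phi>P: "transpose_mat (\<Phi> * P) = \<Phi> * P"
    unfolding transpose_mult[OF carr(7,2)] sym by (rule P\<Phi>[symmetric])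
  have 2: "mat_trace (?A * Q * (\<Phi> * P)) = \<mu>"
  proof -
    have "mat_trace (?A * Q * (\<Phi> * P)) = mat_trace (transpose_mat (?A * Q * (\<Phi> * P)))"
      by (rule mat_trace_transpose[of _ n, symmetric]; intro cl)
    also have "transpose_mat (?A * Q * (\<Phi> * P)) = transpose_mat (\<Phi> * P) * transpose_mat (?A * Q)"
      by (rule transpose_mult[of _ n n _ n]; intro cl)
    also have "transpose_mat (?A * Q) = transpose_mat Q * transpose_mat ?A"
      by (rule transpose_mult[of _ n n _ n]; intro cl)
    also have "transpose_mat (\<Phi> * P) * (transpose_mat Q * transpose_mat ?A) = \<Phi> * P * (Q * A)"
      by (simp only: \<Phi>P sym transpose_transpose)
    also have "mat_trace \<dots> = \<mu>"
      unfolding \<mu>_def by (rule cyc; intro cl)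
    finally show ?thesis .
  qed
  have 3: "mat_trace (Q * \<Phi> * (A * P)) = \<mu>"
  proof -
    have "Q * \<Phi> * (A * P) = transpose_mat \<Phi> * (Q * (A * P))"
      unfolding Q\<Phi> by (rule assoc; intro cl)
    also have "mat_trace \<dots> = mat_trace (Q * (A * P) * transpose_mat \<Phi>)"
      by (rule cyc; intro cl)
    also have "Q * (A * P) = Q * A * P"
      by (rule assoc[symmetric]; intro cl)
    also have "Q * A * P * transpose_mat \<Phi> = Q * A * (P * transpose_mat \<Phi>)"
      by (rule assoc; intro cl)
    finally show ?thesis
      by (simp only: \<mu>_def P\<Phi>)
  qed
  have 4: "mat_trace (Q * \<Phi> * (P * ?A)) = \<mu>"
  proof -
    have "Q * \<Phi> * (P * ?A) = Q * \<Phi> * P * ?A"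
      by (rule assoc[symmetric]; intro cl)
    also have "Q * \<Phi> * P = Q * (\<Phi> * P)"
      by (rule assoc; intro cl)
    also have "mat_trace (Q * (\<Phi> * P) * ?A) = mat_trace (?A * (Q * (\<Phi> * P)))"
      by (rule cyc; intro cl)
    also have "?A * (Q * (\<Phi> * P)) = ?A * Q * (\<Phi> * P)"
      by (rule assoc[symmetric]; intro cl)
    finally show ?thesis
      by (simp only: 2)
  qed
  have tr1: "mat_trace (Q * \<Phi> * \<Gamma>) = - 2 * \<mu>"
    using tr\<Gamma>[OF mult_carrier_mat[OF carr(3,7)]] 3 4 by linarith
  have trN': "mat_trace (N * (\<Phi> * P)) = - 2 * \<mu>"
    using trN[OF mult_carrier_mat[OF carr(7,2)]] 2 \<mu>_def by linarith
  \<comment> \<open>Here the Sylvester equation enters: after a cyclic shift A^T T is replaced, so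
    that \<open>A\<close> reappears to the right of \<open>T\<close> and can be paired with T A
    P.\<close>
  have 5: "mat_trace (T * (P * ?A)) = - mat_trace (T * A * (\<Phi> * P)) - mat_trace (N * (\<Phi> * P))"
  proof -
    have "T * (P * ?A) = T * P * ?A"
      by (rule assoc[symmetric]; intro cl)
    also have "mat_trace \<dots> = mat_trace (?A * (T * P))"
      by (rule cyc; intro cl)
    also have "?A * (T * P) = ?A * T * P"
      by (rule assoc[symmetric]; intro cl)
    also have "\<dots> = - ((T * A * \<Phi> + N * \<Phi>) * P)"
      unfolding AT by (rule uminus_mult_left_mat) (use carr in simp)
    also have "(T * A * \<Phi> + N * \<Phi>) * P = T * A * \<Phi> * P + N * \<Phi> * P"
      by (rule add_mult_distrib_mat[of _ n n _ _ n]; intro cl)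
    also have "T * A * \<Phi> * P = T * A * (\<Phi> * P)"
      by (rule assoc; intro cl)
    also have "N * \<Phi> * P = N * (\<Phi> * P)"
      by (rule assoc; intro cl)
    finally show ?thesis
      by (simp only:) (rule trsum; intro cl)
  qed
  have 6: "mat_trace (T * A * (P - \<Phi> * P)) = mat_trace (T * (A * P)) - mat_trace (T * A * (\<Phi> * P))"
  proof -
    have "T * A * (P - \<Phi> * P) = T * A * P - T * A * (\<Phi> * P)"
      by (rule mult_minus_distrib_mat[of _ n n _ n]; intro cl)
    also have "T * A * P = T * (A * P)"
      by (rule assoc; intro cl)
    finally show ?thesis
      by (simp only:) (rule mat_trace_minus[of _ n]; intro cl)
  qed
  have 7: "mat_trace ((Q - Q * \<Phi>) * \<Gamma>) = mat_trace (Q * \<Gamma>) - mat_trace (Q * \<Phi> * \<Gamma>)"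
  proof -
    have "(Q - Q * \<Phi>) * \<Gamma> = Q * \<Gamma> - Q * \<Phi> * \<Gamma>"
      by (rule minus_mult_distrib_mat[of _ n n _ _ n]; intro cl)
    then show ?thesis
      by (simp only:) (rule mat_trace_minus[of _ n]; intro cl)
  qed
  show ?thesis
    using 6 7 tr\<Gamma>[OF carr(6)] 5 trN' tr1 by linarith
qed

subsection \<open>Balanced pairs of Gramians\<close>

lemma take_drop_cols_carrier [simp]:
  "M \<in> carrier_mat n m \<Longrightarrow> take_cols r M \<in> carrier_mat n r"
  "M \<in> carrier_mat n m \<Longrightarrow> drop_cols r M \<in> carrier_mat n (m - r)"
  "M \<in> carrier_mat n m \<Longrightarrow> drop_rows r M \<in> carrier_mat (n - r) m"
  by (auto simp: take_cols_def drop_cols_def drop_rows_def)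

lemma mat_diag_mult_index:
  fixes X :: "real mat"
  assumes "X \<in> carrier_mat n m" "i < n" "j < m"
  shows "(mat_diag n f * X) $$ (i, j) = f i * X $$ (i, j)"
  using assms by (simp add: mat_diag_mult_left[OF assms(1)])

lemma mult_mat_diag_index:
  fixes X :: "real mat"
  assumes "X \<in> carrier_mat n m" "i < n" "j < m"
  shows "(X * mat_diag m f) $$ (i, j) = X $$ (i, j) * f j"
  using assms by (simp add: mat_diag_mult_right[OF assms(1)])

lemma transpose_mat_diag [simp]: "transpose_mat (mat_diag n f) = mat_diag n f"
  by (auto simp: mat_diag_def)

lemma mat_diag_sandwich_index:
  fixes X Y :: "real mat"
  assumes X: "X \<in> carrier_mat n m" and Y: "Y \<in> carrier_mat k m" and ij: "i < n" "j < k"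
  shows "(X * mat_diag m f * transpose_mat Y) $$ (i, j) = (\<Sum>l<m. X $$ (i, l) * f l * Y $$ (j, l))"
proof -
  have "(X * mat_diag m f * transpose_mat Y) $$ (i, j) =
      (\<Sum>l<m. (X * mat_diag m f) $$ (i, l) * transpose_mat Y $$ (l, j))"
    by (rule index_mult_sum[of _ n m _ k]) (use assms in auto)
  also have "\<dots> = (\<Sum>l<m. X $$ (i, l) * f l * Y $$ (j, l))"
    using assms by (intro sum.cong) (auto simp: mult_mat_diag_index simp del: index_mult_mat(1))
  finally show ?thesis .
qed

text \<open>Terms beyond the cut are multiplied by 0. Padding the diagonal with zeros turns products
  of truncated rectangular matrices into products of full ones, so that the later algebra takes
  place among d x d matrices.\<close>

lemma take_cols_sandwich:
  fixes X Y :: "real mat"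
  assumes X: "X \<in> carrier_mat n m" and Y: "Y \<in> carrier_mat k m" and r: "r \<le> m"
  shows "take_cols r X * mat_diag r f * transpose_mat (take_cols r Y) =
    X * mat_diag m (\<lambda>i. if i < r then f i else 0) * transpose_mat Y"
proof (rule eq_matI)
  fix i j assume "i < dim_row (X * mat_diag m (\<lambda>i. if i < r then f i else 0) * transpose_mat Y)"
    "j < dim_col (X * mat_diag m (\<lambda>i. if i < r then f i else 0) * transpose_mat Y)"
  then have ij: "i < n" "j < k"
    using X Y by auto
  have "(\<Sum>l<r. X $$ (i, l) * f l * Y $$ (j, l)) = (\<Sum>l<m. X $$ (i, l) * (if l < r then f l else 0) * Y $$ (j, l))"
    using r by (intro sum.mono_neutral_cong_left) auto
  then show "(take_cols r X * mat_diag r f * transpose_mat (take_cols r Y)) $$ (i, j) =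
      (X * mat_diag m (\<lambda>i. if i < r then f i else 0) * transpose_mat Y) $$ (i, j)"
    unfolding mat_diag_sandwich_index[OF X Y ij]
      mat_diag_sandwich_index[OF take_drop_cols_carrier(1)[OF X] take_drop_cols_carrier(1)[OF Y] ij]
    using X Y ij by (simp add: take_cols_def)
qed (use X Y in \<open>auto simp: take_cols_def\<close>)

lemma drop_cols_sandwich:
  fixes X Y :: "real mat"
  assumes X: "X \<in> carrier_mat n m" and Y: "Y \<in> carrier_mat k m" and r: "r \<le> m"
  shows "drop_cols r X * mat_diag (m - r) (\<lambda>i. f (r + i)) * transpose_mat (drop_cols r Y) =
    X * mat_diag m (\<lambda>i. if r \<le> i then f i else 0) * transpose_mat Y"
proof (rule eq_matI)
  fix i j assume "i < dim_row (X * mat_diag m (\<lambda>i. if r \<le> i then f i else 0) * transpose_mat Y)"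
    "j < dim_col (X * mat_diag m (\<lambda>i. if r \<le> i then f i else 0) * transpose_mat Y)"
  then have ij: "i < n" "j < k"
    using X Y by auto
  have "(\<Sum>l<m - r. X $$ (i, r + l) * f (r + l) * Y $$ (j, r + l)) =
      (\<Sum>l=r..<m. X $$ (i, l) * f l * Y $$ (j, l))"
    using sum.shift_bounds_nat_ivl[of "\<lambda>l. X $$ (i, l) * f l * Y $$ (j, l)" 0 r "m - r"] r
    by (simp add: lessThan_atLeast0 add.commute)
  also have "\<dots> = (\<Sum>l<m. X $$ (i, l) * (if r \<le> l then f l else 0) * Y $$ (j, l))"
    by (intro sum.mono_neutral_cong_left) auto
  finally show "(drop_cols r X * mat_diag (m - r) (\<lambda>i. f (r + i)) * transpose_mat (drop_cols r Y)) $$ (i, j) =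
      (X * mat_diag m (\<lambda>i. if r \<le> i then f i else 0) * transpose_mat Y) $$ (i, j)"
    unfolding mat_diag_sandwich_index[OF X Y ij]
      mat_diag_sandwich_index[OF take_drop_cols_carrier(2)[OF X] take_drop_cols_carrier(2)[OF Y] ij]
    using X Y ij by (simp add: drop_cols_def)
qed (use X Y in \<open>auto simp: drop_cols_def\<close>)

lemma take_cols_mult:
  fixes X Y :: "real mat"
  assumes X: "X \<in> carrier_mat n m" and Y: "Y \<in> carrier_mat m k" and r: "r \<le> k"
  shows "take_cols r (X * Y) = X * take_cols r Y"
proof (rule eq_matI)
  fix i j assume "i < dim_row (X * take_cols r Y)" "j < dim_col (X * take_cols r Y)"
  then have ij: "i < n" "j < r"
    using X by (auto simp: take_cols_def)
  have "(X * take_cols r Y) $$ (i, j) = (\<Sum>l<m. X $$ (i, l) * take_cols r Y $$ (l, j))"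
    by (rule index_mult_sum[OF X take_drop_cols_carrier(1)[OF Y] ij])
  also have "\<dots> = (\<Sum>l<m. X $$ (i, l) * Y $$ (l, j))"
    using Y ij by (simp add: take_cols_def)
  also have "\<dots> = (X * Y) $$ (i, j)"
    using ij r by (intro index_mult_sum[OF X Y, symmetric]) auto
  finally show "take_cols r (X * Y) $$ (i, j) = (X * take_cols r Y) $$ (i, j)"
    using X ij by (simp add: take_cols_def del: index_mult_mat(1))
qed (use X in \<open>auto simp: take_cols_def\<close>)

lemma drop_rows_mult:
  fixes X Y :: "real mat"
  assumes X: "X \<in> carrier_mat m n" and Y: "Y \<in> carrier_mat m k"
  shows "drop_rows r (transpose_mat X * Y) = transpose_mat (drop_cols r X) * Y"
proof (rule eq_matI)
  fix i j assume "i < dim_row (transpose_mat (drop_cols r X) * Y)" "j < dim_col (transpose_mat (drop_cols r X) * Y)"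
  then have ij: "i < n - r" "j < k"
    using X Y by (auto simp: drop_cols_def)
  have "(transpose_mat (drop_cols r X) * Y) $$ (i, j) =
      (\<Sum>l<m. transpose_mat (drop_cols r X) $$ (i, l) * Y $$ (l, j))"
    using X Y ij by (intro index_mult_sum[of _ "n - r" m _ k]) auto
  also have "\<dots> = (\<Sum>l<m. transpose_mat X $$ (r + i, l) * Y $$ (l, j))"
    using X ij by (simp add: drop_cols_def)
  also have "\<dots> = (transpose_mat X * Y) $$ (r + i, j)"
    using X Y ij by (intro index_mult_sum[of _ n m _ k, symmetric]) auto
  finally show "drop_rows r (transpose_mat X * Y) $$ (i, j) = (transpose_mat (drop_cols r X) * Y) $$ (i, j)"
    using X Y ij by (simp add: drop_rows_def del: index_mult_mat(1))
qed (use X Y in \<open>auto simp: drop_rows_def drop_cols_def\<close>)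

lemma sandwich_index_take_cols:
  fixes X M :: "real mat"
  assumes X: "X \<in> carrier_mat n m" and M: "M \<in> carrier_mat n n" and ij: "i < r" "j < r" "r \<le> m"
  shows "(transpose_mat (take_cols r X) * M * take_cols r X) $$ (i, j) = (transpose_mat X * M * X) $$ (i, j)"
proof -
  have "transpose_mat (take_cols r X) $$ (i, l) = transpose_mat X $$ (i, l)" if "l < n" for l
    using X ij that by (simp add: take_cols_def)
  then have *: "(transpose_mat (take_cols r X) * M) $$ (i, l) = (transpose_mat X * M) $$ (i, l)" if "l < n" for l
    using X M ij that
    by (simp add: index_mult_sum[of _ r n _ n] index_mult_sum[of _ m n _ n] del: index_mult_mat(1))
  have "(transpose_mat (take_cols r X) * M * take_cols r X) $$ (i, j) =
      (\<Sum>l<n. (transpose_mat (take_cols r X) * M) $$ (i, l) * take_cols r X $$ (l, j))"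
    by (rule index_mult_sum[of _ r n _ r]) (use X M ij in \<open>auto intro!: mult_carrier_mat[of _ r n]\<close>)
  also have "\<dots> = (\<Sum>l<n. (transpose_mat X * M) $$ (i, l) * X $$ (l, j))"
  proof (rule sum.cong)
    fix l assume "l \<in> {..<n}"
    then have "take_cols r X $$ (l, j) = X $$ (l, j)" "l < n"
      using X ij by (auto simp: take_cols_def)
    then show "(transpose_mat (take_cols r X) * M) $$ (i, l) * take_cols r X $$ (l, j) =
        (transpose_mat X * M) $$ (i, l) * X $$ (l, j)"
      by (simp only: *)
  qed simp
  also have "\<dots> = (transpose_mat X * M * X) $$ (i, j)"
    by (rule index_mult_sum[of _ m n _ m, symmetric]) (use X M ij in \<open>auto intro!: mult_carrier_mat[of _ m n]\<close>)
  finally show ?thesis .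
qed

text \<open>Only the static data are fixed, because these assumptions are invariant under exchanging
  (P, W) with (Q, V): what is proved for \<open>P\<close> in this setting also holds for
  \<open>Q\<close>.\<close>

locale balanced =
  fixes d :: nat and P Q :: "real mat" and \<sigma> :: "nat \<Rightarrow> real" and W V :: "real mat"
  assumes P: "P \<in> carrier_mat d d" "transpose_mat P = P"
    and Q: "Q \<in> carrier_mat d d" "transpose_mat Q = Q"
    and \<sigma>_nonneg: "i < d \<Longrightarrow> 0 \<le> \<sigma> i"
    and \<sigma>_antimono: "i \<le> j \<Longrightarrow> j < d \<Longrightarrow> \<sigma> j \<le> \<sigma> i"
    and bases: "balancing_bases d P Q \<sigma> W V"
begin

definition q where "q = num_nonzero d \<sigma>"

text \<open>Monotonicity makes the indices of the nonzero values an initial segment, so the count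
  \<open>q\<close> is also the cut-off index.\<close>

lemma \<sigma>_nonzero_set: "{i. i < d \<and> \<sigma> i \<noteq> 0} = {..<q}"
proof -
  let ?S = "{i. i < d \<and> \<sigma> i \<noteq> 0}"
  have down: "i \<in> ?S" if "j \<in> ?S" "i \<le> j" for i j
  proof -
    have "0 < \<sigma> j"
      using that(1) \<sigma>_nonneg[of j] by simp
    then show ?thesis
      using that \<sigma>_antimono[OF that(2)] by simp
  qed
  obtain m where m: "?S = {..<m}"
  proof (cases "?S = {}")
    case True
    then have "?S = {..<0}"
      by simp
    then show ?thesis
      by (rule that)
  next
    case False
    have fin: "finite ?S"
      by simp
    have "?S = {..<Suc (Max ?S)}"
    proof (intro equalityI subsetI)
      fix i assume "i \<in> ?S"
      then show "i \<in> {..<Suc (Max ?S)}"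
        using Max_ge[OF fin] by (simp only: lessThan_iff less_Suc_eq_le)
    next
      fix i assume "i \<in> {..<Suc (Max ?S)}"
      then have "i \<le> Max ?S"
        by (simp only: lessThan_iff less_Suc_eq_le)
      then show "i \<in> ?S"
        by (rule down[OF Max_in[OF fin False]])
    qed
    then show ?thesis
      by (rule that)
  qed
  then have "q = m"
    unfolding q_def num_nonzero_def by simp
  with m show ?thesis
    by simp
qed

lemma \<sigma>_eq_0_iff: "i < d \<Longrightarrow> \<sigma> i = 0 \<longleftrightarrow> q \<le> i"
  using \<sigma>_nonzero_set[unfolded set_eq_iff, rule_format, of i] by auto

lemma \<sigma>_pos: "i < q \<Longrightarrow> \<sigma> i > 0"
  using \<sigma>_nonzero_set[unfolded set_eq_iff, rule_format, of i] \<sigma>_nonneg[of i] by auto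

lemma q_le: "q \<le> d"
proof (rule ccontr)
  assume "\<not> q \<le> d"
  then have "d \<in> {..<q}"
    by simp
  then show False
    unfolding \<sigma>_nonzero_set[symmetric] by simp
qed

lemma W: "W \<in> carrier_mat d d" and V: "V \<in> carrier_mat d d"
  and PQW: "P * Q * W = W * mat_diag d (\<lambda>i. (\<sigma> i)\<^sup>2)"
  and VPQ: "transpose_mat V * (P * Q) = mat_diag d (\<lambda>i. (\<sigma> i)\<^sup>2) * transpose_mat V"
  and VW: "transpose_mat V * W = 1\<^sub>m d"
  using bases by (auto simp: balancing_bases_def Let_def)

lemmas cl = mult_carrier_mat[of _ d d _ d] add_carrier_mat minus_carrier_mat
    transpose_carrier_mat[THEN iffD2] mat_diag_dim P(1) Q(1) W V
lemmas assoc = assoc_mult_mat[of _ d d _ d _ d]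

lemma WV: "W * transpose_mat V = 1\<^sub>m d"
  using mat_mult_left_right_inverse[OF _ W VW] V by simp

lemma VWt: "V * transpose_mat W = 1\<^sub>m d"
  using transpose_mult[of W d d "transpose_mat V" d] W V WV by simp

lemma WVt: "transpose_mat W * V = 1\<^sub>m d"
  using transpose_mult[of "transpose_mat V" d d W d] W V VW by simp

lemma cancel:
  assumes X: "X \<in> carrier_mat d d"
  shows "transpose_mat V * (W * X) = X" "W * (transpose_mat V * X) = X"
    "transpose_mat W * (V * X) = X" "V * (transpose_mat W * X) = X"
proof -
  have *: "Y * (Z * X) = X" if "Y * Z = 1\<^sub>m d" "Y \<in> carrier_mat d d" "Z \<in> carrier_mat d d" for Y Z
    using that X assoc_mult_mat[of Y d d Z d X d] by simp
  show "transpose_mat V * (W * X) = X" "W * (transpose_mat V * X) = X"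
    "transpose_mat W * (V * X) = X" "V * (transpose_mat W * X) = X"
    using W V by (auto intro!: * VW WV WVt VWt)
qed

text \<open>Transposition turns right eigenvectors of P Q into left eigenvectors of Q P and
  conversely, while the two normalizations trade places.\<close>

lemma swap: "balanced d Q P \<sigma> V W"
proof
  have "Q * P * V = transpose_mat (transpose_mat V * (P * Q))"
    using P Q V by (simp add: transpose_mult[of _ d d _ d])
  also have "\<dots> = V * mat_diag d (\<lambda>i. (\<sigma> i)\<^sup>2)"
    unfolding VPQ using V by (simp add: transpose_mult[of _ d d _ d])
  finally have 1: "Q * P * V = V * mat_diag d (\<lambda>i. (\<sigma> i)\<^sup>2)" .
  have "transpose_mat W * (Q * P) = transpose_mat (P * Q * W)"
    using P Q W by (simp add: transpose_mult[of _ d d _ d])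
  also have "\<dots> = mat_diag d (\<lambda>i. (\<sigma> i)\<^sup>2) * transpose_mat W"
    unfolding PQW using W by (simp add: transpose_mult[of _ d d _ d])
  finally have 2: "transpose_mat W * (Q * P) = mat_diag d (\<lambda>i. (\<sigma> i)\<^sup>2) * transpose_mat W" .
  show "balancing_bases d Q P \<sigma> V W"
    using bases 1 2 WVt by (auto simp: balancing_bases_def Let_def)
qed (use P Q \<sigma>_nonneg \<sigma>_antimono in auto)

text \<open>The two Gramians in balanced coordinates x = W \<xi>, whose inverse is \<xi> = V^T x:
  the controllability Gramian transforms with \<open>V\<close>, the observability Gramian with
  \<open>W\<close>.\<close>

definition Ph where "Ph = transpose_mat V * P * V"
definition Qh where "Qh = transpose_mat W * Q * W"

lemma Ph: "Ph \<in> carrier_mat d d" and Qh: "Qh \<in> carrier_mat d d"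
  unfolding Ph_def Qh_def by (intro cl)+

lemma Ph_Qh_dim [simp]: "dim_row Ph = d" "dim_col Ph = d" "dim_row Qh = d" "dim_col Qh = d"
  using Ph Qh by auto

lemma Ph_sym: "transpose_mat Ph = Ph" and Qh_sym: "transpose_mat Qh = Qh"
  unfolding Ph_def Qh_def
  by (simp_all only: transpose_mult[of _ d d _ d] assoc cl P(2) Q(2) transpose_transpose)

lemma P_eq: "P = W * (Ph * transpose_mat W)" and Q_eq: "Q = V * (Qh * transpose_mat V)"
proof -
  have "Ph * transpose_mat W = transpose_mat V * (P * (V * transpose_mat W))"
    unfolding Ph_def by (simp only: assoc cl)
  then show "P = W * (Ph * transpose_mat W)"
    by (simp only: VWt right_mult_one_mat[OF P(1)] cancel cl)
  have "Qh * transpose_mat V = transpose_mat W * (Q * (W * transpose_mat V))"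
    unfolding Qh_def by (simp only: assoc cl)
  then show "Q = V * (Qh * transpose_mat V)"
    by (simp only: WV right_mult_one_mat[OF Q(1)] cancel cl)
qed

lemma Ph_Qh: "Ph * Qh = mat_diag d (\<lambda>i. (\<sigma> i)\<^sup>2)"
proof -
  have "Ph * Qh = transpose_mat V * (P * (V * (transpose_mat W * (Q * W))))"
    unfolding Ph_def Qh_def by (simp only: assoc cl)
  also have "V * (transpose_mat W * (Q * W)) = Q * W"
    by (rule cancel; intro cl)
  also have "P * (Q * W) = W * mat_diag d (\<lambda>i. (\<sigma> i)\<^sup>2)"
    unfolding PQW[symmetric] by (simp only: assoc cl)
  also have "transpose_mat V * \<dots> = mat_diag d (\<lambda>i. (\<sigma> i)\<^sup>2)"
    by (rule cancel) simp
  finally show ?thesis .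
qed

lemma Qh_Ph: "Qh * Ph = mat_diag d (\<lambda>i. (\<sigma> i)\<^sup>2)"
  using transpose_mult[OF Ph Qh] by (simp add: Ph_sym Qh_sym Ph_Qh)

text \<open>\<open>Ph\<close> commutes with \<open>Ph * Qh\<close>, so it cannot mix indices with different singular values.\<close>

lemma Ph_index:
  assumes ij: "i < d" "j < d" "i < q \<or> j < q"
  shows "Ph $$ (i, j) = (if i = j then \<sigma> i else 0)"
proof (cases "i < q \<and> j < q")
  case True
  have "transpose_mat (take_cols q V) * P * take_cols q V = mat_diag q \<sigma>"
    using bases by (simp add: balancing_bases_def Let_def q_def)
  then have "Ph $$ (i, j) = mat_diag q \<sigma> $$ (i, j)"
    unfolding Ph_def using sandwich_index_take_cols[OF V P(1) _ _ q_le, of i j] True by simp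
  then show ?thesis
    using True by (simp add: mat_diag_def)
next
  case False
  have "Ph * mat_diag d (\<lambda>i. (\<sigma> i)\<^sup>2) = mat_diag d (\<lambda>i. (\<sigma> i)\<^sup>2) * Ph"
    using assoc[OF Ph Qh Ph] unfolding Ph_Qh Qh_Ph by (rule sym)
  then have "Ph $$ (i, j) * (\<sigma> j)\<^sup>2 = (\<sigma> i)\<^sup>2 * Ph $$ (i, j)"
    using mult_mat_diag_index[OF Ph ij(1,2)] mat_diag_mult_index[OF Ph ij(1,2)] by metis
  moreover have "(\<sigma> i = 0) \<noteq> (\<sigma> j = 0)"
    using False ij \<sigma>_eq_0_iff by auto
  ultimately show ?thesis
    by auto
qed

definition keep :: "nat \<Rightarrow> real mat" where
  "keep r = mat_diag d (\<lambda>i. if i < r then 1 else 0)"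

text \<open>The oblique projector W_r V_r^T onto the retained states, written with a mask so that
  every factor is d x d.\<close>

definition proj :: "nat \<Rightarrow> real mat" where
  "proj r = W * (keep r * transpose_mat V)"

text \<open>The part of \<open>P\<close> on the indices beyond \<open>q\<close>. The normalization
  does not control it, and it may be nonzero although the Hankel singular values vanish
  there.\<close>

definition resid :: "real mat" where
  "resid = P - proj q * P"

lemma keep: "keep r \<in> carrier_mat d d"
  by (simp add: keep_def)

lemma keep_dim [simp]: "dim_row (keep r) = d" "dim_col (keep r) = d"
  using keep by auto

lemma keep_index: "X \<in> carrier_mat d d \<Longrightarrow> i < d \<Longrightarrow> j < d \<Longrightarrow>
    (keep r * X) $$ (i, j) = (if i < r then X $$ (i, j) else 0)"
  "X \<in> carrier_mat d d \<Longrightarrow> i < d \<Longrightarrow> j < d \<Longrightarrow>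
    (X * keep r) $$ (i, j) = (if j < r then X $$ (i, j) else 0)"
  unfolding keep_def by (simp_all add: mat_diag_mult_index mult_mat_diag_index del: index_mult_mat(1))

lemma proj: "proj r \<in> carrier_mat d d"
  unfolding proj_def keep_def by (intro cl)

lemma proj_eq: "r \<le> d \<Longrightarrow> proj r = take_cols r W * transpose_mat (take_cols r V)"
  using take_cols_sandwich[OF W V, of r "\<lambda>_. 1"] assoc[OF W keep transpose_carrier_mat[THEN iffD2, OF V], of r]
  by (simp add: proj_def keep_def right_mult_one_mat[OF take_drop_cols_carrier(1)[OF W]])

lemma transpose_proj: "transpose_mat (proj r) = V * (keep r * transpose_mat W)"
proof -
  have "transpose_mat (proj r) = transpose_mat (keep r * transpose_mat V) * transpose_mat W"
    unfolding proj_def by (rule transpose_mult[of _ d d _ d]; intro cl keep)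
  also have "transpose_mat (keep r * transpose_mat V) = V * keep r"
    using transpose_mult[OF keep transpose_carrier_mat[THEN iffD2, OF V], of r] by (simp add: keep_def)
  also have "V * keep r * transpose_mat W = V * (keep r * transpose_mat W)"
    by (rule assoc; intro cl keep)
  finally show ?thesis .
qed

text \<open>Below \<open>q\<close> every row and column of \<open>Ph\<close> has only its diagonal
  entry, so a cut at r \<le> q separates no coupled indices; the block beyond \<open>q\<close> need
  not be diagonal.\<close>

lemma keep_Ph_comm: "r \<le> q \<Longrightarrow> keep r * Ph = Ph * keep r"
  using q_le Ph by (intro eq_matI) (auto simp: keep_index Ph_index simp del: index_mult_mat(1))

lemma proj_P: "proj r * P = W * (keep r * Ph * transpose_mat W)"
proof -
  have "proj r * P = W * (keep r * (transpose_mat V * (W * (Ph * transpose_mat W))))"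
    unfolding proj_def by (subst P_eq) (simp only: assoc cl keep Ph)
  also have "transpose_mat V * (W * (Ph * transpose_mat W)) = Ph * transpose_mat W"
    by (rule cancel) (intro cl Ph)
  also have "keep r * (Ph * transpose_mat W) = keep r * Ph * transpose_mat W"
    by (simp only: assoc cl keep Ph)
  finally show ?thesis .
qed

lemma P_transpose_proj: "P * transpose_mat (proj r) = W * (Ph * keep r * transpose_mat W)"
proof -
  have "P * transpose_mat (proj r) = W * (Ph * (transpose_mat W * (V * (keep r * transpose_mat W))))"
    unfolding transpose_proj by (subst P_eq) (simp only: assoc cl keep Ph)
  also have "transpose_mat W * (V * (keep r * transpose_mat W)) = keep r * transpose_mat W"
    by (rule cancel) (intro cl keep)
  also have "Ph * (keep r * transpose_mat W) = Ph * keep r * transpose_mat W"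
    by (simp only: assoc cl keep Ph)
  finally show ?thesis .
qed

lemma proj_P_comm: "r \<le> q \<Longrightarrow> proj r * P = P * transpose_mat (proj r)"
  unfolding proj_P P_transpose_proj by (simp only: keep_Ph_comm)

lemma minus_proj_P: "P - proj r * P = W * ((Ph - keep r * Ph) * transpose_mat W)"
proof -
  have "P - proj r * P = W * (Ph * transpose_mat W) - W * (keep r * Ph * transpose_mat W)"
    unfolding proj_P by (simp only: P_eq[symmetric])
  also have "\<dots> = W * (Ph * transpose_mat W - keep r * Ph * transpose_mat W)"
    by (rule mult_minus_distrib_mat[of _ d d _ d, symmetric]; intro cl Ph keep)
  also have "Ph * transpose_mat W - keep r * Ph * transpose_mat W = (Ph - keep r * Ph) * transpose_mat W"
    by (rule minus_mult_distrib_mat[of _ d d _ _ d, symmetric]; intro cl Ph keep)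
  finally show ?thesis .
qed

lemma resid: "resid \<in> carrier_mat d d"
  unfolding resid_def by (intro cl proj)

lemma resid_sym: "transpose_mat resid = resid"
proof -
  have "transpose_mat resid = transpose_mat P - transpose_mat (proj q * P)"
    unfolding resid_def by (rule transpose_minus[of _ d d]; intro cl proj)
  also have "transpose_mat (proj q * P) = P * transpose_mat (proj q)"
    using transpose_mult[OF proj P(1)] by (simp add: P)
  also have "\<dots> = proj q * P"
    by (simp add: proj_P_comm)
  finally show ?thesis
    by (simp add: P resid_def)
qed

text \<open>The discarded part of \<open>P\<close> consists of the diagonal entries with r \<le> i <
  q and the block beyond \<open>q\<close>. The mask may run up to \<open>d\<close> because \<sigma>
  vanishes from \<open>q\<close> on.\<close>

lemma minus_proj_P_resid:
  assumes r: "r \<le> q"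
  shows "P - proj r * P = W * mat_diag d (\<lambda>i. if r \<le> i then \<sigma> i else 0) * transpose_mat W + resid"
proof -
  let ?D = "mat_diag d (\<lambda>i. if r \<le> i then \<sigma> i else 0)"
  have "Ph - keep r * Ph = ?D + (Ph - keep q * Ph)"
  proof (rule eq_matI)
    fix i j assume "i < dim_row (?D + (Ph - keep q * Ph))" "j < dim_col (?D + (Ph - keep q * Ph))"
    then have ij: "i < d" "j < d"
      using Ph keep[of q] by auto
    then show "(Ph - keep r * Ph) $$ (i, j) = (?D + (Ph - keep q * Ph)) $$ (i, j)"
      using Ph keep[of q] keep[of r] r \<sigma>_eq_0_iff[of i]
      by (auto simp: keep_index Ph_index mat_diag_def simp del: index_mult_mat(1))
  qed (use Ph keep in auto)
  then have "P - proj r * P = W * ((?D + (Ph - keep q * Ph)) * transpose_mat W)"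
    by (simp only: minus_proj_P)
  also have "(?D + (Ph - keep q * Ph)) * transpose_mat W =
      ?D * transpose_mat W + (Ph - keep q * Ph) * transpose_mat W"
    by (rule add_mult_distrib_mat[of _ d d _ _ d]; intro cl Ph keep)
  also have "W * \<dots> = W * (?D * transpose_mat W) + W * ((Ph - keep q * Ph) * transpose_mat W)"
    by (rule mult_add_distrib_mat[of _ d d _ d]; intro cl Ph keep)
  also have "W * (?D * transpose_mat W) = W * ?D * transpose_mat W"
    by (rule assoc[symmetric]; intro cl)
  finally show ?thesis
    by (simp only: resid_def minus_proj_P)
qed

text \<open>In balanced coordinates \<open>Qh * Ph\<close> is the diagonal of squared singular
  values, which is 0 beyond \<open>q\<close>; the mask passes through \<open>Qh\<close> by the dual
  of its commutation with \<open>Ph\<close>.\<close>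

lemma Q_resid: "Q * resid = 0\<^sub>m d d"
proof -
  let ?E = "Ph - keep q * Ph"
  have keep_Qh: "keep q * Qh = Qh * keep q"
    using balanced.keep_Ph_comm[OF swap, of q]
    unfolding balanced.keep_def[OF swap] balanced.Ph_def[OF swap] balanced.q_def[OF swap]
    unfolding keep_def Qh_def q_def by simp
  have "Qh * ?E = Qh * Ph - Qh * (keep q * Ph)"
    by (rule mult_minus_distrib_mat[of _ d d _ d]; intro cl Ph Qh keep)
  also have "Qh * (keep q * Ph) = Qh * keep q * Ph"
    by (rule assoc[symmetric]; intro keep Ph Qh)
  also have "\<dots> = keep q * (Qh * Ph)"
    unfolding keep_Qh[symmetric] by (rule assoc; intro keep Ph Qh)
  also have "Qh * Ph - keep q * (Qh * Ph) = 0\<^sub>m d d"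
  proof (rule eq_matI)
    fix i j assume "i < dim_row (0\<^sub>m d d :: real mat)" "j < dim_col (0\<^sub>m d d :: real mat)"
    then have ij: "i < d" "j < d"
      by auto
    show "(Qh * Ph - keep q * (Qh * Ph)) $$ (i, j) = 0\<^sub>m d d $$ (i, j)"
      unfolding Qh_Ph using ij \<sigma>_eq_0_iff[of i]
      by (auto simp: keep_index mat_diag_def simp del: index_mult_mat(1))
  qed auto
  finally have *: "Qh * ?E = 0\<^sub>m d d" .
  have "Q * resid = V * (Qh * (transpose_mat V * (W * (?E * transpose_mat W))))"
    unfolding resid_def minus_proj_P
    by (subst Q_eq) (simp only: assoc cl keep Ph Qh)
  also have "transpose_mat V * (W * (?E * transpose_mat W)) = ?E * transpose_mat W"
    by (rule cancel) (intro cl Ph keep)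
  also have "Qh * (?E * transpose_mat W) = Qh * ?E * transpose_mat W"
    by (rule assoc[symmetric]; intro cl Ph Qh keep)
  also have "V * \<dots> = 0\<^sub>m d d"
    unfolding * using V W by simp
  finally show ?thesis .
qed

lemma resid_Q: "resid * Q = 0\<^sub>m d d"
  using transpose_mult[OF Q(1) resid] by (simp add: Q_resid resid_sym Q)

end

subsection \<open>The truncation error in terms of the discarded states\<close>

text \<open>The side conditions are equations between dimensions instead of carrier memberships with
  free sizes, so these rules rewrite products of rectangular matrices once the dimension facts are
  supplied.\<close>

lemma mat_mult_assoc_dim:
  fixes A B C :: "real mat"
  assumes "dim_col A = dim_row B" "dim_col B = dim_row C"
  shows "A * B * C = A * (B * C)"
  by (rule assoc_mult_mat[of _ "dim_row A" "dim_col A" _ "dim_col B" _ "dim_col C"]) (use assms in auto)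

lemma mat_add_mult_distrib_dim:
  fixes A B C :: "real mat"
  assumes "dim_row A = dim_row B" "dim_col A = dim_col B" "dim_col A = dim_row C"
  shows "(A + B) * C = A * C + B * C"
  by (rule add_mult_distrib_mat[of _ "dim_row A" "dim_col A" _ _ "dim_col C"]) (use assms in auto)

lemma mat_mult_add_distrib_dim:
  fixes A B C :: "real mat"
  assumes "dim_row B = dim_row C" "dim_col B = dim_col C" "dim_col A = dim_row B"
  shows "A * (B + C) = A * B + A * C"
  by (rule mult_add_distrib_mat[of _ "dim_row A" "dim_col A" _ "dim_col C"]) (use assms in auto)

lemma transpose_mult_dim:
  fixes A B :: "real mat"
  assumes "dim_col A = dim_row B"
  shows "transpose_mat (A * B) = transpose_mat B * transpose_mat A"
  by (rule transpose_mult[of _ "dim_row A" "dim_col A" _ "dim_col B"]) (use assms in auto)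

lemma mult_zero_mat_dim:
  fixes A :: "real mat"
  shows "dim_col A = n \<Longrightarrow> A * 0\<^sub>m n m = 0\<^sub>m (dim_row A) m"
    and "dim_row A = m \<Longrightarrow> 0\<^sub>m n m * A = 0\<^sub>m n (dim_col A)"
  by (auto intro: right_mult_zero_mat left_mult_zero_mat)

lemmas mat_dims = index_mult_mat(2,3) index_transpose_mat(2,3) index_add_mat(2,3) index_zero_mat(2,3)

text \<open>Multiplying the equation by \<open>R\<close> on both sides removes the two terms that
  contain R X or X R and leaves (R L) (R L)^T = 0. Directions annihilated by the Gramian receive no
  input.\<close>

lemma lyapunov_kernel:
  fixes A X R L :: "real mat"
  assumes A: "A \<in> carrier_mat n n" and X: "X \<in> carrier_mat n n" and R: "R \<in> carrier_mat n n"
    and L: "L \<in> carrier_mat n m"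
    and eq: "A * X + X * transpose_mat A + L * transpose_mat L = 0\<^sub>m n n"
    and R0: "R * X = 0\<^sub>m n n" "X * R = 0\<^sub>m n n" and R_sym: "transpose_mat R = R"
  shows "R * L = 0\<^sub>m n m"
proof (rule mult_transpose_self_eq_0)
  note dims = mat_dims carrier_matD[OF A] carrier_matD[OF X] carrier_matD[OF R] carrier_matD[OF L]
  have AXR: "A * X * R = 0\<^sub>m n n"
    using R0(2) by (simp only: mat_mult_assoc_dim mult_zero_mat_dim dims)
  have RXA: "R * (X * transpose_mat A) = 0\<^sub>m n n"
  proof -
    have "R * (X * transpose_mat A) = R * X * transpose_mat A"
      by (rule mat_mult_assoc_dim[symmetric]) (simp_all only: dims)
    then show ?thesis
      unfolding R0 by (simp only: mult_zero_mat_dim dims)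
  qed
  have "0\<^sub>m n n = R * ((A * X + X * transpose_mat A + L * transpose_mat L) * R)"
    unfolding eq by (simp only: mult_zero_mat_dim dims)
  also have "\<dots> = R * (A * X * R) + R * (X * transpose_mat A) * R + R * (L * transpose_mat L) * R"
    by (simp only: mat_add_mult_distrib_dim mat_mult_add_distrib_dim mat_mult_assoc_dim dims)
  also have "R * (L * transpose_mat L) * R = R * L * transpose_mat (R * L)"
    by (simp only: mat_mult_assoc_dim transpose_mult_dim R_sym dims)
  also have "R * (A * X * R) + R * (X * transpose_mat A) * R + R * L * transpose_mat (R * L)
      = R * L * transpose_mat (R * L)"
    unfolding AXR RXA using R L
    by (simp only: mult_zero_mat_dim dims) (intro eq_matI; simp)
  finally show "R * L * transpose_mat (R * L) = 0\<^sub>m n n"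
    by (rule sym)
qed (use R L in auto)

context balanced
begin

lemma Qh_index:
  assumes "i < d" "j < d" "i < q \<or> j < q"
  shows "Qh $$ (i, j) = (if i = j then \<sigma> i else 0)"
  using balanced.Ph_index[OF swap assms] unfolding balanced.Ph_def[OF swap] Qh_def .

lemma transpose_proj_swap: "balanced.proj d V W r = transpose_mat (proj r)"
  unfolding balanced.proj_def[OF swap] balanced.keep_def[OF swap] transpose_proj keep_def ..

lemma Q_proj_comm: "r \<le> q \<Longrightarrow> Q * proj r = transpose_mat (proj r) * Q"
  using balanced.proj_P_comm[OF swap, of r] by (simp add: transpose_proj_swap)

text \<open>From Q W = V Qh, where the first r \<le> q columns of \<open>Qh\<close> have only their
  diagonal entries. This relation carries the Lyapunov equation of \<open>Q\<close> over to the
  reduced system.\<close>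

lemma Q_take_cols_W:
  assumes r: "r \<le> q"
  shows "Q * take_cols r W = take_cols r V * mat_diag r \<sigma>"
proof (rule eq_matI)
  fix i j assume "i < dim_row (take_cols r V * mat_diag r \<sigma>)" "j < dim_col (take_cols r V * mat_diag r \<sigma>)"
  then have ij: "i < d" "j < r"
    using V by (auto simp: take_cols_def mat_diag_def)
  have j: "j < d" "j < q"
    using ij r q_le by auto
  have QW: "Q * W = V * Qh"
    unfolding Qh_def using cancel(4)[OF mult_carrier_mat[OF Q(1) W]] by (simp only: assoc cl)
  have "(Q * take_cols r W) $$ (i, j) = (V * Qh) $$ (i, j)"
    unfolding take_cols_mult[OF Q(1) W order_trans[OF r q_le], symmetric] QW
    using ij V by (simp add: take_cols_def del: index_mult_mat(1))
  also have "\<dots> = (\<Sum>l<d. V $$ (i, l) * Qh $$ (l, j))"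
    by (rule index_mult_sum[OF V Qh ij(1) j(1)])
  also have "\<dots> = (\<Sum>l<d. if l = j then V $$ (i, j) * \<sigma> j else 0)"
    using j by (intro sum.cong) (auto simp: Qh_index)
  also have "\<dots> = (take_cols r V * mat_diag r \<sigma>) $$ (i, j)"
    using mult_mat_diag_index[OF take_drop_cols_carrier(1)[OF V] ij] ij j V by (simp add: take_cols_def)
  finally show "(Q * take_cols r W) $$ (i, j) = (take_cols r V * mat_diag r \<sigma>) $$ (i, j)" .
qed (use Q V W in \<open>auto simp: take_cols_def mat_diag_def\<close>)

lemma take_cols_VW:
  assumes "r \<le> d"
  shows "transpose_mat (take_cols r V) * take_cols r W = 1\<^sub>m r"
proof (rule eq_matI)
  fix i j assume "i < dim_row (1\<^sub>m r :: real mat)" "j < dim_col (1\<^sub>m r :: real mat)"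
  then have ij: "i < r" "j < r"
    by auto
  have "(transpose_mat (take_cols r V) * take_cols r W) $$ (i, j) =
      (\<Sum>l<d. transpose_mat (take_cols r V) $$ (i, l) * take_cols r W $$ (l, j))"
    by (rule index_mult_sum[of _ r d _ r]) (use V W ij in auto)
  also have "\<dots> = (\<Sum>l<d. transpose_mat V $$ (i, l) * W $$ (l, j))"
    using ij V W assms by (simp add: take_cols_def)
  also have "\<dots> = (transpose_mat V * W) $$ (i, j)"
    by (rule index_mult_sum[of _ d d _ d, symmetric]) (use V W ij assms in auto)
  finally show "(transpose_mat (take_cols r V) * take_cols r W) $$ (i, j) = 1\<^sub>m r $$ (i, j)"
    unfolding VW using ij assms by simp
qed (use V W in \<open>auto simp: take_cols_def\<close>)

text \<open>Compress the equation of \<open>Q\<close> by W_r^T from the left and W_r from the right: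
  Q W_r turns into V_r times the diagonal matrix, and V_r^T A W_r is the reduced matrix.\<close>

lemma truncated_observability_lyapunov:
  assumes A: "A \<in> carrier_mat d d" and K: "K \<in> carrier_mat p d"
    and Q_lyap: "transpose_mat A * Q + Q * A + transpose_mat K * K = 0\<^sub>m d d"
    and r: "r \<le> q"
  defines "W\<^sub>r \<equiv> take_cols r W" and "V\<^sub>r \<equiv> take_cols r V"
  defines "A\<^sub>r \<equiv> transpose_mat V\<^sub>r * A * W\<^sub>r"
  shows "transpose_mat A\<^sub>r * mat_diag r \<sigma> + mat_diag r \<sigma> * A\<^sub>r + transpose_mat (K * W\<^sub>r) * (K * W\<^sub>r) = 0\<^sub>m r r"
proof -
  have Wr: "W\<^sub>r \<in> carrier_mat d r" and Vr: "V\<^sub>r \<in> carrier_mat d r"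
    using W V by (auto simp: W\<^sub>r_def V\<^sub>r_def)
  note dims = mat_dims carrier_matD[OF A] carrier_matD[OF K] carrier_matD[OF Wr] carrier_matD[OF Vr]
    carrier_matD[OF Q(1)] carrier_matD[OF mat_diag_dim]
  have QW: "Q * W\<^sub>r = V\<^sub>r * mat_diag r \<sigma>"
    unfolding W\<^sub>r_def V\<^sub>r_def by (rule Q_take_cols_W[OF r])
  have "transpose_mat (Q * W\<^sub>r) = transpose_mat (V\<^sub>r * mat_diag r \<sigma>)"
    by (simp only: QW)
  then have WQ: "transpose_mat W\<^sub>r * Q = mat_diag r \<sigma> * transpose_mat V\<^sub>r"
    by (simp only: transpose_mult_dim dims Q(2) transpose_mat_diag)
  have "transpose_mat A\<^sub>r * mat_diag r \<sigma> = transpose_mat W\<^sub>r * (transpose_mat A * (V\<^sub>r * mat_diag r \<sigma>))"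
    unfolding A\<^sub>r_def by (simp only: transpose_mult_dim mat_mult_assoc_dim dims transpose_transpose)
  also have "\<dots> = transpose_mat W\<^sub>r * (transpose_mat A * Q * W\<^sub>r)"
    unfolding QW[symmetric] by (simp only: mat_mult_assoc_dim dims)
  finally have 1: "transpose_mat A\<^sub>r * mat_diag r \<sigma> = transpose_mat W\<^sub>r * (transpose_mat A * Q * W\<^sub>r)" .
  have "mat_diag r \<sigma> * A\<^sub>r = mat_diag r \<sigma> * transpose_mat V\<^sub>r * (A * W\<^sub>r)"
    unfolding A\<^sub>r_def by (simp only: mat_mult_assoc_dim dims)
  also have "\<dots> = transpose_mat W\<^sub>r * (Q * A * W\<^sub>r)"
    unfolding WQ[symmetric] by (simp only: mat_mult_assoc_dim dims)
  finally have 2: "mat_diag r \<sigma> * A\<^sub>r = transpose_mat W\<^sub>r * (Q * A * W\<^sub>r)" .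
  have 3: "transpose_mat (K * W\<^sub>r) * (K * W\<^sub>r) = transpose_mat W\<^sub>r * (transpose_mat K * K * W\<^sub>r)"
    by (simp only: transpose_mult_dim mat_mult_assoc_dim dims)
  have "transpose_mat W\<^sub>r * (transpose_mat A * Q * W\<^sub>r) + transpose_mat W\<^sub>r * (Q * A * W\<^sub>r) +
      transpose_mat W\<^sub>r * (transpose_mat K * K * W\<^sub>r) =
      transpose_mat W\<^sub>r * ((transpose_mat A * Q + Q * A + transpose_mat K * K) * W\<^sub>r)"
    by (simp only: mat_add_mult_distrib_dim mat_mult_add_distrib_dim dims)
  also have "\<dots> = 0\<^sub>m r r"
    unfolding Q_lyap by (simp only: mult_zero_mat_dim dims)
  finally show ?thesis
    unfolding 1 2 3 .
qed

text \<open>The trace identity is applied with the projector \<open>proj r\<close> and T = S V_r^T.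
  Besides the truncated singular values, the discarded parts of \<open>P\<close> and
  \<open>Q\<close> contain their blocks beyond \<open>q\<close>; the work lies in showing that both
  blocks contribute nothing.\<close>

lemma truncated_energy_trace:
  assumes A: "A \<in> carrier_mat d d" and L: "L \<in> carrier_mat d s" and K: "K \<in> carrier_mat p d"
    and P_lyap: "A * P + P * transpose_mat A + L * transpose_mat L = 0\<^sub>m d d"
    and Q_lyap: "transpose_mat A * Q + Q * A + transpose_mat K * K = 0\<^sub>m d d"
    and r: "r \<le> q"
  defines "W\<^sub>r \<equiv> take_cols r W" and "V\<^sub>r \<equiv> take_cols r V"
  defines "A\<^sub>r \<equiv> transpose_mat V\<^sub>r * A * W\<^sub>r" and "L\<^sub>r \<equiv> transpose_mat V\<^sub>r * L"
  assumes S: "S \<in> carrier_mat d r"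
    and S_eq: "transpose_mat A * S + S * A\<^sub>r + transpose_mat K * (K * W\<^sub>r) = 0\<^sub>m d r"
  shows "mat_trace (transpose_mat L * Q * L) + mat_trace (transpose_mat L\<^sub>r * mat_diag r \<sigma> * L\<^sub>r)
      - 2 * mat_trace (transpose_mat L * S * L\<^sub>r) =
    mat_trace (V * mat_diag d (\<lambda>i. if r \<le> i then \<sigma> i else 0) * transpose_mat V * (L * transpose_mat L)) +
    2 * mat_trace (S * transpose_mat V\<^sub>r * A * (W * mat_diag d (\<lambda>i. if r \<le> i then \<sigma> i else 0) * transpose_mat W))"
proof -
  interpret sw: balanced d Q P \<sigma> V W
    by (rule swap)
  let ?D = "mat_diag d (\<lambda>i. if r \<le> i then \<sigma> i else 0)"
  let ?\<Gamma> = "L * transpose_mat L"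
  let ?N = "transpose_mat K * K"
  have r_d: "r \<le> d"
    using r q_le by simp
  have Wr: "W\<^sub>r \<in> carrier_mat d r" and Vr: "V\<^sub>r \<in> carrier_mat d r"
    using W V by (auto simp: W\<^sub>r_def V\<^sub>r_def)
  note dims = mat_dims carrier_matD[OF A] carrier_matD[OF L] carrier_matD[OF K] carrier_matD[OF S]
    carrier_matD[OF Wr] carrier_matD[OF Vr] carrier_matD[OF W] carrier_matD[OF V]
    carrier_matD[OF P(1)] carrier_matD[OF Q(1)] carrier_matD[OF mat_diag_dim]
    carrier_matD[OF resid] carrier_matD[OF sw.resid]
  have \<Gamma>: "?\<Gamma> \<in> carrier_mat d d" and N: "?N \<in> carrier_mat d d"
    using L K by auto
  define T where "T = S * transpose_mat V\<^sub>r"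
  have T: "T \<in> carrier_mat d d"
    unfolding T_def using S Vr by auto
  have proj_r: "proj r = W\<^sub>r * transpose_mat V\<^sub>r"
    unfolding W\<^sub>r_def V\<^sub>r_def by (rule proj_eq[OF r_d])
  have VWr: "transpose_mat V\<^sub>r * W\<^sub>r = 1\<^sub>m r"
    unfolding W\<^sub>r_def V\<^sub>r_def by (rule take_cols_VW[OF r_d])
  have T_proj: "T * proj r = T"
  proof -
    have "T * proj r = S * (transpose_mat V\<^sub>r * W\<^sub>r * transpose_mat V\<^sub>r)"
      unfolding T_def proj_r by (simp only: mat_mult_assoc_dim dims)
    then show ?thesis
      unfolding VWr T_def using Vr by simp
  qed
  have T_eq: "transpose_mat A * T + T * A * proj r + ?N * proj r = 0\<^sub>m d d"
  proof -
    have "transpose_mat A * T + T * A * proj r + ?N * proj r =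
        (transpose_mat A * S + S * A\<^sub>r + transpose_mat K * (K * W\<^sub>r)) * transpose_mat V\<^sub>r"
      unfolding T_def proj_r A\<^sub>r_def
      by (simp only: mat_mult_assoc_dim mat_add_mult_distrib_dim dims)
    then show ?thesis
      unfolding S_eq by (simp only: mult_zero_mat_dim dims)
  qed
  have "mat_trace (transpose_mat L * Q * L) = mat_trace (transpose_mat L * (Q * L))"
    by (simp only: mat_mult_assoc_dim dims)
  also have "\<dots> = mat_trace (Q * L * transpose_mat L)"
    by (rule mat_trace_mult_comm[of _ s d]) (use Q L in auto)
  also have "Q * L * transpose_mat L = Q * ?\<Gamma>"
    by (simp only: mat_mult_assoc_dim dims)
  finally have 1: "mat_trace (transpose_mat L * Q * L) = mat_trace (Q * ?\<Gamma>)" .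
  have Q_proj: "Q * proj r = V\<^sub>r * mat_diag r \<sigma> * transpose_mat V\<^sub>r"
    unfolding Q_take_cols_W[OF r, symmetric, folded W\<^sub>r_def V\<^sub>r_def] proj_r
    by (simp only: mat_mult_assoc_dim dims)
  have "transpose_mat L\<^sub>r * mat_diag r \<sigma> * L\<^sub>r = transpose_mat L * (Q * proj r * L)"
    unfolding Q_proj L\<^sub>r_def by (simp only: mat_mult_assoc_dim transpose_mult_dim transpose_transpose dims)
  also have "mat_trace \<dots> = mat_trace (Q * proj r * L * transpose_mat L)"
    by (rule mat_trace_mult_comm[of _ s d]) (use Q L proj in \<open>auto intro!: mult_carrier_mat[of _ d d]\<close>)
  also have "Q * proj r * L * transpose_mat L = Q * proj r * ?\<Gamma>"
    using proj[of r] by (simp only: mat_mult_assoc_dim dims carrier_matD)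
  finally have 2: "mat_trace (transpose_mat L\<^sub>r * mat_diag r \<sigma> * L\<^sub>r) = mat_trace (Q * proj r * ?\<Gamma>)" .
  have "transpose_mat L * S * L\<^sub>r = transpose_mat L * (T * L)"
    unfolding T_def L\<^sub>r_def by (simp only: mat_mult_assoc_dim dims)
  also have "mat_trace \<dots> = mat_trace (T * L * transpose_mat L)"
    by (rule mat_trace_mult_comm[of _ s d]) (use T L in \<open>auto intro!: mult_carrier_mat[of _ d d]\<close>)
  also have "T * L * transpose_mat L = T * ?\<Gamma>"
    unfolding T_def by (simp only: mat_mult_assoc_dim dims)
  finally have 3: "mat_trace (transpose_mat L * S * L\<^sub>r) = mat_trace (T * ?\<Gamma>)" .
  have main: "mat_trace (Q * ?\<Gamma>) + mat_trace (Q * proj r * ?\<Gamma>) - 2 * mat_trace (T * ?\<Gamma>) =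
      mat_trace ((Q - Q * proj r) * ?\<Gamma>) + 2 * mat_trace (T * A * (P - proj r * P))"
    by (rule truncation_trace_identity[OF A P(1) Q(1) \<Gamma> N T proj P(2) Q(2) P_lyap Q_lyap T_eq T_proj
        proj_P_comm[OF r] Q_proj_comm[OF r]])
  \<comment> \<open>The block of \<open>Q\<close> beyond \<open>q\<close> is annihilated by
    \<open>P\<close>, hence it meets no input.\<close>
  have "sw.resid * L = 0\<^sub>m d s"
    by (rule lyapunov_kernel[OF A P(1) sw.resid L P_lyap sw.resid_Q sw.Q_resid sw.resid_sym])
  then have resid_\<Gamma>: "sw.resid * ?\<Gamma> = 0\<^sub>m d d"
    using mat_mult_assoc_dim[of sw.resid L "transpose_mat L"] by (simp only: dims mult_zero_mat_dim)
  \<comment> \<open>Dually, the block of \<open>P\<close> beyond \<open>q\<close> is invisible to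
    the output. The Lyapunov equation of \<open>Q\<close> applied to this block then shows that
    \<open>Q\<close> annihilates its image under \<open>A\<close> as well.\<close>
  have "resid * transpose_mat K = 0\<^sub>m d p"
    by (rule lyapunov_kernel[of "transpose_mat A" d Q resid "transpose_mat K" p])
      (use A K Q resid Q_lyap resid_Q Q_resid resid_sym in auto)
  then have "transpose_mat (resid * transpose_mat K) = 0\<^sub>m p d"
    by simp
  then have K_resid: "K * resid = 0\<^sub>m p d"
    by (simp only: transpose_mult_dim dims transpose_transpose resid_sym)
  have "0\<^sub>m d d = (transpose_mat A * Q + Q * A + ?N) * resid"
    unfolding Q_lyap by (simp only: mult_zero_mat_dim dims)
  also have "\<dots> = transpose_mat A * (Q * resid) + Q * (A * resid) + transpose_mat K * (K * resid)"
    by (simp only: mat_mult_assoc_dim mat_add_mult_distrib_dim dims)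
  also have "\<dots> = Q * (A * resid)"
    unfolding K_resid Q_resid using Q A resid K
    by (simp only: mult_zero_mat_dim dims) (intro eq_matI; simp)
  finally have QA_resid: "Q * (A * resid) = 0\<^sub>m d d"
    by (rule sym)
  define Y where "Y = transpose_mat V * (A * resid)"
  have Y: "Y \<in> carrier_mat d d"
    unfolding Y_def by (intro cl A resid)
  have "Qh * Y = transpose_mat W * (Q * (W * (transpose_mat V * (A * resid))))"
    unfolding Qh_def Y_def by (simp only: mat_mult_assoc_dim dims)
  also have "W * (transpose_mat V * (A * resid)) = A * resid"
    by (rule cancel) (intro cl A resid)
  finally have Qh_Y: "Qh * Y = 0\<^sub>m d d"
    unfolding QA_resid by (simp only: mult_zero_mat_dim dims)
  \<comment> \<open>Rows of \<open>Qh\<close> below \<open>q\<close> have only a positive diagonal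
    entry, so Qh Y = 0 forces the first r rows of \<open>Y\<close> to vanish. These are the only
    rows that matter, because T = T proj r.\<close>
  have keep_Y: "keep r * Y = 0\<^sub>m d d"
  proof (rule eq_matI)
    fix i j assume "i < dim_row (0\<^sub>m d d :: real mat)" "j < dim_col (0\<^sub>m d d :: real mat)"
    then have ij: "i < d" "j < d"
      by auto
    have "Y $$ (i, j) = 0" if "i < r"
    proof -
      have "0 = (Qh * Y) $$ (i, j)"
        unfolding Qh_Y using ij by simp
      also have "\<dots> = (\<Sum>l<d. Qh $$ (i, l) * Y $$ (l, j))"
        by (rule index_mult_sum[OF Qh Y ij])
      also have "\<dots> = (\<Sum>l<d. if l = i then \<sigma> i * Y $$ (i, j) else 0)"
        using ij that r by (intro sum.cong) (auto simp: Qh_index)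
      also have "\<dots> = \<sigma> i * Y $$ (i, j)"
        using ij by simp
      finally show ?thesis
        using \<sigma>_pos[of i] that r by simp
    qed
    then show "(keep r * Y) $$ (i, j) = 0\<^sub>m d d $$ (i, j)"
      using ij by (simp add: keep_index(1)[OF Y] del: index_mult_mat(1))
  qed (use Y in auto)
  have "T * A * resid = T * proj r * (A * resid)"
    unfolding T_proj using T by (simp only: mat_mult_assoc_dim dims carrier_matD)
  also have "\<dots> = T * (W * (keep r * Y))"
    unfolding proj_def Y_def using T by (simp only: mat_mult_assoc_dim dims carrier_matD keep_dim)
  finally have TA_resid: "T * A * resid = 0\<^sub>m d d"
    unfolding keep_Y using T by (simp only: mult_zero_mat_dim dims carrier_matD)
  have Q_split: "Q - Q * proj r = V * ?D * transpose_mat V + sw.resid"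
    using sw.minus_proj_P_resid r unfolding sw.q_def q_def transpose_proj_swap
    by (simp only: Q_proj_comm[OF r])
  have "mat_trace ((Q - Q * proj r) * ?\<Gamma>) = mat_trace (V * ?D * transpose_mat V * ?\<Gamma> + sw.resid * ?\<Gamma>)"
    unfolding Q_split by (simp only: mat_add_mult_distrib_dim dims)
  also have "V * ?D * transpose_mat V * ?\<Gamma> + sw.resid * ?\<Gamma> = V * ?D * transpose_mat V * ?\<Gamma>"
    unfolding resid_\<Gamma> by (rule right_add_zero_mat; intro cl \<Gamma>)
  finally have 4: "mat_trace ((Q - Q * proj r) * ?\<Gamma>) = mat_trace (V * ?D * transpose_mat V * ?\<Gamma>)" .
  have "T * A * (P - proj r * P) = T * A * (W * ?D * transpose_mat W) + T * A * resid"
    unfolding minus_proj_P_resid[OF r] by (rule mult_add_distrib_mat[of _ d d _ d]; intro cl T A resid)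
  also have "\<dots> = T * A * (W * ?D * transpose_mat W)"
    unfolding TA_resid by (rule right_add_zero_mat; intro cl T A)
  finally show ?thesis
    using main unfolding 1 2 3 4 T_def by simp
qed

end

subsection \<open>Truncation beyond the numerical rank\<close>

text \<open>The Markov parameters K A^k B, divided by k!, are the Taylor coefficients of the impulse
  response, so systems of different state dimension can be compared through them alone.\<close>

lemma mat_exp_sandwich_sums:
  fixes A B K :: "real mat"
  assumes A: "A \<in> carrier_mat n n" and B: "B \<in> carrier_mat n m" and K: "K \<in> carrier_mat p n"
    and ij: "i < p" "j < m"
  shows "(\<lambda>k. (K * A ^\<^sub>m k * B) $$ (i, j) / fact k * t ^ k) sums (K * mat_exp (t \<cdot>\<^sub>m A) * B) $$ (i, j)"
proof -
  have expand: "(K * X * B) $$ (i, j) = (\<Sum>l<n. \<Sum>l'<n. K $$ (i, l') * X $$ (l', l) * B $$ (l, j))"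
    if X: "X \<in> carrier_mat n n" for X
  proof -
    have "(K * X * B) $$ (i, j) = (\<Sum>l<n. (K * X) $$ (i, l) * B $$ (l, j))"
      by (rule index_mult_sum[OF mult_carrier_mat[OF K X] B ij])
    also have "\<dots> = (\<Sum>l<n. (\<Sum>l'<n. K $$ (i, l') * X $$ (l', l)) * B $$ (l, j))"
      using index_mult_sum[OF K X ij(1)] by (intro sum.cong) auto
    finally show ?thesis
      by (simp add: sum_distrib_right)
  qed
  have "(\<lambda>k. \<Sum>l<n. \<Sum>l'<n. K $$ (i, l') * ((A ^\<^sub>m k) $$ (l', l) / fact k * t ^ k) * B $$ (l, j))
      sums (\<Sum>l<n. \<Sum>l'<n. K $$ (i, l') * mat_exp (t \<cdot>\<^sub>m A) $$ (l', l) * B $$ (l, j))"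
    by (intro sums_sum sums_mult sums_mult2 mat_exp_sums[OF A]) auto
  then show ?thesis
    unfolding expand[OF mat_exp_carrier[OF A]] expand[OF pow_carrier_mat[OF A]]
    by (simp add: sum_distrib_left sum_distrib_right sum_divide_distrib mult_ac)
qed

lemma impulse_response_eq_if_markov_eq:
  fixes A A' B B' K K' :: "real mat"
  assumes A: "A \<in> carrier_mat n n" and B: "B \<in> carrier_mat n m" and K: "K \<in> carrier_mat p n"
    and A': "A' \<in> carrier_mat n' n'" and B': "B' \<in> carrier_mat n' m" and K': "K' \<in> carrier_mat p n'"
    and markov: "\<And>k. K * A ^\<^sub>m k * B = K' * A' ^\<^sub>m k * B'"
  shows "K * mat_exp (t \<cdot>\<^sub>m A) * B = K' * mat_exp (t \<cdot>\<^sub>m A') * B'"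
proof (rule eq_matI)
  fix i j assume "i < dim_row (K' * mat_exp (t \<cdot>\<^sub>m A') * B')" "j < dim_col (K' * mat_exp (t \<cdot>\<^sub>m A') * B')"
  then have ij: "i < p" "j < m"
    using K' B' by auto
  show "(K * mat_exp (t \<cdot>\<^sub>m A) * B) $$ (i, j) = (K' * mat_exp (t \<cdot>\<^sub>m A') * B') $$ (i, j)"
    using mat_exp_sandwich_sums[OF A B K ij, of t] mat_exp_sandwich_sums[OF A' B' K' ij, of t]
    unfolding markov by (rule sums_unique2)
qed (use assms in auto)

text \<open>Indices with \<open>U\<close> are uncontrollable, those with \<open>N\<close> are unobservable; deleting some of them
  does not change the transfer behaviour.\<close>

lemma markov_parameters_truncation:
  fixes A B C A' B' C' :: "real mat"
  assumes A: "A \<in> carrier_mat n n" and B: "B \<in> carrier_mat n m" and C: "C \<in> carrier_mat p n"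
    and A': "A' \<in> carrier_mat r r" and B': "B' \<in> carrier_mat r m" and C': "C' \<in> carrier_mat p r"
    and r: "r \<le> n"
    and A_eq: "\<And>i j. i < r \<Longrightarrow> j < r \<Longrightarrow> A' $$ (i, j) = A $$ (i, j)"
    and B_eq: "\<And>i j. i < r \<Longrightarrow> j < m \<Longrightarrow> B' $$ (i, j) = B $$ (i, j)"
    and C_eq: "\<And>i j. i < p \<Longrightarrow> j < r \<Longrightarrow> C' $$ (i, j) = C $$ (i, j)"
    and B_U: "\<And>i j. i < n \<Longrightarrow> j < m \<Longrightarrow> U i \<Longrightarrow> B $$ (i, j) = 0"
    and A_U: "\<And>i j. i < n \<Longrightarrow> j < n \<Longrightarrow> U i \<Longrightarrow> \<not> U j \<Longrightarrow> A $$ (i, j) = 0"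
    and C_O: "\<And>i j. i < p \<Longrightarrow> j < n \<Longrightarrow> N j \<Longrightarrow> C $$ (i, j) = 0"
    and A_O: "\<And>i j. i < n \<Longrightarrow> j < n \<Longrightarrow> N j \<Longrightarrow> \<not> N i \<Longrightarrow> A $$ (i, j) = 0"
    and UO: "\<And>i. r \<le> i \<Longrightarrow> i < n \<Longrightarrow> U i \<or> N i"
  shows "C * A ^\<^sub>m k * B = C' * A' ^\<^sub>m k * B'"
proof -
  define X where "X k = A ^\<^sub>m k * B" for k
  define X' where "X' k = A' ^\<^sub>m k * B'" for k
  have X: "X k \<in> carrier_mat n m" and X': "X' k \<in> carrier_mat r m" for k
    unfolding X_def X'_def using A B A' B' by auto
  have X_Suc: "X (Suc k) = A * X k" for k
    unfolding X_def pow_mat_Suc_left[OF A] by (rule assoc_mult_mat[OF A pow_carrier_mat[OF A] B])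
  have X'_Suc: "X' (Suc k) = A' * X' k" for k
    unfolding X'_def pow_mat_Suc_left[OF A'] by (rule assoc_mult_mat[OF A' pow_carrier_mat[OF A'] B'])
  have X_U: "X k $$ (i, j) = 0" if "i < n" "j < m" "U i" for i j k
    using that
  proof (induction k arbitrary: i)
    case 0
    then show ?case
      using A B B_U by (simp add: X_def)
  next
    case (Suc k)
    have "X (Suc k) $$ (i, j) = (\<Sum>l<n. A $$ (i, l) * X k $$ (l, j))"
      unfolding X_Suc by (rule index_mult_sum[OF A X Suc.prems(1,2)])
    also have "\<dots> = 0"
      using Suc.IH Suc.prems A_U by (intro sum.neutral) auto
    finally show ?case .
  qed
  have X'_U: "X' k $$ (i, j) = 0" if "i < r" "j < m" "U i" for i j k
    using that
  proof (induction k arbitrary: i)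
    case 0
    then show ?case
      using A' B' B_U B_eq r by (simp add: X'_def)
  next
    case (Suc k)
    have "X' (Suc k) $$ (i, j) = (\<Sum>l<r. A' $$ (i, l) * X' k $$ (l, j))"
      unfolding X'_Suc by (rule index_mult_sum[OF A' X' Suc.prems(1,2)])
    also have "\<dots> = 0"
    proof (intro sum.neutral ballI)
      fix l assume "l \<in> {..<r}"
      then show "A' $$ (i, l) * X' k $$ (l, j) = 0"
        using Suc.IH[of l] Suc.prems A_U[of i l] A_eq[of i l] r by (cases "U l") auto
    qed
    finally show ?case .
  qed
  \<comment> \<open>Indices with \<open>U\<close> carry 0 in both systems, indices with
    \<open>N\<close> are weighted by 0, and every deleted index is of one of these kinds; agreement
    is therefore required only on the other indices.\<close>
  have sum_eq: "(\<Sum>l<n. f l * X k $$ (l, j)) = (\<Sum>l<r. f l * X' k $$ (l, j))"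
    if f: "\<And>l. l < n \<Longrightarrow> N l \<Longrightarrow> f l = 0"
      and eq: "\<And>l. l < r \<Longrightarrow> \<not> U l \<Longrightarrow> \<not> N l \<Longrightarrow> X k $$ (l, j) = X' k $$ (l, j)"
      and j: "j < m" for f j k
  proof (rule sum.mono_neutral_cong_right)
    show "\<forall>l\<in>{..<n} - {..<r}. f l * X k $$ (l, j) = 0"
      using f X_U j UO by (metis DiffE lessThan_iff linorder_not_le mult_eq_0_iff)
    show "f l * X k $$ (l, j) = f l * X' k $$ (l, j)" if "l \<in> {..<r}" for l
      using that f[of l] eq[of l] X_U[of l j k] X'_U[of l j k] j r by (cases "U l"; cases "N l") auto
  qed (use r in auto)
  \<comment> \<open>Unobservable coordinates are excluded from the claim: they may depend on deleted
    unobservable ones, so the two systems can differ there.\<close>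
  have X_eq: "X k $$ (i, j) = X' k $$ (i, j)" if "i < r" "j < m" "\<not> U i" "\<not> N i" for i j k
    using that
  proof (induction k arbitrary: i)
    case 0
    then show ?case
      using A B A' B' B_eq r by (simp add: X_def X'_def)
  next
    case (Suc k)
    have i: "i < n"
      using Suc.prems r by simp
    have "X (Suc k) $$ (i, j) = (\<Sum>l<n. A $$ (i, l) * X k $$ (l, j))"
      unfolding X_Suc by (rule index_mult_sum[OF A X i Suc.prems(2)])
    also have "\<dots> = (\<Sum>l<r. A $$ (i, l) * X' k $$ (l, j))"
      using A_O[OF i _ _ Suc.prems(4)] Suc.IH Suc.prems(2) by (intro sum_eq) auto
    also have "\<dots> = (\<Sum>l<r. A' $$ (i, l) * X' k $$ (l, j))"
      using A_eq Suc.prems(1) by simp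
    also have "\<dots> = X' (Suc k) $$ (i, j)"
      unfolding X'_Suc by (rule index_mult_sum[OF A' X' Suc.prems(1,2), symmetric])
    finally show ?case .
  qed
  have "C * X k = C' * X' k"
  proof (rule eq_matI)
    fix i j assume "i < dim_row (C' * X' k)" "j < dim_col (C' * X' k)"
    then have ij: "i < p" "j < m"
      using C' X'[of k] by auto
    have "(C * X k) $$ (i, j) = (\<Sum>l<n. C $$ (i, l) * X k $$ (l, j))"
      by (rule index_mult_sum[OF C X ij])
    also have "\<dots> = (\<Sum>l<r. C $$ (i, l) * X' k $$ (l, j))"
      using C_O[OF ij(1)] X_eq ij(2) by (intro sum_eq) auto
    also have "\<dots> = (\<Sum>l<r. C' $$ (i, l) * X' k $$ (l, j))"
      using C_eq ij by simp
    also have "\<dots> = (C' * X' k) $$ (i, j)"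
      by (rule index_mult_sum[OF C' X' ij, symmetric])
    finally show "(C * X k) $$ (i, j) = (C' * X' k) $$ (i, j)" .
  qed (use C C' X[of k] X'[of k] in auto)
  then show ?thesis
    unfolding X_def X'_def assoc_mult_mat[OF C pow_carrier_mat[OF A] B]
      assoc_mult_mat[OF C' pow_carrier_mat[OF A'] B'] .
qed

text \<open>Entry (i, i) of the equation reduces to the sum of squares of row \<open>i\<close> of
  \<open>G\<close>, so that row vanishes; entry (i, j) then reduces to F_ij X_jj = 0. A state with
  zero Gramian entry is thus driven neither by the input nor by states with nonzero entry.\<close>

lemma diagonal_lyapunov_vanish:
  fixes F X G :: "real mat"
  assumes F: "F \<in> carrier_mat n n" and X: "X \<in> carrier_mat n n" and G: "G \<in> carrier_mat n m"
    and diag: "diagonal_mat X"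
    and eq: "F * X + X * transpose_mat F + G * transpose_mat G = 0\<^sub>m n n"
    and i: "i < n" "X $$ (i, i) = 0"
  shows "l < m \<Longrightarrow> G $$ (i, l) = 0"
    and "j < n \<Longrightarrow> X $$ (j, j) \<noteq> 0 \<Longrightarrow> F $$ (i, j) = 0"
proof -
  have entry: "F $$ (i, j) * X $$ (j, j) + X $$ (i, i) * F $$ (j, i) + (\<Sum>l<m. G $$ (i, l) * G $$ (j, l)) = 0"
    if j: "j < n" for j
  proof -
    have "(F * X) $$ (i, j) = (\<Sum>l<n. F $$ (i, l) * X $$ (l, j))"
      by (rule index_mult_sum[OF F X i(1) j])
    also have "\<dots> = (\<Sum>l<n. if l = j then F $$ (i, j) * X $$ (j, j) else 0)"
      using diag X j by (intro sum.cong) (auto simp: diagonal_mat_def)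
    finally have 1: "(F * X) $$ (i, j) = F $$ (i, j) * X $$ (j, j)"
      using j by simp
    have "(X * transpose_mat F) $$ (i, j) = (\<Sum>l<n. X $$ (i, l) * transpose_mat F $$ (l, j))"
      by (rule index_mult_sum[OF X transpose_carrier_mat[THEN iffD2, OF F] i(1) j])
    also have "\<dots> = (\<Sum>l<n. if l = i then X $$ (i, i) * F $$ (j, i) else 0)"
      using diag X F i j by (intro sum.cong) (auto simp: diagonal_mat_def)
    finally have 2: "(X * transpose_mat F) $$ (i, j) = X $$ (i, i) * F $$ (j, i)"
      using i by simp
    have "(G * transpose_mat G) $$ (i, j) = (\<Sum>l<m. G $$ (i, l) * transpose_mat G $$ (l, j))"
      by (rule index_mult_sum[OF G transpose_carrier_mat[THEN iffD2, OF G] i(1) j])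
    then have 3: "(G * transpose_mat G) $$ (i, j) = (\<Sum>l<m. G $$ (i, l) * G $$ (j, l))"
      using G j by simp
    have "(F * X + X * transpose_mat F + G * transpose_mat G) $$ (i, j) =
        (F * X) $$ (i, j) + (X * transpose_mat F) $$ (i, j) + (G * transpose_mat G) $$ (i, j)"
      using F X G i j by (simp del: index_mult_mat(1))
    then show ?thesis
      unfolding 1 2 3 eq using i(1) j by simp
  qed
  have "(\<Sum>l<m. (G $$ (i, l))\<^sup>2) = 0"
    using entry[OF i(1)] i(2) by (simp add: power2_eq_square)
  then have G0: "G $$ (i, l) = 0" if "l < m" for l
    using that by (subst (asm) sum_nonneg_eq_0_iff) auto
  then show "l < m \<Longrightarrow> G $$ (i, l) = 0" .
  show "F $$ (i, j) = 0" if "j < n" "X $$ (j, j) \<noteq> 0"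
    using entry[OF that(1)] that(2) i(2) G0 by simp
qed

context balanced
begin

text \<open>With both Gramians diagonal in balanced coordinates, their entries at an index i beyond
  \<open>q\<close> have product \<sigma>_i^2 = 0. Each such state is therefore uncontrollable or
  unobservable by itself, and the zero pattern of the transformed system follows from the two
  Lyapunov equations.\<close>

lemma truncated_markov_parameters:
  assumes A: "A \<in> carrier_mat d d" and L: "L \<in> carrier_mat d s" and K: "K \<in> carrier_mat p d"
    and P_lyap: "A * P + P * transpose_mat A + L * transpose_mat L = 0\<^sub>m d d"
    and Q_lyap: "transpose_mat A * Q + Q * A + transpose_mat K * K = 0\<^sub>m d d"
    and r: "q \<le> r" "r \<le> d"
    and diag: "diagonal_mat Ph" "diagonal_mat Qh"
  defines "W\<^sub>r \<equiv> take_cols r W" and "V\<^sub>r \<equiv> take_cols r V"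
  shows "K * A ^\<^sub>m k * L = K * W\<^sub>r * (transpose_mat V\<^sub>r * A * W\<^sub>r) ^\<^sub>m k * (transpose_mat V\<^sub>r * L)"
proof -
  define Ah where "Ah = transpose_mat V * A * W"
  define Lh where "Lh = transpose_mat V * L"
  define Kh where "Kh = K * W"
  have Wr: "W\<^sub>r \<in> carrier_mat d r" and Vr: "V\<^sub>r \<in> carrier_mat d r"
    using W V by (auto simp: W\<^sub>r_def V\<^sub>r_def)
  have Ah: "Ah \<in> carrier_mat d d" and Lh: "Lh \<in> carrier_mat d s" and Kh: "Kh \<in> carrier_mat p d"
    unfolding Ah_def Lh_def Kh_def using A L K W V by auto
  note dims = mat_dims carrier_matD[OF A] carrier_matD[OF L] carrier_matD[OF K]
    carrier_matD[OF W] carrier_matD[OF V] carrier_matD[OF P(1)] carrier_matD[OF Q(1)]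
    carrier_matD[OF pow_carrier_mat[OF Ah]]
  have wit: "similar_mat_wit A Ah W (transpose_mat V)"
  proof -
    have "W * Ah * transpose_mat V = W * (transpose_mat V * (A * (W * transpose_mat V)))"
      unfolding Ah_def by (simp only: mat_mult_assoc_dim dims)
    also have "\<dots> = A"
      unfolding WV right_mult_one_mat[OF A] by (rule cancel[OF A])
    finally show ?thesis
      unfolding similar_mat_wit_def Let_def using A Ah W V WV VW by simp
  qed
  have "K * A ^\<^sub>m k * L = Kh * Ah ^\<^sub>m k * Lh"
    unfolding similar_mat_wit_pow_id[OF wit] Kh_def Lh_def by (simp only: mat_mult_assoc_dim dims)
  also have "\<dots> = K * W\<^sub>r * (transpose_mat V\<^sub>r * A * W\<^sub>r) ^\<^sub>m k * (transpose_mat V\<^sub>r * L)"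
  proof (rule markov_parameters_truncation[OF Ah Lh Kh, where r = r and U = "\<lambda>i. Ph $$ (i, i) = 0"
        and N = "\<lambda>i. Qh $$ (i, i) = 0"])
    have APh: "Ah * Ph = transpose_mat V * (A * P * V)"
    proof -
      have "Ah * Ph = transpose_mat V * (A * (W * (transpose_mat V * (P * V))))"
        unfolding Ah_def Ph_def by (simp only: mat_mult_assoc_dim dims)
      also have "W * (transpose_mat V * (P * V)) = P * V"
        by (rule cancel; intro cl)
      finally show ?thesis
        by (simp only: mat_mult_assoc_dim dims)
    qed
    have "transpose_mat (Ah * Ph) = transpose_mat (transpose_mat V * (A * P * V))"
      by (simp only: APh)
    then have PhA: "Ph * transpose_mat Ah = transpose_mat V * (P * transpose_mat A * V)"
      unfolding transpose_mult[OF Ah Ph] Ph_sym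
      by (simp only: transpose_mult_dim mat_mult_assoc_dim transpose_transpose P(2) dims)
    have "Ah * Ph + Ph * transpose_mat Ah + Lh * transpose_mat Lh =
        transpose_mat V * ((A * P + P * transpose_mat A + L * transpose_mat L) * V)"
      unfolding APh PhA Lh_def
      by (simp only: mat_mult_assoc_dim mat_add_mult_distrib_dim mat_mult_add_distrib_dim
          transpose_mult_dim transpose_transpose dims)
    then have P_lyap': "Ah * Ph + Ph * transpose_mat Ah + Lh * transpose_mat Lh = 0\<^sub>m d d"
      unfolding P_lyap by (simp only: mult_zero_mat_dim dims)
    have AQh: "transpose_mat Ah * Qh = transpose_mat W * (transpose_mat A * Q * W)"
    proof -
      have "transpose_mat Ah * Qh = transpose_mat W * (transpose_mat A * (V * (transpose_mat W * (Q * W))))"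
        unfolding Ah_def Qh_def by (simp only: mat_mult_assoc_dim transpose_mult_dim transpose_transpose dims)
      also have "V * (transpose_mat W * (Q * W)) = Q * W"
        by (rule cancel; intro cl)
      finally show ?thesis
        by (simp only: mat_mult_assoc_dim dims)
    qed
    have "transpose_mat (transpose_mat Ah * Qh) = transpose_mat (transpose_mat W * (transpose_mat A * Q * W))"
      by (simp only: AQh)
    then have QhA: "Qh * Ah = transpose_mat W * (Q * A * W)"
      unfolding transpose_mult[OF transpose_carrier_mat[THEN iffD2, OF Ah] Qh] Qh_sym transpose_transpose
      by (simp only: transpose_mult_dim mat_mult_assoc_dim transpose_transpose Q(2) dims)
    have "transpose_mat Ah * Qh + Qh * transpose_mat (transpose_mat Ah) +
        transpose_mat Kh * transpose_mat (transpose_mat Kh) =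
        transpose_mat W * ((transpose_mat A * Q + Q * A + transpose_mat K * K) * W)"
      unfolding AQh QhA Kh_def transpose_transpose
      by (simp only: mat_mult_assoc_dim mat_add_mult_distrib_dim mat_mult_add_distrib_dim
          transpose_mult_dim dims)
    then have Q_lyap': "transpose_mat Ah * Qh + Qh * transpose_mat (transpose_mat Ah) +
        transpose_mat Kh * transpose_mat (transpose_mat Kh) = 0\<^sub>m d d"
      unfolding Q_lyap by (simp only: mult_zero_mat_dim dims)
    have Ah': "transpose_mat Ah \<in> carrier_mat d d" and Kh': "transpose_mat Kh \<in> carrier_mat d p"
      using Ah Kh by auto
    note P_vanish = diagonal_lyapunov_vanish[OF Ah Ph Lh diag(1) P_lyap']
    note Q_vanish = diagonal_lyapunov_vanish[OF Ah' Qh Kh' diag(2) Q_lyap']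
    show "Lh $$ (i, j) = 0" if "i < d" "j < s" "Ph $$ (i, i) = 0" for i j
      using P_vanish(1) that by blast
    show "Ah $$ (i, j) = 0" if "i < d" "j < d" "Ph $$ (i, i) = 0" "\<not> Ph $$ (j, j) = 0" for i j
      using P_vanish(2) that by blast
    show "Kh $$ (i, j) = 0" if "i < p" "j < d" "Qh $$ (j, j) = 0" for i j
      using Q_vanish(1)[of j i] that Kh by simp
    show "Ah $$ (i, j) = 0" if "i < d" "j < d" "Qh $$ (j, j) = 0" "\<not> Qh $$ (i, i) = 0" for i j
      using Q_vanish(2)[of j i] that Ah by simp
    show "Ph $$ (i, i) = 0 \<or> Qh $$ (i, i) = 0" if "r \<le> i" "i < d" for i
    proof -
      have "(Ph * Qh) $$ (i, i) = (\<Sum>l<d. Ph $$ (i, l) * Qh $$ (l, i))"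
        by (rule index_mult_sum[OF Ph Qh that(2,2)])
      also have "\<dots> = (\<Sum>l<d. if l = i then Ph $$ (i, i) * Qh $$ (i, i) else 0)"
        using diag(1) that by (intro sum.cong) (auto simp: diagonal_mat_def)
      finally have "Ph $$ (i, i) * Qh $$ (i, i) = (\<sigma> i)\<^sup>2"
        using that by (simp add: Ph_Qh mat_diag_def)
      then show ?thesis
        using \<sigma>_eq_0_iff[of i] that r by simp
    qed
    have row_eq: "(transpose_mat V\<^sub>r * Y) $$ (i, j) = (transpose_mat V * Y) $$ (i, j)"
      if "Y \<in> carrier_mat d m" "i < r" "j < m" for Y m i j
    proof -
      have "(transpose_mat V\<^sub>r * Y) $$ (i, j) = (\<Sum>l<d. transpose_mat V\<^sub>r $$ (i, l) * Y $$ (l, j))"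
        by (rule index_mult_sum[of _ r d _ m]) (use Vr that in auto)
      also have "\<dots> = (\<Sum>l<d. transpose_mat V $$ (i, l) * Y $$ (l, j))"
        using V that r by (simp add: V\<^sub>r_def take_cols_def)
      also have "\<dots> = (transpose_mat V * Y) $$ (i, j)"
        by (rule index_mult_sum[of _ d d _ m, symmetric]) (use V that r in auto)
      finally show ?thesis .
    qed
    have col_eq: "(Y * W\<^sub>r) $$ (i, j) = (Y * W) $$ (i, j)" if "Y \<in> carrier_mat m d" "i < m" "j < r" for Y m i j
      unfolding W\<^sub>r_def take_cols_mult[OF that(1) W r(2), symmetric] using that by (simp add: take_cols_def)
    show "(transpose_mat V\<^sub>r * A * W\<^sub>r) $$ (i, j) = Ah $$ (i, j)" if "i < r" "j < r" for i j
    proof -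
      have "transpose_mat V\<^sub>r * A * W\<^sub>r = transpose_mat V\<^sub>r * (A * W\<^sub>r)"
        using A Vr Wr by (intro assoc_mult_mat[of _ r d _ d _ r]) auto
      also have "\<dots> $$ (i, j) = (transpose_mat V * (A * W\<^sub>r)) $$ (i, j)"
        using A Wr that by (intro row_eq[of _ r]) auto
      also have "transpose_mat V * (A * W\<^sub>r) = transpose_mat V * A * W\<^sub>r"
        using A V Wr by (intro assoc_mult_mat[of _ d d _ d _ r, symmetric]) auto
      also have "\<dots> $$ (i, j) = Ah $$ (i, j)"
        unfolding Ah_def using A V that r by (intro col_eq[of _ d]) auto
      finally show ?thesis .
    qed
    show "(transpose_mat V\<^sub>r * L) $$ (i, j) = Lh $$ (i, j)" if "i < r" "j < s" for i j
      unfolding Lh_def by (rule row_eq[OF L that])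
    show "(K * W\<^sub>r) $$ (i, j) = Kh $$ (i, j)" if "i < p" "j < r" for i j
      unfolding Kh_def by (rule col_eq[OF K that])
  qed (use A L K Wr Vr r in auto)
  finally show ?thesis .
qed

text \<open>Cyclicity of the trace moves the rectangular factors around until the diagonal matrix
  stands between the discarded columns of \<open>V\<close>, or of \<open>W\<close>, and their
  transpose, where the masked form applies. The rows are those of W^T S, which represents
  \<open>S\<close> in balanced coordinates.\<close>

lemma truncated_trace:
  assumes A: "A \<in> carrier_mat d d" and L: "L \<in> carrier_mat d s" and S: "S \<in> carrier_mat d r"
    and r: "r \<le> d"
  defines "D \<equiv> mat_diag d (\<lambda>i. if r \<le> i then \<sigma> i else 0)"
  shows "mat_trace ((transpose_mat (drop_cols r V) * L * transpose_mat (transpose_mat (drop_cols r V) * L)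
        + 2 \<cdot>\<^sub>m (drop_rows r (transpose_mat W * S) * (transpose_mat (take_cols r V) * A * drop_cols r W)))
        * mat_diag (d - r) (\<lambda>i. \<sigma> (r + i))) =
    mat_trace (V * D * transpose_mat V * (L * transpose_mat L)) +
    2 * mat_trace (S * transpose_mat (take_cols r V) * A * (W * D * transpose_mat W))"
proof -
  define Vb where "Vb = drop_cols r V"
  define Wb where "Wb = drop_cols r W"
  define Vr where "Vr = take_cols r V"
  define D' where "D' = mat_diag (d - r) (\<lambda>i. \<sigma> (r + i))"
  have carr: "Vb \<in> carrier_mat d (d - r)" "Wb \<in> carrier_mat d (d - r)" "Vr \<in> carrier_mat d r"
    "D' \<in> carrier_mat (d - r) (d - r)"
    using V W by (auto simp: Vb_def Wb_def Vr_def D'_def)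
  note dims = mat_dims carrier_matD[OF A] carrier_matD[OF L] carrier_matD[OF S]
    carrier_matD[OF carr(1)] carrier_matD[OF carr(2)] carrier_matD[OF carr(3)] carrier_matD[OF carr(4)]
    carrier_matD[OF V] carrier_matD[OF W]
  have VD: "Vb * D' * transpose_mat Vb = V * D * transpose_mat V"
    unfolding Vb_def D'_def D_def by (rule drop_cols_sandwich[OF V V r])
  have WD: "Wb * D' * transpose_mat Wb = W * D * transpose_mat W"
    unfolding Wb_def D'_def D_def by (rule drop_cols_sandwich[OF W W r])
  let ?Lb = "transpose_mat Vb * L" and ?Sb = "transpose_mat Wb * S" and ?Ab = "transpose_mat Vr * A * Wb"
  let ?n = "d - r"
  have c: "?Lb * transpose_mat ?Lb \<in> carrier_mat ?n ?n" "?Sb * ?Ab \<in> carrier_mat ?n ?n"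
    by (rule carrier_matI; simp only: dims)+
  have "(?Lb * transpose_mat ?Lb + 2 \<cdot>\<^sub>m (?Sb * ?Ab)) * D' =
      ?Lb * transpose_mat ?Lb * D' + (2 \<cdot>\<^sub>m (?Sb * ?Ab)) * D'"
    using c carr by (intro add_mult_distrib_mat[of _ ?n ?n _ _ ?n]) auto
  also have "(2 \<cdot>\<^sub>m (?Sb * ?Ab)) * D' = 2 \<cdot>\<^sub>m (?Sb * ?Ab * D')"
    using c carr by (intro mult_smult_assoc_mat[of _ ?n ?n _ ?n]) auto
  finally have "mat_trace ((?Lb * transpose_mat ?Lb + 2 \<cdot>\<^sub>m (?Sb * ?Ab)) * D') =
      mat_trace (?Lb * transpose_mat ?Lb * D') + 2 * mat_trace (?Sb * ?Ab * D')"
    using c carr by (simp only: mat_trace_add[of _ ?n] mat_trace_smult[of _ ?n] mult_carrier_mat[of _ ?n ?n _ ?n]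
        smult_carrier_mat)
  also have "?Lb * transpose_mat ?Lb * D' = transpose_mat Vb * (L * transpose_mat L * (Vb * D'))"
    by (simp only: mat_mult_assoc_dim transpose_mult_dim transpose_transpose dims)
  also have "mat_trace \<dots> = mat_trace (L * transpose_mat L * (Vb * D') * transpose_mat Vb)"
    by (rule mat_trace_mult_comm[of _ ?n d]) (use carr L in auto)
  also have "L * transpose_mat L * (Vb * D') * transpose_mat Vb = L * transpose_mat L * (V * D * transpose_mat V)"
    unfolding VD[symmetric] by (simp only: mat_mult_assoc_dim dims)
  also have "mat_trace \<dots> = mat_trace (V * D * transpose_mat V * (L * transpose_mat L))"
    by (rule mat_trace_mult_comm[of _ d d]) (use V L in \<open>auto simp: D_def intro!: mult_carrier_mat[of _ d d]\<close>)
  also have "?Sb * ?Ab * D' = transpose_mat Wb * (S * transpose_mat Vr * A * (Wb * D'))"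
    by (simp only: mat_mult_assoc_dim dims)
  also have "mat_trace \<dots> = mat_trace (S * transpose_mat Vr * A * (Wb * D') * transpose_mat Wb)"
    by (rule mat_trace_mult_comm[of _ ?n d]; rule carrier_matI; simp only: dims)
  also have "S * transpose_mat Vr * A * (Wb * D') * transpose_mat Wb =
      S * transpose_mat Vr * A * (W * D * transpose_mat W)"
    unfolding WD[symmetric] by (simp only: mat_mult_assoc_dim dims)
  finally show ?thesis
    unfolding drop_rows_mult[OF W S] Vb_def Wb_def Vr_def D'_def .
qed

end

text \<open>The transpose solves the same equation because the right-hand side is symmetric, and
  uniqueness for a stable matrix makes the difference vanish.\<close>

lemma lyapunov_solution_symmetric:
  fixes A P \<Gamma> :: "real mat"
  assumes A: "A \<in> carrier_mat n n" "stable_mat A" and P: "P \<in> carrier_mat n n"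
    and \<Gamma>: "\<Gamma> \<in> carrier_mat n n" "transpose_mat \<Gamma> = \<Gamma>"
    and eq: "A * P + P * transpose_mat A = - \<Gamma>"
  shows "transpose_mat P = P"
proof -
  let ?A = "transpose_mat A" and ?P = "transpose_mat P"
  note carr = A(1) P transpose_carrier_mat[THEN iffD2, OF A(1)] transpose_carrier_mat[THEN iffD2, OF P]
  note cl = mult_carrier_mat[of _ n n _ n] add_carrier_mat minus_carrier_mat carr
  have "transpose_mat (A * P + P * ?A) = transpose_mat (A * P) + transpose_mat (P * ?A)"
    by (rule transpose_add[of _ n n]; intro cl)
  also have "transpose_mat (A * P) = ?P * ?A"
    by (rule transpose_mult[of _ n n _ n]; intro cl)
  also have "transpose_mat (P * ?A) = A * ?P"
    using transpose_mult[of P n n ?A n] carr by simp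
  also have "?P * ?A + A * ?P = A * ?P + ?P * ?A"
    by (rule comm_add_mat[of _ n n]; intro cl)
  also have "transpose_mat (A * P + P * ?A) = A * P + P * ?A"
    unfolding eq using \<Gamma> by (simp add: transpose_uminus)
  finally have eq': "A * P + P * ?A = A * ?P + ?P * ?A" .
  have "A * (P - ?P) + (P - ?P) * ?A = (A * P - A * ?P) + (P * ?A - ?P * ?A)"
  proof -
    have "A * (P - ?P) = A * P - A * ?P"
      by (rule mult_minus_distrib_mat[of _ n n _ n]; intro cl)
    moreover have "(P - ?P) * ?A = P * ?A - ?P * ?A"
      by (rule minus_mult_distrib_mat[of _ n n _ _ n]; intro cl)
    ultimately show ?thesis
      by simp
  qed
  also have "\<dots> = 0\<^sub>m n n"
  proof (rule eq_matI)
    fix i j assume "i < dim_row (0\<^sub>m n n :: real mat)" "j < dim_col (0\<^sub>m n n :: real mat)"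
    then have ij: "i < n" "j < n"
      by auto
    have "(A * P) $$ (i, j) + (P * ?A) $$ (i, j) = (A * ?P) $$ (i, j) + (?P * ?A) $$ (i, j)"
      using arg_cong[OF eq', of "\<lambda>M. M $$ (i, j)"] ij A P by (simp del: index_mult_mat(1))
    then show "((A * P - A * ?P) + (P * ?A - ?P * ?A)) $$ (i, j) = 0\<^sub>m n n $$ (i, j)"
      using ij A P by (simp del: index_mult_mat(1))
  qed (use A P in auto)
  finally have "A * (P - ?P) + (P - ?P) * ?A = 0\<^sub>m n n" .
  then have "P - ?P = 0\<^sub>m n n"
    by (rule lyapunov_unique[OF A minus_carrier_mat[OF carr(4)]])
  then have diff: "(P - ?P) $$ (i, j) = 0" if "i < n" "j < n" for i j
    using that by simp
  show ?thesis
  proof (rule eq_matI)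
    fix i j assume "i < dim_row P" "j < dim_col P"
    then show "?P $$ (i, j) = P $$ (i, j)"
      using diff[of i j] P by simp
  qed (use P in auto)
qed

section \<open>Responses and quadratic forms as functions of the impulse vector\<close>

lemma impulse_response_eq:
  assumes "G \<in> carrier_mat p p" "C \<in> carrier_mat p n" "A \<in> carrier_mat n n" "B \<in> carrier_mat n s"
    "z \<in> carrier_vec s"
  shows "impulse_response G C A B z t = (G * C) *\<^sub>v (mat_exp (t \<cdot>\<^sub>m A) *\<^sub>v (B *\<^sub>v z))"
proof -
  have E: "mat_exp (t \<cdot>\<^sub>m A) \<in> carrier_mat n n"
    using assms by simp
  have "(G * C * mat_exp (t \<cdot>\<^sub>m A) * B) *\<^sub>v z = (G * C * mat_exp (t \<cdot>\<^sub>m A)) *\<^sub>v (B *\<^sub>v z)"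
    by (rule assoc_mult_mat_vec[of _ p n _ s])
      (use assms in \<open>auto intro!: mult_carrier_mat[OF mult_carrier_mat[OF assms(1,2)] E]\<close>)
  also have "\<dots> = (G * C) *\<^sub>v (mat_exp (t \<cdot>\<^sub>m A) *\<^sub>v (B *\<^sub>v z))"
    by (rule assoc_mult_mat_vec[OF mult_carrier_mat[OF assms(1,2)] E mult_mat_vec_carrier[OF assms(4,5)]])
  finally show ?thesis
    unfolding impulse_response_def .
qed

lemma quadratic_form_pullback:
  fixes L M :: "real mat"
  assumes L: "L \<in> carrier_mat n s" and M: "M \<in> carrier_mat n m" and K: "K \<in> carrier_mat m s"
    and z: "z \<in> carrier_vec s"
  shows "z \<bullet> ((transpose_mat L * M * K) *\<^sub>v z) = (L *\<^sub>v z) \<bullet> (M *\<^sub>v (K *\<^sub>v z))"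
proof -
  have "transpose_mat L * M * K = transpose_mat L * (M * K)"
    using L M K by (intro assoc_mult_mat[of _ s n _ m _ s]) auto
  then have "z \<bullet> ((transpose_mat L * M * K) *\<^sub>v z) = (L *\<^sub>v z) \<bullet> ((M * K) *\<^sub>v z)"
    using bilinear_transpose_mult[OF L mult_carrier_mat[OF M K] z z] by simp
  also have "(M * K) *\<^sub>v z = M *\<^sub>v (K *\<^sub>v z)"
    by (rule assoc_mult_mat_vec[OF M K z])
  finally show ?thesis .
qed

subsection \<open>The error bound\<close>

text \<open>The comparison takes place in \<open>ereal\<close>, where a negative right-hand side
  stays negative, whereas \<open>ennreal\<close> would clip it to 0. The bound thus also asserts
  that its right-hand side is nonnegative.\<close>

theorem proposition3p5:
  fixes d p s r :: nat
    and A C \<Gamma>\<^sub>\<epsilon> \<Gamma>\<^sub>\<epsilon>_inv \<Gamma>\<^sub>\<epsilon>_inv_sqrt \<Gamma>\<^sub>p\<^sub>r L\<^sub>p\<^sub>r P Q W V :: "real mat"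
    and \<sigma> :: "nat \<Rightarrow> real"
    and W\<^sub>r V\<^sub>r A\<^sub>r L\<^sub>r C\<^sub>r S S_bar V_bar W_bar \<Sigma>_bar L_bar A_bar :: "real mat"
    and M :: "'w measure" and z :: "'w \<Rightarrow> real vec"
  assumes A: "A \<in> carrier_mat d d" "stable_mat A"
    and C: "C \<in> carrier_mat p d"
    and noise: "sym_pd p \<Gamma>\<^sub>\<epsilon>"
    and noise_inv: "\<Gamma>\<^sub>\<epsilon>_inv \<in> carrier_mat p p"
      "inverts_mat \<Gamma>\<^sub>\<epsilon> \<Gamma>\<^sub>\<epsilon>_inv" "inverts_mat \<Gamma>\<^sub>\<epsilon>_inv \<Gamma>\<^sub>\<epsilon>"
    and noise_inv_sqrt: "sym_pd p \<Gamma>\<^sub>\<epsilon>_inv_sqrt" "\<Gamma>\<^sub>\<epsilon>_inv_sqrt * \<Gamma>\<^sub>\<epsilon>_inv_sqrt = \<Gamma>\<^sub>\<epsilon>_inv"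
    and prior: "sym_psd d \<Gamma>\<^sub>p\<^sub>r" "vec_space.rank d \<Gamma>\<^sub>p\<^sub>r = s"
      "L\<^sub>p\<^sub>r \<in> carrier_mat d s" "\<Gamma>\<^sub>p\<^sub>r = L\<^sub>p\<^sub>r * transpose_mat L\<^sub>p\<^sub>r"
    and P: "P \<in> carrier_mat d d" "A * P + P * transpose_mat A = - \<Gamma>\<^sub>p\<^sub>r"
    and Q: "Q = obs_gramian A C \<Gamma>\<^sub>\<epsilon>_inv"
    and hankel: "hankel_singular_values d P Q \<sigma>"
    and balancing: "balancing_bases d P Q \<sigma> W V"
    and r: "r \<le> s"
    and r_beyond_q: "num_nonzero d \<sigma> < r \<longrightarrow>
      diagonal_mat (transpose_mat V * P * V) \<and> diagonal_mat (transpose_mat W * Q * W)"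
    and bases_r: "W\<^sub>r = take_cols r W" "V\<^sub>r = take_cols r V"
    and reduced: "A\<^sub>r = transpose_mat V\<^sub>r * A * W\<^sub>r" "L\<^sub>r = transpose_mat V\<^sub>r * L\<^sub>p\<^sub>r" "C\<^sub>r = C * W\<^sub>r"
    and sylvester: "S \<in> carrier_mat d r"
      "transpose_mat A * S + S * A\<^sub>r + transpose_mat C * \<Gamma>\<^sub>\<epsilon>_inv * C\<^sub>r = 0\<^sub>m d r"
    and S_bar: "S_bar = drop_rows r (transpose_mat W * S)"
    and bases_bar: "V_bar = drop_cols r V" "W_bar = drop_cols r W"
    and \<Sigma>_bar: "\<Sigma>_bar = mat_diag (d - r) (\<lambda>i. \<sigma> (r + i))"
    and L_bar: "L_bar = transpose_mat V_bar * L\<^sub>p\<^sub>r"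
    and A_bar: "A_bar = transpose_mat V\<^sub>r * A * W_bar"
    and z: "std_normal_vector s M z"
  shows "enn2ereal (\<integral>\<^sup>+\<omega>. L2_norm_sq (\<lambda>t.
             impulse_response \<Gamma>\<^sub>\<epsilon>_inv_sqrt C A L\<^sub>p\<^sub>r (z \<omega>) t
             - impulse_response \<Gamma>\<^sub>\<epsilon>_inv_sqrt C\<^sub>r A\<^sub>r L\<^sub>r (z \<omega>) t) \<partial>M)
         \<le> ereal (real s *
             mat_trace ((L_bar * transpose_mat L_bar + 2 \<cdot>\<^sub>m (S_bar * A_bar)) * \<Sigma>_bar))"
proof -
  let ?G = "\<Gamma>\<^sub>\<epsilon>_inv_sqrt"
  \<comment> \<open>The output map whitened by the noise. The root is symmetric and squares to the
    inverse covariance, so the weighted terms with \<open>C\<close> become the products K^T K and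
    K^T (K W_r) of the energy balance.\<close>
  define K where "K = ?G * C"
  have G: "?G \<in> carrier_mat p p" "transpose_mat ?G = ?G"
    using noise_inv_sqrt(1) by (auto simp: sym_pd_def)
  have K: "K \<in> carrier_mat p d"
    unfolding K_def using G C by simp
  note L = prior(3)
  have \<Gamma>: "\<Gamma>\<^sub>p\<^sub>r \<in> carrier_mat d d" "transpose_mat \<Gamma>\<^sub>p\<^sub>r = \<Gamma>\<^sub>p\<^sub>r"
    using prior(1) by (auto simp: sym_psd_def)
  have N_sym: "transpose_mat \<Gamma>\<^sub>\<epsilon>_inv = \<Gamma>\<^sub>\<epsilon>_inv"
    using transpose_mult[OF G(1) G(1)] by (simp add: G noise_inv_sqrt(2))
  have N_K: "transpose_mat C * \<Gamma>\<^sub>\<epsilon>_inv * X = transpose_mat K * (?G * X)" if "dim_row X = p" for X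
    unfolding K_def noise_inv_sqrt(2)[symmetric] using that
    by (simp only: mat_mult_assoc_dim transpose_mult_dim G(2) mat_dims carrier_matD[OF G(1)] carrier_matD[OF C])
  note gramian = obs_gramian_lyapunov[OF A C noise_inv(1), folded Q]
  have Q_lyap: "transpose_mat A * Q + Q * A + transpose_mat K * K = 0\<^sub>m d d"
    using gramian(1) unfolding N_K[OF carrier_matD(1)[OF C]] K_def[symmetric] .
  have P_sym: "transpose_mat P = P"
    by (rule lyapunov_solution_symmetric[OF A P(1) \<Gamma> P(2)])
  have P_lyap: "A * P + P * transpose_mat A + L\<^sub>p\<^sub>r * transpose_mat L\<^sub>p\<^sub>r = 0\<^sub>m d d"
    unfolding P(2) prior(4)[symmetric] using \<Gamma>(1) by (rule uminus_l_inv_mat)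
  interpret balanced d P Q \<sigma> W V
    using P(1) P_sym gramian(2) gramian(3)[OF N_sym] hankel balancing
    by unfold_locales (auto simp: hankel_singular_values_def)
  have "s \<le> d"
    using vec_space.rank_le_nc[OF \<Gamma>(1)] prior(2) by simp
  with r have r_d: "r \<le> d"
    by simp
  have Wr: "W\<^sub>r \<in> carrier_mat d r" and Vr: "V\<^sub>r \<in> carrier_mat d r"
    using W V by (auto simp: bases_r)
  have Ar: "A\<^sub>r \<in> carrier_mat r r" and Lr: "L\<^sub>r \<in> carrier_mat r s" and Cr: "C\<^sub>r \<in> carrier_mat p r"
    using A(1) C L Wr Vr by (auto simp: reduced)
  have J: "?G * C\<^sub>r = K * W\<^sub>r"
    unfolding reduced K_def by (rule assoc_mult_mat[OF G(1) C Wr, symmetric])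
  have z_carrier: "z \<omega> \<in> carrier_vec s" if "\<omega> \<in> space M" for \<omega>
    using z that by (simp add: std_normal_vector_def)
  let ?err = "\<lambda>\<omega> t. impulse_response ?G C A L\<^sub>p\<^sub>r (z \<omega>) t - impulse_response ?G C\<^sub>r A\<^sub>r L\<^sub>r (z \<omega>) t"
  let ?rhs = "mat_trace ((L_bar * transpose_mat L_bar + 2 \<cdot>\<^sub>m (S_bar * A_bar)) * \<Sigma>_bar)"
  have Lbar: "L_bar * transpose_mat L_bar + 2 \<cdot>\<^sub>m (S_bar * A_bar) \<in> carrier_mat (d - r) (d - r)"
    using A(1) L sylvester(1) W V Vr
    by (intro carrier_matI) (auto simp: L_bar S_bar A_bar bases_bar drop_cols_def drop_rows_def)
  show ?thesis
  proof (cases "r \<le> q")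
    case True
    let ?D = "mat_diag r \<sigma>"
    have D: "?D \<in> carrier_mat r r"
      by simp
    have S_eq: "transpose_mat A * S + S * A\<^sub>r + transpose_mat K * (K * W\<^sub>r) = 0\<^sub>m d r"
      using sylvester(2) unfolding N_K[OF carrier_matD(1)[OF Cr]] J .
    have D_eq: "transpose_mat A\<^sub>r * ?D + ?D * A\<^sub>r + transpose_mat (K * W\<^sub>r) * (K * W\<^sub>r) = 0\<^sub>m r r"
      using truncated_observability_lyapunov[OF A(1) K Q_lyap True] unfolding reduced bases_r .
    \<comment> \<open>The initial states L z and L_r z make the initial storage a quadratic form in
      z with matrix \<open>X\<close>. The cross term is kept unsymmetrized, which changes neither
      the form nor the trace.\<close>
    define X1 where "X1 = transpose_mat L\<^sub>p\<^sub>r * Q * L\<^sub>p\<^sub>r"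
    define X2 where "X2 = transpose_mat L\<^sub>r * ?D * L\<^sub>r"
    define X3 where "X3 = transpose_mat L\<^sub>p\<^sub>r * S * L\<^sub>r"
    define X where "X = X1 + X2 + (- 2) \<cdot>\<^sub>m X3"
    have Xs: "X1 \<in> carrier_mat s s" "X2 \<in> carrier_mat s s" "X3 \<in> carrier_mat s s"
      unfolding X1_def X2_def X3_def
      by (rule carrier_matI; simp only: mat_dims carrier_matD[OF L] carrier_matD[OF Lr])+
    then have X: "X \<in> carrier_mat s s"
      unfolding X_def by simp
    have quad: "v \<bullet> (X *\<^sub>v v) = (L\<^sub>p\<^sub>r *\<^sub>v v) \<bullet> (Q *\<^sub>v (L\<^sub>p\<^sub>r *\<^sub>v v)) + (L\<^sub>r *\<^sub>v v) \<bullet> (?D *\<^sub>v (L\<^sub>r *\<^sub>v v))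
        - 2 * ((L\<^sub>p\<^sub>r *\<^sub>v v) \<bullet> (S *\<^sub>v (L\<^sub>r *\<^sub>v v)))" if v: "v \<in> carrier_vec s" for v
    proof -
      have Xv: "X1 *\<^sub>v v \<in> carrier_vec s" "X2 *\<^sub>v v \<in> carrier_vec s" "X3 *\<^sub>v v \<in> carrier_vec s"
        using mult_mat_vec_carrier[OF Xs(1) v] mult_mat_vec_carrier[OF Xs(2) v] mult_mat_vec_carrier[OF Xs(3) v] .
      have "((- 2) \<cdot>\<^sub>m X3) *\<^sub>v v = (- 2) \<cdot>\<^sub>v (X3 *\<^sub>v v)"
        using Xs v by (intro eq_vecI) auto
      then have "X *\<^sub>v v = X1 *\<^sub>v v + X2 *\<^sub>v v + (- 2) \<cdot>\<^sub>v (X3 *\<^sub>v v)"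
        unfolding X_def using Xs v
        by (simp only: add_mult_distrib_mat_vec[of _ s s] add_carrier_mat smult_carrier_mat)
      then have "v \<bullet> (X *\<^sub>v v) = v \<bullet> (X1 *\<^sub>v v) + v \<bullet> (X2 *\<^sub>v v) - 2 * (v \<bullet> (X3 *\<^sub>v v))"
        using Xv v
        by (simp only: scalar_prod_add_distrib[of _ s] scalar_prod_smult_distrib[of _ s] add_carrier_vec
            smult_carrier_vec)
      then show ?thesis
        unfolding X1_def X2_def X3_def quadratic_form_pullback[OF L Q(1) L v]
          quadratic_form_pullback[OF Lr D Lr v] quadratic_form_pullback[OF L sylvester(1) Lr v] .
    qed
    have pos: "\<sigma> i > 0" if "i < r" for i
      using \<sigma>_pos[of i] that True by simp
    note energy = output_error_energy[OF A Ar K mult_carrier_mat[OF K Wr] Q(1) sylvester(1) pos Q_lyap D_eq S_eq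
        mult_mat_vec_carrier[OF L] mult_mat_vec_carrier[OF Lr]]
    have nonneg: "0 \<le> v \<bullet> (X *\<^sub>v v)" if "v \<in> carrier_vec s" for v
      unfolding quad[OF that] by (rule energy(1)[OF _ that that])
    have "L2_norm_sq (?err \<omega>) \<le> ennreal (z \<omega> \<bullet> (X *\<^sub>v z \<omega>))" if "\<omega> \<in> space M" for \<omega>
      unfolding quad[OF z_carrier[OF that]] impulse_response_eq[OF G(1) C A(1) L z_carrier[OF that]]
        impulse_response_eq[OF G(1) Cr Ar Lr z_carrier[OF that]] J K_def[symmetric]
      by (rule energy(2)[OF _ z_carrier[OF that] z_carrier[OF that]])
    then have "(\<integral>\<^sup>+\<omega>. L2_norm_sq (?err \<omega>) \<partial>M) \<le> (\<integral>\<^sup>+\<omega>. ennreal (z \<omega> \<bullet> (X *\<^sub>v z \<omega>)) \<partial>M)"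
      by (intro nn_integral_mono)
    also have "\<dots> = ennreal (mat_trace X)"
      by (rule nn_integral_std_normal_quadratic_form[OF z X nonneg])
    finally have bound: "(\<integral>\<^sup>+\<omega>. L2_norm_sq (?err \<omega>) \<partial>M) \<le> ennreal (mat_trace X)" .
    have "mat_trace X = mat_trace X1 + mat_trace X2 - 2 * mat_trace X3"
      unfolding X_def using Xs by (simp add: mat_trace_add[of _ s] mat_trace_smult[of _ s])
    also have "\<dots> = ?rhs"
      unfolding X1_def X2_def X3_def
      using truncated_energy_trace[OF A(1) L K P_lyap Q_lyap True sylvester(1), folded bases_r,
          folded reduced, OF S_eq]
        truncated_trace[OF A(1) L sylvester(1) r_d, folded bases_r bases_bar,
          folded L_bar S_bar A_bar \<Sigma>_bar]
      by (simp only:)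
    finally have trace: "mat_trace X = ?rhs" .
    have X_nonneg: "0 \<le> mat_trace X"
      by (rule mat_trace_nonneg[OF X nonneg])
    \<comment> \<open>The factor s enters only here: for s \<ge> 1 it enlarges a nonnegative trace,
      and for s = 0 the trace is an empty sum.\<close>
    have "mat_trace X \<le> real s * mat_trace X"
    proof (cases "s = 0")
      case True
      then show ?thesis
        using X by (simp add: mat_trace_def)
    next
      case False
      then show ?thesis
        using X_nonneg mult_right_mono[of 1 "real s" "mat_trace X"] by simp
    qed
    then have "ennreal (mat_trace X) \<le> ennreal (real s * mat_trace X)"
      by (rule ennreal_leI)
    with bound have "(\<integral>\<^sup>+\<omega>. L2_norm_sq (?err \<omega>) \<partial>M) \<le> ennreal (real s * mat_trace X)"
      by (rule order_trans)
    then show ?thesis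
      using X_nonneg unfolding trace[symmetric] less_eq_ennreal.rep_eq by simp
  next
    case False
    then have diag: "diagonal_mat Ph" "diagonal_mat Qh"
      using r_beyond_q by (auto simp: Ph_def Qh_def q_def)
    have markov: "K * A ^\<^sub>m k * L\<^sub>p\<^sub>r = K * W\<^sub>r * A\<^sub>r ^\<^sub>m k * L\<^sub>r" for k
      unfolding reduced bases_r
      by (rule truncated_markov_parameters[OF A(1) L K P_lyap Q_lyap _ r_d diag]) (use False in simp)
    have response: "K * mat_exp (t \<cdot>\<^sub>m A) * L\<^sub>p\<^sub>r = K * W\<^sub>r * mat_exp (t \<cdot>\<^sub>m A\<^sub>r) * L\<^sub>r" for t
      by (rule impulse_response_eq_if_markov_eq[OF A(1) L K Ar Lr mult_carrier_mat[OF K Wr] markov])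
    have "?err \<omega> t = 0\<^sub>v p" for \<omega> t
      unfolding impulse_response_def J K_def[symmetric] response using K by (intro eq_vecI) auto
    then have lhs: "(\<integral>\<^sup>+\<omega>. L2_norm_sq (?err \<omega>) \<partial>M) = 0"
      by (simp add: L2_norm_sq_def)
    have "\<Sigma>_bar = 0\<^sub>m (d - r) (d - r)"
      unfolding \<Sigma>_bar using \<sigma>_eq_0_iff False by (intro eq_matI) (auto simp: mat_diag_def)
    then have "?rhs = 0"
      using right_mult_zero_mat[OF Lbar, of "d - r"] by simp
    then show ?thesis
      unfolding lhs by (simp add: zero_ennreal.rep_eq)
  qed
qed

end
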